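(* Let $K\colon\mathbb{R}^{2}\to\mathbb{R}$ be a continuous function such that: (1) $K(x,y)=K_0+K_1(x,y)$ with $K_0\in\mathbb{R}\setminus\{0\}$ and $K_1(x,y)\to 0$ as $|(x,y)|\to\infty$; (2) there exist $r>0$ and a nonempty open interval (arc) $I\subset\mathbb{S}^1$ such that $K_0K_1(z)>0$ for all $z\in\mathbb{R}^2$ with $|z|>r$ and $\mathrm{arg}(z)\in I$. Then for almost every $\lambda\in\mathbb{R}\setminus\{0\}$ (with respect to Lebesgue measure) there exists a $\lambda K$-loop.
   Context: Write $i$ for the rotation of $\mathbb{R}^2$ by $\frac{\pi}{2}$. A planar closed parametric curve is the image $\mathcal{C}$ of a nonconstant, periodic, continuous map $u\colon\mathbb{R}\to\mathbb{R}^{2}$; a parametrization $u$ of $\mathcal{C}$ is regular if $u$ is of class $C^1$ and $\dot u(t)\neq 0$ for every $t\in\mathbb{R}$. If $u$ is a regular parametrization of class $C^2$, the curvature is $\kappa(t)=\dfrac{\ddot u(t)\cdot i\dot u(t)}{|\dot u(t)|^{3}}$. For a continuous function $F\colon\mathbb{R}^2\to\mathbb{R}$, an $F$-loop is a planar closed curve admitting a regular (periodic) parametrization $u$ of class $C^2$ such that $\kappa(t)=F(u(t))$ for every $t\in\mathbb{R}$. A $\lambda K$-loop is an $F$-loop with $F=\lambda K$. Arguments of nonzero vectors are regarded as points of the unit circle, i.e. $\mathrm{arg}(z)\in I$ means $z/|z|\in I$. *)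

theory Defs
  imports "HOL-Analysis.Analysis"
begin

definition rot90 :: "real ^ 2 \<Rightarrow> real ^ 2" where
  "rot90 v = vector [- (v $ 2), v $ 1]"

definition parametrizes :: "(real \<Rightarrow> real ^ 2) \<Rightarrow> (real ^ 2) set \<Rightarrow> bool" where
  "parametrizes u C \<longleftrightarrow>
     continuous_on UNIV u \<and>
     (\<exists>T>0. \<forall>t. u (t + T) = u t) \<and>
     (\<exists>s t. u s \<noteq> u t) \<and>
     C = range u"

definition planar_closed_curve :: "(real ^ 2) set \<Rightarrow> bool" where
  "planar_closed_curve C \<longleftrightarrow> (\<exists>u. parametrizes u C)"

definition velocity :: "(real \<Rightarrow> real ^ 2) \<Rightarrow> real \<Rightarrow> real ^ 2" where
  "velocity u t = vector_derivative u (at t)"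

definition acceleration :: "(real \<Rightarrow> real ^ 2) \<Rightarrow> real \<Rightarrow> real ^ 2" where
  "acceleration u t = vector_derivative (velocity u) (at t)"

definition regular :: "(real \<Rightarrow> real ^ 2) \<Rightarrow> bool" where
  "regular u \<longleftrightarrow> u C1_differentiable_on UNIV \<and> (\<forall>t. velocity u t \<noteq> 0)"

definition class_C2 :: "(real \<Rightarrow> real ^ 2) \<Rightarrow> bool" where
  "class_C2 u \<longleftrightarrow>
     u C1_differentiable_on UNIV \<and> velocity u C1_differentiable_on UNIV"

definition curvature :: "(real \<Rightarrow> real ^ 2) \<Rightarrow> real \<Rightarrow> real" where
  "curvature u t =
     (acceleration u t \<bullet> rot90 (velocity u t)) / norm (velocity u t) ^ 3"

definition F_loop :: "(real ^ 2 \<Rightarrow> real) \<Rightarrow> (real ^ 2) set \<Rightarrow> bool" where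
  "F_loop F C \<longleftrightarrow>
     planar_closed_curve C \<and>
     (\<exists>u. parametrizes u C \<and> regular u \<and> class_C2 u \<and>
          (\<forall>t. curvature u t = F (u t)))"

text \<open>An open interval of the unit circle is a connected, relatively open subset; the
  full circle is thereby included as an extreme case.\<close>

definition open_arc :: "(real ^ 2) set \<Rightarrow> bool" where
  "open_arc I \<longleftrightarrow> openin (top_of_set (sphere 0 1)) I \<and> connected I"

end

theory Submission
  imports Defs "HOL-Complex_Analysis.Great_Picard"
begin

text \<open>Loops of curvature \<open>\<lambda> K\<close> are critical points of length minus \<open>\<lambda>\<close> times the algebraic area weighted
by \<open>K\<close>. Divided by \<open>\<lambda>\<close>, with \<open>\<theta> = 1 / \<lambda>\<close>, this is the \<open>action\<close> \<open>\<theta> L - A\<close>, where \<open>L\<close> is the square root of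
the Dirichlet integral: it is at least the length, and its critical points have constant speed.
Replacing \<open>K\<close> by \<open>- K\<close>, and a loop by the reversed loop, one may take \<open>K\<^sub>0\<close> and \<open>\<theta>\<close> positive.
The plane is identified with the complex numbers. A loop is a base point \<open>p\<close> together with a
continuous velocity \<open>v\<close> on \<open>[0, 1]\<close> of mean zero; the velocity need not match at the end points, so
the loops form a vector space that contains the gradient of the action.

Small loops have positive action because \<open>\<bar>A\<bar> \<le> k L\<^sup>2 / 2\<close> when \<open>\<bar>K\<bar> \<le> k\<close>, while large circles have negative
action, so there is a mountain pass \<open>level\<close>. Two things can prevent it from being a critical value.

First, almost critical loops at that level may have unbounded length. The level is nondecreasing
in \<open>\<theta>\<close>, hence for almost every \<open>\<theta>\<close> its difference quotients do not tend to infinity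
(\<open>mono_AE_bounded_difference_quotients\<close>, by Fatou's lemma). At such a \<open>\<theta>\<close>, compare a nearly
optimal path for \<open>\<theta> + h\<close> with the level at \<open>\<theta>\<close>: near the top of the path, \<open>h L\<close> is at most a
constant times \<open>h\<close>. This is Struwe's monotonicity trick. If no short loop near the level were almost
critical, one explicit step along the negative gradient would push the whole path below the level
(\<open>almost_critical_loops\<close>).

Second, almost critical loops may run off to infinity. Bounded length gives compactness up to
translation (\<open>almost_critical_loops_converge\<close>), so a subsequence converges, after translation, to a
critical loop either of a translate of \<open>K\<close> or of the constant \<open>K\<^sub>0\<close>. In the latter case the limit is a
circle, possibly covered several times, of action at least \<open>\<pi> \<theta>\<^sup>2 / K\<^sub>0\<close> (\<open>circle_action_ge\<close>). But a
sector in which \<open>K > K\<^sub>0\<close> contains discs of every size, and the path of concentric circles that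
fills such a disc stays strictly below this value (\<open>mountain_path_of_circles\<close>). Hence the loops stay
in a bounded region, and their limit has curvature \<open>K / \<theta>\<close>.

Differentiability of the weighted area for merely continuous \<open>K\<close> is the one analytic point that
needs care: \<open>area\<close> is defined by contracting a loop to its base point, and \<open>area_diff\<close> shows that it
changes along any segment of loops by the integral of the expected first variation.\<close>

section \<open>Integrals over the unit interval\<close>

definition wedge :: "complex \<Rightarrow> complex \<Rightarrow> real" where
  "wedge a b = Re a * Im b - Im a * Re b"

lemma abs_wedge_le: "\<bar>wedge a b\<bar> \<le> norm a * norm b"
proof -
  have "wedge a b = Im (cnj a * b)" by (simp add: wedge_def)
  also have "\<bar>\<dots>\<bar> \<le> norm (cnj a * b)" by (rule abs_Im_le_cmod)
  finally show ?thesis by (simp add: norm_mult)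
qed

lemma bounded_bilinear_wedge: "bounded_bilinear wedge"
proof
  show "\<exists>K. \<forall>a b. norm (wedge a b) \<le> norm a * norm b * K"
    using abs_wedge_le by (intro exI[of _ 1]) auto
qed (simp_all add: wedge_def algebra_simps)

lemmas continuous_on_wedge [continuous_intros] =
  bounded_bilinear.continuous_on[OF bounded_bilinear_wedge]

lemma wedge_scaleR [simp]: "wedge (c *\<^sub>R a) b = c * wedge a b" "wedge a (c *\<^sub>R b) = c * wedge a b"
  by (simp_all add: wedge_def algebra_simps)

lemma wedge_add: "wedge (a + a') b = wedge a b + wedge a' b" "wedge a (b + b') = wedge a b + wedge a b'"
  by (simp_all add: wedge_def algebra_simps)

lemma wedge_inner: "wedge a b = - (a \<bullet> (\<i> * b))"
  by (simp add: wedge_def inner_complex_def)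

lemma integrable_unit: "continuous_on {0..1} f \<Longrightarrow> f integrable_on {0..1::real}"
  for f :: "real \<Rightarrow> 'a::banach"
  by (rule integrable_continuous_real)

lemma integral_unit_mono:
  fixes f g :: "real \<Rightarrow> real"
  assumes "continuous_on {0..1} f" "continuous_on {0..1} g" "\<And>t. t \<in> {0..1} \<Longrightarrow> f t \<le> g t"
  shows "integral {0..1} f \<le> integral {0..1} g"
  using assms by (intro integral_le integrable_unit) auto

lemma norm_integral_unit_le:
  fixes f :: "real \<Rightarrow> 'a::euclidean_space"
  assumes "continuous_on {0..1} f" "continuous_on {0..1} g" "\<And>t. t \<in> {0..1} \<Longrightarrow> norm (f t) \<le> g t"
  shows "norm (integral {0..1} f) \<le> integral {0..1} g"
  using assms by (intro integral_norm_bound_integral integrable_unit) auto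

lemma norm_integral_unit_le_const:
  fixes f :: "real \<Rightarrow> 'a::euclidean_space"
  assumes "continuous_on {0..1} f" "\<And>t. t \<in> {0..1} \<Longrightarrow> norm (f t) \<le> c"
  shows "norm (integral {0..1} f) \<le> c"
  using norm_integral_unit_le[of f "\<lambda>_. c"] assms by simp

lemma square_integral_le:
  fixes f :: "real \<Rightarrow> real"
  assumes "continuous_on {0..1} f"
  shows "(integral {0..1} f)\<^sup>2 \<le> integral {0..1} (\<lambda>t. (f t)\<^sup>2)"
proof -
  define m where "m = integral {0..1} f"
  have "0 \<le> integral {0..1} (\<lambda>t. (f t - m)\<^sup>2)"
    by (rule integral_nonneg) (use assms in \<open>auto intro!: integrable_unit continuous_intros\<close>)
  also have "(\<lambda>t. (f t - m)\<^sup>2) = (\<lambda>t. (f t)\<^sup>2 - 2 * m * f t + m\<^sup>2)"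
    by (auto simp: power2_eq_square algebra_simps)
  also have "integral {0..1} \<dots> = integral {0..1} (\<lambda>t. (f t)\<^sup>2) - 2 * m * m + m\<^sup>2"
    using assms
    by (simp add: integral_add integral_diff integrable_unit continuous_intros m_def)
  finally show ?thesis by (simp add: m_def power2_eq_square)
qed

section \<open>The Dirichlet length\<close>

text \<open>The square root of the Dirichlet integral. It dominates the length of the loop and agrees with it
exactly at constant speed.\<close>

definition len :: "(real \<Rightarrow> complex) \<Rightarrow> real" where
  "len v = sqrt (integral {0..1} (\<lambda>t. (norm (v t))\<^sup>2))"

lemma len_square: "continuous_on {0..1} v \<Longrightarrow> (len v)\<^sup>2 = integral {0..1} (\<lambda>t. (norm (v t))\<^sup>2)"
  unfolding len_def
  by (simp, rule integral_nonneg) (auto intro!: integrable_unit continuous_intros)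

lemma len_nonneg: "continuous_on {0..1} v \<Longrightarrow> 0 \<le> len v"
  unfolding len_def
  by (simp, rule integral_nonneg) (auto intro!: integrable_unit continuous_intros)

lemma integral_norm_le_len:
  assumes "continuous_on {0..1} v"
  shows "integral {0..1} (\<lambda>t. norm (v t)) \<le> len v"
  unfolding len_def
  by (rule real_le_rsqrt, rule square_integral_le) (intro continuous_intros assms)

lemma len_scaleR: "len (\<lambda>t. c *\<^sub>R v t) = \<bar>c\<bar> * len v"
  by (simp add: len_def power_mult_distrib real_sqrt_mult)

lemma len_le_const:
  assumes "continuous_on {0..1} v" "\<And>t. t \<in> {0..1} \<Longrightarrow> norm (v t) \<le> c"
  shows "len v \<le> c"
proof -
  have c: "0 \<le> c" using assms(2)[of 0] norm_ge_zero[of "v 0"] by (simp del: norm_ge_zero)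
  have "integral {0..1} (\<lambda>t. (norm (v t))\<^sup>2) \<le> integral {0..1} (\<lambda>t::real. c\<^sup>2)"
    by (rule integral_unit_mono) (use assms in \<open>auto intro!: continuous_intros power_mono\<close>)
  then have "len v \<le> sqrt (c\<^sup>2)" unfolding len_def by (intro real_sqrt_le_mono) simp
  then show ?thesis using c by simp
qed

text \<open>The square root is concave, so it lies below its tangent line: the first-order expansion of the
length overestimates it up to an explicit quadratic term.\<close>

lemma len_add_le:
  assumes v: "continuous_on {0..1} v" and w: "continuous_on {0..1} w" and L: "0 < len v"
  shows "len (\<lambda>t. v t + w t)
    \<le> len v + integral {0..1} (\<lambda>t. v t \<bullet> w t) / len v + (len w)\<^sup>2 / (2 * len v)"
proof -
  define i where "i = integral {0..1} (\<lambda>t. v t \<bullet> w t)"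
  have vw: "continuous_on {0..1} (\<lambda>t. v t + w t)" using v w by (intro continuous_intros)
  have "(len (\<lambda>t. v t + w t))\<^sup>2 = integral {0..1} (\<lambda>t. (norm (v t))\<^sup>2 + 2 * (v t \<bullet> w t) + (norm (w t))\<^sup>2)"
    unfolding len_square[OF vw] by (simp add: power2_norm_eq_inner inner_add inner_commute algebra_simps)
  also have "\<dots> = (len v)\<^sup>2 + 2 * i + (len w)\<^sup>2"
    unfolding len_square[OF v] len_square[OF w] i_def using v w
    by (simp add: integral_add integrable_unit continuous_intros)
  finally have *: "(len (\<lambda>t. v t + w t))\<^sup>2 = (len v)\<^sup>2 + 2 * i + (len w)\<^sup>2" .
  have "0 \<le> (len (\<lambda>t. v t + w t) - len v)\<^sup>2" by simp
  then have "2 * len v * len (\<lambda>t. v t + w t) \<le> (len v)\<^sup>2 * 2 + 2 * i + (len w)\<^sup>2"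
    using * by (simp add: power2_eq_square algebra_simps)
  then have "len (\<lambda>t. v t + w t) \<le> ((len v)\<^sup>2 * 2 + 2 * i + (len w)\<^sup>2) / (2 * len v)"
    using L by (subst pos_le_divide_eq) (simp_all add: mult.commute)
  also have "\<dots> = len v + i / len v + (len w)\<^sup>2 / (2 * len v)"
    using L by (simp add: field_simps power2_eq_square)
  finally show ?thesis unfolding i_def .
qed

section \<open>Loops given by their velocities\<close>

definition prim :: "(real \<Rightarrow> complex) \<Rightarrow> real \<Rightarrow> complex" where
  "prim v t = integral {0..t} v"

lemma prim_0 [simp]: "prim v 0 = 0"
  by (simp add: prim_def)

lemma prim_deriv:
  "continuous_on {0..1} v \<Longrightarrow> t \<in> {0..1} \<Longrightarrow> (prim v has_vector_derivative v t) (at t within {0..1})"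
  unfolding prim_def by (rule integral_has_vector_derivative)

lemma prim_cont: "continuous_on {0..1} v \<Longrightarrow> continuous_on {0..1} (prim v)"
  using has_vector_derivative_continuous[OF prim_deriv] by (auto simp: continuous_on_eq_continuous_within)

lemma integrable_sub:
  "continuous_on {0..1} v \<Longrightarrow> t \<in> {0..1} \<Longrightarrow> v integrable_on {0..t::real}"
  for v :: "real \<Rightarrow> 'a::banach"
  by (rule integrable_continuous_real, erule continuous_on_subset) auto

lemma prim_add:
  "continuous_on {0..1} v \<Longrightarrow> continuous_on {0..1} w \<Longrightarrow> t \<in> {0..1} \<Longrightarrow>
   prim (\<lambda>t. v t + w t) t = prim v t + prim w t"
  unfolding prim_def by (intro integral_add integrable_sub)

lemma prim_scaleR [simp]: "prim (\<lambda>t. c *\<^sub>R v t) t = c *\<^sub>R prim v t"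
  by (simp add: prim_def)

lemma norm_prim_le:
  assumes "continuous_on {0..1} v" "t \<in> {0..1}"
  shows "norm (prim v t) \<le> len v"
proof -
  have n: "continuous_on {0..1} (\<lambda>t. norm (v t))" by (intro continuous_intros assms)
  have "norm (prim v t) \<le> integral {0..t} (\<lambda>t. norm (v t))"
    unfolding prim_def by (intro integral_norm_bound_integral integrable_sub assms n) simp
  also have "\<dots> \<le> integral {0..1} (\<lambda>t. norm (v t))"
    by (rule integral_subset_le) (use assms in \<open>auto intro!: integrable_sub n integrable_unit\<close>)
  also have "\<dots> \<le> len v" by (rule integral_norm_le_len[OF assms(1)])
  finally show ?thesis .
qed

text \<open>Moving the variable bound of integration into the integrand reduces joint continuity of a family
of primitives to continuity of integrals that depend on a parameter.\<close>

lemma prim_rescaled: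
  assumes "continuous_on {0..1} v" "t \<in> {0..1}"
  shows "prim v t = t *\<^sub>R integral {0..1} (\<lambda>x. v (t * x))"
proof -
  have t: "0 \<le> t" "t \<le> 1" using assms by auto
  have "((\<lambda>x. t *\<^sub>R v (t * x)) has_integral (integral {t * 0..t * 1} v)) {0..1}"
  proof (rule has_integral_substitution[where c = 0 and d = 1])
    show "(\<lambda>x. t * x) ` {0..1} \<subseteq> {0..1}" using t by (auto intro!: mult_le_one)
    show "continuous_on {0..1} v" by fact
    show "((*) t has_real_derivative t) (at x within {0..1})" for x
      by (auto intro!: derivative_eq_intros)
  qed (use t in auto)
  from integral_unique[OF this] show ?thesis by (simp add: prim_def)
qed

lemma continuous_integral_unit:
  fixes f :: "'a::topological_space \<Rightarrow> real \<Rightarrow> 'b::banach"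
  assumes "continuous_on (U \<times> {0..1}) (\<lambda>(x, t). f x t)"
  shows "continuous_on U (\<lambda>x. integral {0..1} (f x))"
  using integral_continuous_on_param[of U 0 1 f] assms by (simp add: box_real)

lemma continuous_prim2:
  fixes S :: "'a::topological_space set"
  assumes V: "continuous_on (S \<times> {0..1}) (\<lambda>(s, t). V s t)"
  shows "continuous_on (S \<times> {0..1}) (\<lambda>(s, t). prim (V s) t)"
proof -
  have 1: "continuous_on ((S \<times> {0..1}) \<times> {0..1}) (\<lambda>(z, x). V (fst z) (snd z * x))"
  proof -
    have c: "continuous_on ((S \<times> {0..1}) \<times> {0..1}) (\<lambda>z. (fst (fst z), snd (fst z) * snd z :: real))"
      by (intro continuous_intros)
    have "(\<lambda>z. (fst (fst z), snd (fst z) * snd z :: real)) ` ((S \<times> {0..1}) \<times> {0..1}) \<subseteq> S \<times> {0..1}"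
      by (auto intro!: mult_le_one)
    from continuous_on_compose2[OF V c this] show ?thesis by (simp add: split_beta)
  qed
  have 2: "continuous_on (S \<times> {0..1}) (\<lambda>z. snd z *\<^sub>R integral {0..1} (\<lambda>x. V (fst z) (snd z * x)))"
    by (intro continuous_on_scaleR continuous_on_snd continuous_on_id continuous_integral_unit 1)
  have Vs: "continuous_on {0..1} (V s)" if "s \<in> S" for s
  proof -
    have "continuous_on {0..1} (\<lambda>t::real. (s, t))" by (intro continuous_intros)
    from continuous_on_compose2[OF V this] show ?thesis using that by auto
  qed
  show ?thesis
    by (rule continuous_on_eq[OF 2]) (auto simp: prim_rescaled[OF Vs])
qed

section \<open>The weighted area and its first variation\<close>

text \<open>The derivative of the area weighted by \<open>K\<close>, at the loop \<open>(p, v)\<close> in the direction \<open>(q, w)\<close>: the strip swept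
out by the displacement \<open>q + prim w\<close> along the curve, measured with density \<open>K\<close>.\<close>

definition darea where
  "darea K p v q w = integral {0..1} (\<lambda>t. K (p + prim v t) * wedge (q + prim w t) (v t))"

text \<open>The loop is contracted linearly to its base point, and the first variation is integrated along this
contraction. The weight thus enters only through its values at distance at most \<open>len v\<close> from \<open>p\<close>, so the area of a loop that is
translated to infinity is governed by \<open>K\<^sub>0\<close>.\<close>

definition area where
  "area K p v = integral {0..1} (\<lambda>s. darea K p (\<lambda>t. s *\<^sub>R v t) 0 v)"

lemma cont_comp: "continuous_on UNIV K \<Longrightarrow> continuous_on S f \<Longrightarrow> continuous_on S (\<lambda>x. K (f x))"
  by (rule continuous_on_compose2) auto

lemma darea_cont:
  assumes "continuous_on UNIV K" "continuous_on {0..1} v" "continuous_on {0..1} w"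
  shows "continuous_on {0..1} (\<lambda>t. K (p + prim v t) * wedge (q + prim w t) (v t))"
  by (intro continuous_intros prim_cont cont_comp[OF assms(1)] assms(2,3))

lemma continuous_darea:
  fixes S :: "'a::topological_space set"
  assumes K: "continuous_on UNIV K" and p: "continuous_on S P" and q: "continuous_on S Q"
    and V: "continuous_on (S \<times> {0..1}) (\<lambda>(s, t). V s t)"
    and W: "continuous_on (S \<times> {0..1}) (\<lambda>(s, t). W s t)"
  shows "continuous_on S (\<lambda>s. darea K (P s) (V s) (Q s) (W s))"
proof -
  have [continuous_intros]: "continuous_on (S \<times> {0..1}) (\<lambda>z. P (fst z))"
    "continuous_on (S \<times> {0..1}) (\<lambda>z. Q (fst z))"
    by (rule continuous_on_compose2[OF p continuous_on_fst[OF continuous_on_id]]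
          continuous_on_compose2[OF q continuous_on_fst[OF continuous_on_id]]; auto)+
  note [continuous_intros] = V[unfolded split_beta] W[unfolded split_beta]
    continuous_prim2[OF V, unfolded split_beta] continuous_prim2[OF W, unfolded split_beta]
  show ?thesis unfolding darea_def
    by (rule continuous_integral_unit) (unfold split_beta, intro continuous_intros cont_comp[OF K])
qed

lemma continuous_area:
  fixes S :: "'a::topological_space set"
  assumes K: "continuous_on UNIV K" and p: "continuous_on S P"
    and V: "continuous_on (S \<times> {0..1}) (\<lambda>(s, t). V s t)"
  shows "continuous_on S (\<lambda>s. area K (P s) (V s))"
proof -
  have c: "continuous_on ((S \<times> {0..1::real}) \<times> {0..1::real}) (\<lambda>z. (fst (fst z), snd z))"
    by (intro continuous_intros)
  have V2: "continuous_on ((S \<times> {0..1::real}) \<times> {0..1}) (\<lambda>z. V (fst (fst z)) (snd z))"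
    using continuous_on_compose2[OF V c] by (force simp: split_beta)
  have P2: "continuous_on (S \<times> {0..1::real}) (\<lambda>z. P (fst z))"
    by (rule continuous_on_compose2[OF p continuous_on_fst[OF continuous_on_id]]) auto
  have "continuous_on (S \<times> {0..1})
     (\<lambda>z. darea K (P (fst z)) (\<lambda>t. snd z *\<^sub>R V (fst z) t) 0 (\<lambda>t. V (fst z) t))"
    by (rule continuous_darea[OF K P2], unfold split_beta) (intro continuous_intros V2)+
  then show ?thesis unfolding area_def
    by (intro continuous_integral_unit) (simp add: split_beta)
qed

lemma continuous_len:
  fixes S :: "'a::topological_space set"
  assumes V: "continuous_on (S \<times> {0..1}) (\<lambda>(s, t). V s t)"
  shows "continuous_on S (\<lambda>s. len (V s))"
proof -
  have "continuous_on (S \<times> {0..1}) (\<lambda>(s, t). (norm (V s t))\<^sup>2)"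
    unfolding split_beta by (intro continuous_intros V[unfolded split_beta])
  then show ?thesis
    unfolding len_def by (intro continuous_intros continuous_integral_unit)
qed

lemma abs_darea_le:
  assumes K: "continuous_on UNIV K" and v: "continuous_on {0..1} v" and w: "continuous_on {0..1} w"
    and k: "\<And>t. t \<in> {0..1} \<Longrightarrow> \<bar>K (p + prim v t)\<bar> \<le> k"
  shows "\<bar>darea K p v q w\<bar> \<le> k * (norm q + len w) * len v"
proof -
  have k0: "0 \<le> k" using k[of 0] by (force intro: order_trans[OF abs_ge_zero])
  have "norm (darea K p v q w) \<le> integral {0..1} (\<lambda>t. k * (norm q + len w) * norm (v t))"
    unfolding darea_def
  proof (rule norm_integral_unit_le[OF darea_cont[OF K v w]])
    show "continuous_on {0..1} (\<lambda>t. k * (norm q + len w) * norm (v t))"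
      by (intro continuous_intros v)
    fix t :: real assume t: "t \<in> {0..1}"
    have "norm (q + prim w t) \<le> norm q + len w"
      using norm_prim_le[OF w t] norm_triangle_ineq[of q "prim w t"] by linarith
    then have "\<bar>wedge (q + prim w t) (v t)\<bar> \<le> (norm q + len w) * norm (v t)"
      using abs_wedge_le[of "q + prim w t" "v t"] by (meson mult_right_mono norm_ge_zero order_trans)
    then show "norm (K (p + prim v t) * wedge (q + prim w t) (v t)) \<le> k * (norm q + len w) * norm (v t)"
      using k[OF t] k0 by (simp add: abs_mult mult.assoc mult_mono)
  qed
  also have "\<dots> = k * (norm q + len w) * integral {0..1} (\<lambda>t. norm (v t))" by simp
  also have "\<dots> \<le> k * (norm q + len w) * len v"
    using k0 by (intro mult_left_mono integral_norm_le_len v mult_nonneg_nonneg add_nonneg_nonneg len_nonneg w) auto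
  finally show ?thesis by simp
qed

lemma darea_diff:
  assumes K: "continuous_on UNIV K" and K': "continuous_on UNIV K'"
    and v: "continuous_on {0..1} v" and w: "continuous_on {0..1} w"
  shows "darea (\<lambda>z. K z - K' z) p v q w = darea K p v q w - darea K' p v q w"
  unfolding darea_def left_diff_distrib
  by (rule integral_diff) (intro integrable_unit darea_cont assms)+

lemma continuous_scaled:
  assumes v: "continuous_on {0..1} v"
  shows "continuous_on (S \<times> {0..1}) (\<lambda>(s::real, t::real). s *\<^sub>R (v t :: complex))"
proof -
  have "continuous_on (S \<times> {0..1}) (\<lambda>z. v (snd z))"
    by (rule continuous_on_compose2[OF v continuous_on_snd[OF continuous_on_id]]) auto
  then show ?thesis unfolding split_beta by (intro continuous_intros)
qed

lemma continuous_snd_on: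
  assumes v: "continuous_on {0..1} v"
  shows "continuous_on (S \<times> {0..1}) (\<lambda>(s::real, t::real). (v t :: complex))"
  unfolding split_beta
  by (rule continuous_on_compose2[OF v continuous_on_snd[OF continuous_on_id]]) auto

lemma area_cont:
  assumes K: "continuous_on UNIV K" and v: "continuous_on {0..1} v"
  shows "continuous_on {0..1} (\<lambda>s. darea K p (\<lambda>t. s *\<^sub>R v t) 0 v)"
  by (intro continuous_darea K continuous_scaled continuous_snd_on v continuous_on_const)

lemma integral_ident_unit: "integral {0..1} (\<lambda>s::real. s * c) = c / 2"
proof -
  have "((\<lambda>s. s * c) has_integral (1\<^sup>2 / 2 * c - 0\<^sup>2 / 2 * c)) {0..1::real}"
    by (rule fundamental_theorem_of_calculus)
       (auto intro!: derivative_eq_intros simp flip: has_real_derivative_iff_has_vector_derivative)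
  then show ?thesis by (simp add: integral_unique)
qed

text \<open>A quadratic isoperimetric inequality, with a constant that is not sharp: every point of the loop lies
within \<open>len v\<close> of the base point.\<close>

lemma abs_area_le:
  assumes K: "continuous_on UNIV K" and v: "continuous_on {0..1} v"
    and k: "\<And>z. norm (z - p) \<le> len v \<Longrightarrow> \<bar>K z\<bar> \<le> k"
  shows "\<bar>area K p v\<bar> \<le> k * (len v)\<^sup>2 / 2"
proof -
  have "norm (area K p v) \<le> integral {0..1} (\<lambda>s. s * (k * (len v)\<^sup>2))"
    unfolding area_def
  proof (rule norm_integral_unit_le[OF area_cont[OF K v]])
    fix s :: real assume s: "s \<in> {0..1}"
    have "\<bar>darea K p (\<lambda>t. s *\<^sub>R v t) 0 v\<bar> \<le> k * (norm (0::complex) + len v) * len (\<lambda>t. s *\<^sub>R v t)"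
    proof (intro abs_darea_le K continuous_intros v k)
      fix t :: real assume t: "t \<in> {0..1}"
      have "norm (s *\<^sub>R prim v t) \<le> 1 * len v"
        using s norm_prim_le[OF v t] unfolding norm_scaleR by (intro mult_mono) auto
      then show "norm (p + prim (\<lambda>t. s *\<^sub>R v t) t - p) \<le> len v" by simp
    qed
    then show "norm (darea K p (\<lambda>t. s *\<^sub>R v t) 0 v) \<le> s * (k * (len v)\<^sup>2)"
      using s by (simp add: len_scaleR power2_eq_square mult_ac)
  qed (intro continuous_intros)
  then show ?thesis by (simp add: integral_ident_unit)
qed

text \<open>For such weights the area is the line integral of \<open>Q dy\<close>, by Green's theorem; \<open>S\<close> is the other partial
derivative of \<open>Q\<close>.\<close>

definition has_potential :: "(complex \<Rightarrow> real) \<Rightarrow> bool" where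
  "has_potential K \<longleftrightarrow> continuous_on UNIV K \<and>
     (\<exists>Q S. continuous_on UNIV S \<and>
        (\<forall>z. (Q has_derivative (\<lambda>h. K z * Re h + S z * Im h)) (at z)))"

text \<open>Differentiating \<open>Q (u) dy\<close> under the integral sign produces terms with \<open>S\<close> and with the derivative of the
displacement. Subtracting the total derivative of \<open>Q (u) Im \<phi>\<close>, which integrates to zero because the
loops close up, leaves exactly the term with \<open>K\<close>.\<close>

lemma darea_eq_potential_derivative:
  assumes K: "continuous_on UNIV K" and S: "continuous_on UNIV S"
    and Q: "\<And>z. (Q has_derivative (\<lambda>h. K z * Re h + S z * Im h)) (at z)"
    and v: "continuous_on {0..1} v" "integral {0..1} v = 0"
    and w: "continuous_on {0..1} w" "integral {0..1} w = 0"
    and \<sigma>: "\<sigma> \<in> {0..1::real}"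
  shows "((\<lambda>\<sigma>. integral {0..1} (\<lambda>t. Q (p + \<sigma> *\<^sub>R q + prim (\<lambda>t. v t + \<sigma> *\<^sub>R w t) t) * Im (v t + \<sigma> *\<^sub>R w t)))
    has_vector_derivative darea K (p + \<sigma> *\<^sub>R q) (\<lambda>t. v t + \<sigma> *\<^sub>R w t) q w) (at \<sigma> within {0..1})"
proof -
  define u where "u = (\<lambda>\<sigma> t. p + \<sigma> *\<^sub>R q + (prim v t + \<sigma> *\<^sub>R prim w t))"
  define \<phi> where "\<phi> = (\<lambda>t. q + prim w t)"
  define f where "f = (\<lambda>\<sigma> t. Q (u \<sigma> t) * Im (v t + \<sigma> *\<^sub>R w t))"
  define fx where "fx = (\<lambda>\<sigma> t. (K (u \<sigma> t) * Re (\<phi> t) + S (u \<sigma> t) * Im (\<phi> t)) * Im (v t + \<sigma> *\<^sub>R w t)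
      + Q (u \<sigma> t) * Im (w t))"
  have prim_eq: "prim (\<lambda>t. v t + \<sigma> *\<^sub>R w t) t = prim v t + \<sigma> *\<^sub>R prim w t" if "t \<in> {0..1}" for t \<sigma>
    using that by (subst prim_add) (auto intro!: continuous_intros v w)
  have Qc: "continuous_on UNIV Q"
    using has_derivative_continuous[OF Q] by (simp add: continuous_on_eq_continuous_at)
  have vs: "continuous_on (A \<times> {0..1}) (\<lambda>z. v (snd z))" "continuous_on (A \<times> {0..1}) (\<lambda>z. w (snd z))"
    "continuous_on (A \<times> {0..1}) (\<lambda>z. prim v (snd z))" "continuous_on (A \<times> {0..1}) (\<lambda>z. prim w (snd z))"
    for A :: "real set"
    by (rule continuous_on_compose2[OF v(1) continuous_on_snd[OF continuous_on_id]]
          continuous_on_compose2[OF w(1) continuous_on_snd[OF continuous_on_id]]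
          continuous_on_compose2[OF prim_cont[OF v(1)] continuous_on_snd[OF continuous_on_id]]
          continuous_on_compose2[OF prim_cont[OF w(1)] continuous_on_snd[OF continuous_on_id]]; auto)+
  have D: "((\<lambda>\<sigma>. integral {0..1} (f \<sigma>)) has_vector_derivative integral {0..1} (fx \<sigma>)) (at \<sigma> within {0..1})"
  proof -
    have "((\<lambda>\<sigma>. integral (cbox 0 1) (f \<sigma>)) has_vector_derivative integral (cbox 0 1) (fx \<sigma>)) (at \<sigma> within {0..1})"
    proof (rule leibniz_rule_vector_derivative)
      fix x t :: real assume "x \<in> {0..1}" "t \<in> cbox 0 1"
      have ud: "((\<lambda>x. u x t) has_vector_derivative \<phi> t) (at x within {0..1})"
        unfolding u_def \<phi>_def by (auto intro!: derivative_eq_intros)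
      have "((\<lambda>x. Q (u x t)) has_vector_derivative (K (u x t) * Re (\<phi> t) + S (u x t) * Im (\<phi> t))) (at x within {0..1})"
        using has_derivative_compose[OF ud[unfolded has_vector_derivative_def] Q[of "u x t"]]
        by (simp add: has_vector_derivative_def algebra_simps)
      moreover have "((\<lambda>x. Im (v t + x *\<^sub>R w t)) has_vector_derivative Im (w t)) (at x within {0..1})"
        by (auto intro!: derivative_eq_intros simp flip: has_real_derivative_iff_has_vector_derivative)
      ultimately show "((\<lambda>x. f x t) has_vector_derivative fx x t) (at x within {0..1})"
        unfolding f_def fx_def
        by (auto intro!: derivative_eq_intros simp flip: has_real_derivative_iff_has_vector_derivative)
    next
      fix x :: real assume "x \<in> {0..1}"
      have "continuous_on {0..1} (f x)" unfolding f_def u_def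
        by (intro continuous_intros v w prim_cont cont_comp[OF Qc])
      then show "f x integrable_on cbox 0 1" by (simp add: integrable_unit)
    next
      have "continuous_on ({0..1} \<times> {0..1}) (\<lambda>(x, t). fx x t)"
        unfolding fx_def u_def \<phi>_def split_beta
        by (intro continuous_intros vs cont_comp[OF K] cont_comp[OF S] cont_comp[OF Qc])
      then show "continuous_on ({0..1} \<times> cbox 0 1) (\<lambda>(x, t). fx x t)" by simp
    qed (use \<sigma> in auto)
    then show ?thesis by simp
  qed
  define g where "g = (\<lambda>t. Q (u \<sigma> t) * Im (w t)
      + (K (u \<sigma> t) * Re (v t + \<sigma> *\<^sub>R w t) + S (u \<sigma> t) * Im (v t + \<sigma> *\<^sub>R w t)) * Im (\<phi> t))"
  have "(g has_integral Q (u \<sigma> 1) * Im (\<phi> 1) - Q (u \<sigma> 0) * Im (\<phi> 0)) {0..1}"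
  proof (rule fundamental_theorem_of_calculus)
    fix t :: real assume t: "t \<in> {0..1}"
    have ud: "((\<lambda>t. u \<sigma> t) has_vector_derivative (v t + \<sigma> *\<^sub>R w t)) (at t within {0..1})"
      unfolding u_def by (auto intro!: derivative_eq_intros prim_deriv v w t)
    have "((\<lambda>t. Q (u \<sigma> t)) has_vector_derivative (K (u \<sigma> t) * Re (v t + \<sigma> *\<^sub>R w t) + S (u \<sigma> t) * Im (v t + \<sigma> *\<^sub>R w t))) (at t within {0..1})"
      using has_derivative_compose[OF ud[unfolded has_vector_derivative_def] Q[of "u \<sigma> t"]]
      by (simp add: has_vector_derivative_def algebra_simps)
    moreover have "((\<lambda>t. \<phi> t) has_vector_derivative w t) (at t within {0..1})"
      unfolding \<phi>_def by (auto intro!: derivative_eq_intros prim_deriv w t)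
    then have "((\<lambda>t. Im (\<phi> t)) has_vector_derivative Im (w t)) (at t within {0..1})"
      by (rule bounded_linear.has_vector_derivative[OF bounded_linear_Im])
    ultimately show "((\<lambda>t. Q (u \<sigma> t) * Im (\<phi> t)) has_vector_derivative g t) (at t within {0..1})"
      using has_vector_derivative_mult[of "\<lambda>t. Q (u \<sigma> t)" _ t "{0..1}" "\<lambda>t. Im (\<phi> t)" "Im (w t)"]
      unfolding g_def by simp
  qed simp
  moreover have "u \<sigma> 1 = u \<sigma> 0" "\<phi> 1 = \<phi> 0"
    using v(2) w(2) by (auto simp: u_def \<phi>_def prim_def)
  ultimately have g0: "integral {0..1} g = 0" by (simp add: integral_unique)
  have fxc: "continuous_on {0..1} (fx \<sigma>)" and gc: "continuous_on {0..1} g"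
    unfolding fx_def g_def u_def \<phi>_def
    by (intro continuous_intros v w prim_cont cont_comp[OF K] cont_comp[OF S] cont_comp[OF Qc])+
  have "integral {0..1} (fx \<sigma>) = integral {0..1} (\<lambda>t. fx \<sigma> t - g t)"
    using g0 by (simp add: integral_diff integrable_unit fxc gc)
  also have "\<dots> = darea K (p + \<sigma> *\<^sub>R q) (\<lambda>t. v t + \<sigma> *\<^sub>R w t) q w"
    unfolding darea_def
    by (rule integral_cong) (simp add: fx_def g_def u_def \<phi>_def prim_eq wedge_def algebra_simps)
  finally have "((\<lambda>\<sigma>. integral {0..1} (f \<sigma>)) has_vector_derivative darea K (p + \<sigma> *\<^sub>R q) (\<lambda>t. v t + \<sigma> *\<^sub>R w t) q w) (at \<sigma> within {0..1})"
    using D by simp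
  moreover have "(\<lambda>\<sigma>. integral {0..1} (\<lambda>t. Q (p + \<sigma> *\<^sub>R q + prim (\<lambda>t. v t + \<sigma> *\<^sub>R w t) t) * Im (v t + \<sigma> *\<^sub>R w t)))
     = (\<lambda>\<sigma>. integral {0..1} (f \<sigma>))"
    by (rule ext, rule integral_cong) (simp add: f_def u_def prim_eq)
  ultimately show ?thesis by simp
qed

lemma area_diff_potential:
  assumes K: "has_potential K"
    and v: "continuous_on {0..1} v" "integral {0..1} v = 0"
    and w: "continuous_on {0..1} w" "integral {0..1} w = 0"
  shows "area K (p + q) (\<lambda>t. v t + w t) - area K p v =
    integral {0..1} (\<lambda>\<sigma>. darea K (p + \<sigma> *\<^sub>R q) (\<lambda>t. v t + \<sigma> *\<^sub>R w t) q w)"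
proof -
  from K obtain Q S where Kc: "continuous_on UNIV K" and S: "continuous_on UNIV S"
    and Q: "\<And>z. (Q has_derivative (\<lambda>h. K z * Re h + S z * Im h)) (at z)"
    unfolding has_potential_def by blast
  define B where "B = (\<lambda>p v. integral {0..1} (\<lambda>t. Q (p + prim v t) * Im (v t)))"
  have line: "integral {0..1} (\<lambda>\<sigma>. darea K (p + \<sigma> *\<^sub>R q) (\<lambda>t. v t + \<sigma> *\<^sub>R w t) q w) =
      B (p + q) (\<lambda>t. v t + w t) - B p v"
    if "continuous_on {0..1} v" "integral {0..1} v = 0" "continuous_on {0..1} w" "integral {0..1} w = 0"
    for p q v w
    using fundamental_theorem_of_calculus[OF zero_le_one darea_eq_potential_derivative[OF Kc S Q that]]
    by (auto simp: B_def integral_unique)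
  have area_B: "area K p v = B p v" if "continuous_on {0..1} v" "integral {0..1} v = 0" for p v
    using line[of "\<lambda>_. 0" v p 0] that by (simp add: area_def B_def)
  have "integral {0..1} (\<lambda>t. v t + w t) = 0"
    using v w by (simp add: integral_add integrable_unit)
  then show ?thesis using v w
    by (simp add: line area_B continuous_on_add)
qed

text \<open>Polynomials in two real variables in expanded form: antiderivatives in the first variable are
explicit for monomials, whereas a product of two functions with antiderivatives gives none.\<close>

inductive monomial_sum :: "(complex \<Rightarrow> real) \<Rightarrow> bool" where
  monomial: "monomial_sum (\<lambda>z. c * Re z ^ a * Im z ^ b)"
| add: "monomial_sum f \<Longrightarrow> monomial_sum g \<Longrightarrow> monomial_sum (\<lambda>z. f z + g z)"

lemma monomial_sum_mult:
  assumes "monomial_sum f" "monomial_sum g"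
  shows "monomial_sum (\<lambda>z. f z * g z)"
proof -
  have *: "monomial_sum (\<lambda>z. (c * Re z ^ a * Im z ^ b) * g z)" if "monomial_sum g" for c a b g
    using that
  proof induction
    case (monomial c' a' b')
    then show ?case
      using monomial_sum.monomial[of "c * c'" "a + a'" "b + b'"] by (simp add: power_add mult_ac)
  qed (simp add: distrib_left monomial_sum.add)
  show ?thesis using assms(1)
    by induction (simp_all add: * assms(2) distrib_right monomial_sum.add)
qed

lemma monomial_sum_polynomial: "real_polynomial_function f \<Longrightarrow> monomial_sum f"
proof (induction rule: real_polynomial_function.induct)
  case (linear f)
  define c d where "c = f 1" and "d = f \<i>"
  have f: "f = (\<lambda>z. c * Re z ^ 1 * Im z ^ 0 + d * Re z ^ 0 * Im z ^ 1)"
  proof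
    fix z
    have "f z = f (Re z *\<^sub>R 1 + Im z *\<^sub>R \<i>)" by (rule arg_cong[of _ _ f]) (simp add: complex_eq_iff)
    also have "\<dots> = Re z * f 1 + Im z * f \<i>"
      using bounded_linear.linear[OF linear] by (simp only: linear_add linear_scale real_scaleR_def)
    finally show "f z = c * Re z ^ 1 * Im z ^ 0 + d * Re z ^ 0 * Im z ^ 1" by (simp add: c_def d_def)
  qed
  show ?case unfolding f by (intro monomial_sum.intros)
next
  case (const c)
  show ?case using monomial_sum.monomial[of c 0 0] by simp
qed (auto intro: monomial_sum.add monomial_sum_mult)

lemma has_potential_monomial_sum: "monomial_sum K \<Longrightarrow> has_potential K"
proof (induction rule: monomial_sum.induct)
  case (monomial c a b)
  define m where "m = real (Suc a)"
  have m: "m \<noteq> 0" by (simp add: m_def)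
  define Q where "Q = (\<lambda>z. c / m * (Re z ^ Suc a * Im z ^ b))"
  define S where "S = (\<lambda>z. c / m * (Re z ^ Suc a * (b * Im z ^ (b - 1))))"
  have "(Q has_derivative (\<lambda>h. (c * Re z ^ a * Im z ^ b) * Re h + S z * Im h)) (at z)" for z
  proof -
    have 1: "((\<lambda>z. Re z ^ Suc a) has_derivative (\<lambda>h. m * Re h * Re z ^ a)) (at z)"
      using has_derivative_power[OF bounded_linear.has_derivative[OF bounded_linear_Re has_derivative_ident], of "Suc a" z UNIV]
      by (simp add: m_def del: power_Suc of_nat_Suc)
    have 2: "((\<lambda>z. Im z ^ b) has_derivative (\<lambda>h. b * Im h * Im z ^ (b - 1))) (at z)"
      using has_derivative_power[OF bounded_linear.has_derivative[OF bounded_linear_Im has_derivative_ident], of b z UNIV]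
      by simp
    have "(\<lambda>h. c / m * (Re z ^ Suc a * (b * Im h * Im z ^ (b - 1)) + m * Re h * Re z ^ a * Im z ^ b)) =
        (\<lambda>h. (c * Re z ^ a * Im z ^ b) * Re h + S z * Im h)"
      using m by (auto simp: S_def field_simps)
    with has_derivative_mult_right[OF has_derivative_mult[OF 1 2], of "c / m"]
    show ?thesis unfolding Q_def by (simp only:)
  qed
  moreover have "continuous_on UNIV S" "continuous_on UNIV (\<lambda>z. c * Re z ^ a * Im z ^ b)"
    unfolding S_def by (intro continuous_intros; simp)+
  ultimately show ?case unfolding has_potential_def by blast
next
  case (add f g)
  then obtain Q S Q' S' where *: "continuous_on UNIV f" "continuous_on UNIV g"
    "continuous_on UNIV S" "continuous_on UNIV S'"
    "\<And>z. (Q has_derivative (\<lambda>h. f z * Re h + S z * Im h)) (at z)"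
    "\<And>z. (Q' has_derivative (\<lambda>h. g z * Re h + S' z * Im h)) (at z)"
    unfolding has_potential_def by blast
  have "((\<lambda>z. Q z + Q' z) has_derivative (\<lambda>h. (f z + g z) * Re h + (S z + S' z) * Im h)) (at z)" for z
    using has_derivative_add[OF *(5,6)[of z]] by (simp add: algebra_simps)
  moreover have "continuous_on UNIV (\<lambda>z. f z + g z)" "continuous_on UNIV (\<lambda>z. S z + S' z)"
    by (intro continuous_intros *)+
  ultimately show ?case unfolding has_potential_def by blast
qed

text \<open>Both sides are linear in \<open>K\<close> and depend continuously on its values on a disc that contains all the loops
involved. By the Stone-Weierstrass theorem it is enough to treat polynomials, for which both sides are
differences of the line integral of a potential.\<close>

theorem area_diff:
  assumes K: "continuous_on UNIV K"
    and v: "continuous_on {0..1} v" "integral {0..1} v = 0"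
    and w: "continuous_on {0..1} w" "integral {0..1} w = 0"
  shows "area K (p + q) (\<lambda>t. v t + w t) - area K p v =
    integral {0..1} (\<lambda>\<sigma>. darea K (p + \<sigma> *\<^sub>R q) (\<lambda>t. v t + \<sigma> *\<^sub>R w t) q w)"
    (is "?l K = ?r K")
proof -
  define vw where "vw = (\<lambda>t. v t + w t)"
  define l where "l = (\<lambda>\<sigma>. len (\<lambda>t. v t + \<sigma> *\<^sub>R w t))"
  have vwc: "continuous_on {0..1} vw" unfolding vw_def by (intro continuous_intros v w)
  have lvc: "continuous_on {0..1} (\<lambda>t. v t + \<sigma> *\<^sub>R w t)" for \<sigma> by (intro continuous_intros v w)
  have line: "continuous_on ({0..1} \<times> {0..1}) (\<lambda>(\<sigma>, t). v t + \<sigma> *\<^sub>R w t)"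
    using continuous_on_add[OF continuous_snd_on[OF v(1), of "{0..1}"] continuous_scaled[OF w(1), of "{0..1}"]]
    by (simp add: split_beta)
  have lc: "continuous_on {0..1} l" unfolding l_def by (rule continuous_len[OF line])
  then obtain B where B: "\<And>\<sigma>. \<sigma> \<in> {0..1} \<Longrightarrow> l \<sigma> \<le> B"
    using continuous_attains_sup[OF compact_Icc _ lc] by force
  have B0: "0 \<le> B" using B[of 0] len_nonneg[OF v(1)] by (simp add: l_def)
  \<comment> \<open>A radius that contains all loops on the segment and all their contractions.\<close>
  define R where "R = norm p + norm q + B"
  define C where "C = (len vw)\<^sup>2 / 2 + (len v)\<^sup>2 / 2 + (norm q + len w) * B"
  have Rvw: "len vw \<le> B" "len v \<le> B" using B[of 1] B[of 0] by (auto simp: l_def vw_def)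
  have est: "\<bar>?l K - ?r K\<bar> \<le> e * C" if e: "e > 0" for e
  proof -
    obtain K' where K': "real_polynomial_function K'" "\<And>z. z \<in> cball 0 R \<Longrightarrow> \<bar>K z - K' z\<bar> < e"
      by (rule Stone_Weierstrass_real_polynomial_function[of "cball 0 R" K e])
         (use continuous_on_subset[OF K] e in auto)
    have pot: "has_potential K'"
      by (intro has_potential_monomial_sum monomial_sum_polynomial K')
    then have K'c: "continuous_on UNIV K'" by (simp add: has_potential_def)
    define D where "D = (\<lambda>z. K z - K' z)"
    have Dc: "continuous_on UNIV D" unfolding D_def by (intro continuous_intros K K'c)
    have De: "\<bar>D z\<bar> \<le> e" if "norm z \<le> R" for z
      using K'(2)[of z] that by (simp add: D_def)
    have area_D: "area D p v = area K p v - area K' p v" if "continuous_on {0..1} v" for p v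
      unfolding area_def D_def using that
      by (subst integral_diff[symmetric])
         (auto intro!: integrable_unit area_cont K K'c integral_cong darea_diff continuous_intros)
    have dc: "continuous_on {0..1} (\<lambda>\<sigma>. darea K (p + \<sigma> *\<^sub>R q) (\<lambda>t. v t + \<sigma> *\<^sub>R w t) q w)"
      if "continuous_on UNIV K" for K
      by (intro continuous_darea that line continuous_snd_on w continuous_intros)
    have r_D: "?r D = ?r K - ?r K'"
      unfolding D_def
      by (subst integral_diff[symmetric])
         (auto intro!: integrable_unit dc K K'c integral_cong darea_diff lvc w)
    have "?l K - ?r K = area D (p + q) vw - area D p v - ?r D"
      using area_diff_potential[OF pot v w, of p q]
      by (simp add: area_D vwc v r_D flip: vw_def)
    moreover have "\<bar>area D (p + q) vw\<bar> \<le> e * (len vw)\<^sup>2 / 2"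
    proof (rule abs_area_le[OF Dc vwc])
      fix z assume "norm (z - (p + q)) \<le> len vw"
      then show "\<bar>D z\<bar> \<le> e"
        using Rvw norm_triangle_ineq[of "z - (p + q)" "p + q"] norm_triangle_ineq[of p q]
        by (intro De) (simp add: R_def)
    qed
    moreover have "\<bar>area D p v\<bar> \<le> e * (len v)\<^sup>2 / 2"
    proof (rule abs_area_le[OF Dc v(1)])
      fix z assume "norm (z - p) \<le> len v"
      then show "\<bar>D z\<bar> \<le> e"
        using Rvw norm_triangle_ineq[of "z - p" "p"] norm_ge_zero[of q]
        by (intro De) (simp add: R_def del: norm_ge_zero)
    qed
    moreover have "\<bar>?r D\<bar> \<le> e * ((norm q + len w) * B)"
    proof -
      have "norm (?r D) \<le> e * ((norm q + len w) * B)"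
      proof (rule norm_integral_unit_le_const[OF dc[OF Dc]])
        fix \<sigma> :: real assume \<sigma>: "\<sigma> \<in> {0..1}"
        have "\<bar>darea D (p + \<sigma> *\<^sub>R q) (\<lambda>t. v t + \<sigma> *\<^sub>R w t) q w\<bar> \<le> e * (norm q + len w) * l \<sigma>"
          unfolding l_def
        proof (rule abs_darea_le[OF Dc lvc w(1)])
          fix t :: real assume t: "t \<in> {0..1}"
          have "norm (\<sigma> *\<^sub>R q) \<le> norm q" using \<sigma> by (simp add: mult_left_le_one_le)
          moreover have "norm (prim (\<lambda>t. v t + \<sigma> *\<^sub>R w t) t) \<le> B"
            using norm_prim_le[OF lvc t, of \<sigma>] B[OF \<sigma>] by (simp add: l_def)
          ultimately show "\<bar>D (p + \<sigma> *\<^sub>R q + prim (\<lambda>t. v t + \<sigma> *\<^sub>R w t) t)\<bar> \<le> e"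
            using norm_triangle_ineq[of "p + \<sigma> *\<^sub>R q" "prim (\<lambda>t. v t + \<sigma> *\<^sub>R w t) t"]
              norm_triangle_ineq[of p "\<sigma> *\<^sub>R q"]
            by (intro De) (unfold R_def, linarith)
        qed
        also have "\<dots> \<le> e * (norm q + len w) * B"
          using e B[OF \<sigma>] len_nonneg[OF w(1)] by (intro mult_left_mono) auto
        finally show "norm (darea D (p + \<sigma> *\<^sub>R q) (\<lambda>t. v t + \<sigma> *\<^sub>R w t) q w) \<le> e * ((norm q + len w) * B)"
          by (simp add: mult.assoc)
      qed
      then show ?thesis by simp
    qed
    ultimately show ?thesis unfolding C_def by (simp add: algebra_simps)
  qed
  have "0 \<le> C" unfolding C_def using B0 len_nonneg[OF w(1)] by simp
  have "\<bar>?l K - ?r K\<bar> \<le> 0"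
  proof (rule field_le_epsilon)
    fix d :: real assume d: "0 < d"
    have "\<bar>?l K - ?r K\<bar> \<le> d / (C + 1) * C" using est[of "d / (C + 1)"] d \<open>0 \<le> C\<close> by simp
    also have "\<dots> \<le> d" using d \<open>0 \<le> C\<close> by (simp add: field_simps)
    finally show "\<bar>?l K - ?r K\<bar> \<le> 0 + d" by simp
  qed
  then show ?thesis by simp
qed

section \<open>The action and its gradient\<close>

lemma len_add_square:
  assumes v: "continuous_on {0..1} v" and w: "continuous_on {0..1} w"
  shows "(len (\<lambda>t. a *\<^sub>R v t + b *\<^sub>R w t))\<^sup>2
    = a\<^sup>2 * (len v)\<^sup>2 + 2 * a * b * integral {0..1} (\<lambda>t. v t \<bullet> w t) + b\<^sup>2 * (len w)\<^sup>2"
proof -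
  have vw: "continuous_on {0..1} (\<lambda>t. a *\<^sub>R v t + b *\<^sub>R w t)" using v w by (intro continuous_intros)
  have "(len (\<lambda>t. a *\<^sub>R v t + b *\<^sub>R w t))\<^sup>2 =
    integral {0..1} (\<lambda>t. a\<^sup>2 * (norm (v t))\<^sup>2 + 2 * a * b * (v t \<bullet> w t) + b\<^sup>2 * (norm (w t))\<^sup>2)"
    unfolding len_square[OF vw]
    by (simp only: power2_norm_eq_inner) (simp add: inner_add inner_commute power2_eq_square algebra_simps)
  also have "\<dots> = a\<^sup>2 * (len v)\<^sup>2 + 2 * a * b * integral {0..1} (\<lambda>t. v t \<bullet> w t) + b\<^sup>2 * (len w)\<^sup>2"
    unfolding len_square[OF v] len_square[OF w] using v w
    by (simp add: integral_add integrable_unit continuous_intros)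
  finally show ?thesis .
qed

text \<open>The Cauchy-Schwarz inequality, from the nonnegativity of a quadratic form; the definite and the
degenerate cases are separated because \<open>len\<close> is only known to be a seminorm.\<close>

lemma inner_le_len:
  assumes v: "continuous_on {0..1} v" and w: "continuous_on {0..1} w"
  shows "integral {0..1} (\<lambda>t. v t \<bullet> w t) \<le> len v * len w"
proof -
  define i where "i = integral {0..1} (\<lambda>t. v t \<bullet> w t)"
  define a where "a = len v"
  define b where "b = len w"
  have ab: "0 \<le> a" "0 \<le> b" using len_nonneg v w by (auto simp: a_def b_def)
  have *: "0 \<le> x\<^sup>2 * a\<^sup>2 + 2 * x * y * i + y\<^sup>2 * b\<^sup>2" for x y
    using len_add_square[OF v w, of x y] zero_le_power2[of "len (\<lambda>t. x *\<^sub>R v t + y *\<^sub>R w t)"]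
    by (simp add: i_def a_def b_def)
  show ?thesis
  proof (cases "a = 0 \<and> b = 0")
    case True
    then show ?thesis using *[of 1 "-1"] by (simp add: i_def a_def b_def)
  next
    case False
    have "i\<^sup>2 \<le> (a * b)\<^sup>2"
    proof (cases "b = 0")
      case b: True
      then have "0 \<le> a\<^sup>2 * (- (i\<^sup>2))"
        using *[of "i" "- a\<^sup>2"] by (simp add: power2_eq_square algebra_simps)
      moreover have "0 < a\<^sup>2" using False b by simp
      ultimately show ?thesis using b by (simp add: mult_le_0_iff zero_le_mult_iff)
    next
      case b: False
      have "0 \<le> b\<^sup>2 * ((a * b)\<^sup>2 - i\<^sup>2)"
        using *[of "b\<^sup>2" "- i"] by (simp add: power2_eq_square algebra_simps)
      moreover have "0 < b\<^sup>2" using b by simp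
      ultimately show ?thesis by (simp add: zero_le_mult_iff)
    qed
    then have "i \<le> a * b" by (rule power2_le_imp_le) (simp add: ab)
    then show ?thesis by (simp add: i_def a_def b_def)
  qed
qed

lemma len_triangle:
  assumes v: "continuous_on {0..1} v" and w: "continuous_on {0..1} w"
  shows "len (\<lambda>t. v t + w t) \<le> len v + len w"
proof -
  have "(len (\<lambda>t. v t + w t))\<^sup>2 \<le> (len v + len w)\<^sup>2"
    using len_add_square[OF v w, of 1 1] inner_le_len[OF v w] by (simp add: power2_sum)
  then show ?thesis
    by (rule power2_le_imp_le) (simp add: len_nonneg v w)
qed

text \<open>\<open>\<theta>\<close> is the reciprocal of the factor of \<open>K\<close> in the curvature, so the action is affine and nondecreasing in it.\<close>

definition action where "action K \<theta> p v = \<theta> * len v - area K p v"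

text \<open>A primitive of \<open>K (u) i u'\<close>. A critical loop satisfies \<open>\<theta> u' / L = force + const\<close>, and
its force vanishes at time 1.\<close>

definition force where "force K p v = prim (\<lambda>s. K (p + prim v s) *\<^sub>R (\<i> * v s))"

text \<open>The gradient of the action with respect to the squared norm \<open>\<bar>q\<bar>\<^sup>2 + (len w)\<^sup>2\<close> on pairs \<open>(q, w)\<close>: this is its
velocity component, made mean-free so that it is again the velocity of a closed curve. The component in the
base point is \<open>force K p v 1\<close>.\<close>

definition grad where
  "grad K \<theta> p v t = (\<theta> / len v) *\<^sub>R v t - (force K p v t - integral {0..1} (force K p v))"

definition slope where
  "slope K \<theta> p v = (len (grad K \<theta> p v))\<^sup>2 + (norm (force K p v 1))\<^sup>2"

lemma force_integrand_cont:
  assumes "continuous_on UNIV K" "continuous_on {0..1} v"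
  shows "continuous_on {0..1} (\<lambda>s. K (p + prim v s) *\<^sub>R (\<i> * v s))"
  by (intro continuous_intros prim_cont cont_comp[OF assms(1)] assms(2))

lemma force_cont:
  assumes "continuous_on UNIV K" "continuous_on {0..1} v"
  shows "continuous_on {0..1} (force K p v)"
  unfolding force_def by (intro prim_cont force_integrand_cont assms)

lemma grad_cont:
  assumes "continuous_on UNIV K" "continuous_on {0..1} v"
  shows "continuous_on {0..1} (grad K \<theta> p v)"
  unfolding grad_def by (intro continuous_intros force_cont assms)

lemma integral_grad:
  assumes K: "continuous_on UNIV K" and v: "continuous_on {0..1} v" "integral {0..1} v = 0"
  shows "integral {0..1} (grad K \<theta> p v) = 0"
proof -
  have W: "continuous_on {0..1} (force K p v)" by (rule force_cont[OF K v(1)])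
  have "integral {0..1} (grad K \<theta> p v) =
      integral {0..1} (\<lambda>t. (\<theta> / len v) *\<^sub>R v t)
      - (integral {0..1} (force K p v) - integral {0..1} (\<lambda>t::real. integral {0..1} (force K p v)))"
    unfolding grad_def
    by (subst integral_diff | subst integral_diff[of "force K p v"] | intro integrable_unit continuous_intros W v refl)+
  then show ?thesis by (simp add: v(2))
qed

lemma len_scaled_le:
  assumes v: "continuous_on {0..1} v" and f: "continuous_on {0..1} f"
    and k: "\<And>t. t \<in> {0..1} \<Longrightarrow> \<bar>f t\<bar> \<le> k"
  shows "len (\<lambda>t. f t *\<^sub>R (\<i> * v t)) \<le> k * len v"
proof -
  have k0: "0 \<le> k" using k[of 0] by force
  have "len (\<lambda>t. f t *\<^sub>R (\<i> * v t)) \<le> len (\<lambda>t. k *\<^sub>R v t)"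
    unfolding len_def
  proof (intro real_sqrt_le_mono integral_unit_mono)
    fix t :: real assume "t \<in> {0..1}"
    then show "(norm (f t *\<^sub>R (\<i> * v t)))\<^sup>2 \<le> (norm (k *\<^sub>R v t))\<^sup>2"
      using k k0 by (intro power_mono) (auto simp: norm_mult intro: mult_right_mono)
  qed (intro continuous_intros v f)+
  also have "\<dots> = k * len v" using k0 by (simp add: len_scaleR)
  finally show ?thesis .
qed

lemma norm_force_le:
  assumes K: "continuous_on UNIV K" and v: "continuous_on {0..1} v" and k: "\<And>z. \<bar>K z\<bar> \<le> k"
    and t: "t \<in> {0..1}"
  shows "norm (force K p v t) \<le> k * len v"
proof -
  have "norm (force K p v t) \<le> len (\<lambda>s. K (p + prim v s) *\<^sub>R (\<i> * v s))"
    unfolding force_def by (rule norm_prim_le[OF force_integrand_cont[OF K v] t])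
  also have "\<dots> \<le> k * len v"
    by (rule len_scaled_le[OF v _ k]) (intro continuous_intros cont_comp[OF K] prim_cont v)
  finally show ?thesis .
qed

lemma len_grad_le:
  assumes K: "continuous_on UNIV K" and v: "continuous_on {0..1} v" "0 < len v"
    and k: "\<And>z. \<bar>K z\<bar> \<le> k" and \<theta>: "0 \<le> \<theta>"
  shows "len (grad K \<theta> p v) \<le> \<theta> + 2 * k * len v"
proof -
  define W where "W = force K p v"
  have Wc: "continuous_on {0..1} W" unfolding W_def by (rule force_cont[OF K v(1)])
  have W: "norm (W t) \<le> k * len v" if "t \<in> {0..1}" for t
    unfolding W_def by (rule norm_force_le[OF K v(1) k that])
  have "norm (integral {0..1} W) \<le> k * len v"
    by (rule norm_integral_unit_le_const[OF Wc W])
  then have "norm (integral {0..1} W - W t) \<le> 2 * k * len v" if "t \<in> {0..1}" for t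
    using W[OF that] norm_triangle_ineq4[of "integral {0..1} W" "W t"] by simp
  then have "len (\<lambda>t. integral {0..1} W - W t) \<le> 2 * k * len v"
    by (intro len_le_const continuous_intros Wc) auto
  moreover have "len (\<lambda>t. (\<theta> / len v) *\<^sub>R v t) = \<theta>"
    using v(2) \<theta> by (simp add: len_scaleR)
  moreover have "grad K \<theta> p v = (\<lambda>t. (\<theta> / len v) *\<^sub>R v t + (integral {0..1} W - W t))"
    by (auto simp: grad_def W_def)
  ultimately show ?thesis
    using len_triangle[of "\<lambda>t. (\<theta> / len v) *\<^sub>R v t" "\<lambda>t. integral {0..1} W - W t"]
    by (simp add: continuous_intros v(1) Wc)
qed

text \<open>The integrand is the inner product of the displacement with the derivative of the force; integrating
by parts puts the derivative on the displacement, which exhibits the gradient.\<close>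

lemma darea_by_parts:
  assumes K: "continuous_on UNIV K" and v: "continuous_on {0..1} v"
    and w: "continuous_on {0..1} w" "integral {0..1} w = 0"
  shows "darea K p v q w = integral {0..1} (\<lambda>t. w t \<bullet> force K p v t) - q \<bullet> force K p v 1"
proof -
  define W where "W = force K p v"
  have Wc: "continuous_on {0..1} W" unfolding W_def by (rule force_cont[OF K v(1)])
  define g where "g = (\<lambda>t. (q + prim w t) \<bullet> (K (p + prim v t) *\<^sub>R (\<i> * v t)) + w t \<bullet> W t)"
  have "(g has_integral (q + prim w 1) \<bullet> W 1 - (q + prim w 0) \<bullet> W 0) {0..1}"
  proof (rule fundamental_theorem_of_calculus)
    fix t :: real assume t: "t \<in> {0..1}"
    have "((\<lambda>t. q + prim w t) has_vector_derivative w t) (at t within {0..1})"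
      by (auto intro!: derivative_eq_intros prim_deriv w t)
    moreover have "(W has_vector_derivative K (p + prim v t) *\<^sub>R (\<i> * v t)) (at t within {0..1})"
      unfolding W_def force_def by (rule prim_deriv[OF force_integrand_cont[OF K v] t])
    ultimately show "((\<lambda>t. (q + prim w t) \<bullet> W t) has_vector_derivative g t) (at t within {0..1})"
      unfolding g_def by (rule bounded_bilinear.has_vector_derivative[OF bounded_bilinear_inner])
  qed simp
  then have 1: "integral {0..1} g = q \<bullet> W 1"
    using w(2) by (simp add: integral_unique prim_def W_def force_def)
  have c: "continuous_on {0..1} g" "continuous_on {0..1} (\<lambda>t. w t \<bullet> W t)"
    unfolding g_def by (intro continuous_intros prim_cont force_integrand_cont[OF K v] w v Wc)+
  have "darea K p v q w = integral {0..1} (\<lambda>t. w t \<bullet> W t - g t)"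
    unfolding darea_def by (rule integral_cong) (simp add: g_def wedge_inner)
  also have "\<dots> = integral {0..1} (\<lambda>t. w t \<bullet> W t) - q \<bullet> W 1"
    using 1 by (simp add: integral_diff integrable_unit c)
  finally show ?thesis by (simp add: W_def)
qed

lemma first_variation_grad:
  assumes K: "continuous_on UNIV K" and v: "continuous_on {0..1} v" "integral {0..1} v = 0"
  shows "\<theta> / len v * integral {0..1} (\<lambda>t. v t \<bullet> grad K \<theta> p v t)
     - darea K p v (force K p v 1) (grad K \<theta> p v) = slope K \<theta> p v"
proof -
  define W where "W = force K p v"
  define g where "g = grad K \<theta> p v"
  have Wc: "continuous_on {0..1} W" unfolding W_def by (rule force_cont[OF K v(1)])
  have gc: "continuous_on {0..1} g" unfolding g_def by (rule grad_cont[OF K v(1)])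
  have g0: "integral {0..1} g = 0" unfolding g_def by (rule integral_grad[OF K v])
  have "(len g)\<^sup>2 = integral {0..1} (\<lambda>t. \<theta> / len v * (v t \<bullet> g t) - g t \<bullet> W t + g t \<bullet> integral {0..1} W)"
    unfolding len_square[OF gc]
  proof (rule integral_cong)
    fix t :: real
    have "(norm (g t))\<^sup>2 = g t \<bullet> ((\<theta> / len v) *\<^sub>R v t - (W t - integral {0..1} W))"
      unfolding power2_norm_eq_inner by (simp add: g_def grad_def W_def)
    then show "(norm (g t))\<^sup>2 = \<theta> / len v * (v t \<bullet> g t) - g t \<bullet> W t + g t \<bullet> integral {0..1} W"
      by (simp add: inner_diff inner_commute)
  qed
  also have "\<dots> = \<theta> / len v * integral {0..1} (\<lambda>t. v t \<bullet> g t) - integral {0..1} (\<lambda>t. g t \<bullet> W t)"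
  proof -
    have "integral {0..1} (\<lambda>t. c * (v t \<bullet> g t) - g t \<bullet> W t + g t \<bullet> integral {0..1} W) =
        c * integral {0..1} (\<lambda>t. v t \<bullet> g t) - integral {0..1} (\<lambda>t. g t \<bullet> W t)" for c
      using g0 by (simp add: integral_add integral_diff integrable_unit continuous_intros gc v Wc)
    then show ?thesis .
  qed
  finally show ?thesis
    using darea_by_parts[OF K v(1) gc g0, of p "W 1"]
    by (simp add: slope_def power2_norm_eq_inner flip: W_def g_def)
qed

section \<open>Descent along the gradient\<close>

text \<open>The first variation varies little along a short segment of loops, by the modulus of continuity \<open>e\<close> of \<open>K\<close> at
the scale of the displacement.\<close>

lemma darea_line_close:
  assumes K: "continuous_on UNIV K" and k: "\<And>z. \<bar>K z\<bar> \<le> k"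
    and v: "continuous_on {0..1} v" and w: "continuous_on {0..1} w"
    and d: "\<And>z z'. norm (z' - z) \<le> norm q + len w \<Longrightarrow> \<bar>K z' - K z\<bar> \<le> e"
    and \<sigma>: "\<sigma> \<in> {0..1}"
  shows "\<bar>darea K (p + \<sigma> *\<^sub>R q) (\<lambda>t. v t + \<sigma> *\<^sub>R w t) q w - darea K p v q w\<bar>
     \<le> (norm q + len w) * (e * len v + k * len w)"
proof -
  define N where "N = norm q + len w"
  have N0: "0 \<le> N" using len_nonneg[OF w] by (simp add: N_def)
  have k0: "0 \<le> k" using k[of 0] by linarith
  have e0: "0 \<le> e" using d[of 0 0] N0 by (simp add: N_def)
  have lvc: "continuous_on {0..1} (\<lambda>t. v t + \<sigma> *\<^sub>R w t)" by (intro continuous_intros v w)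
  define f where "f = (\<lambda>t. K (p + \<sigma> *\<^sub>R q + prim (\<lambda>t. v t + \<sigma> *\<^sub>R w t) t) * wedge (q + prim w t) (v t + \<sigma> *\<^sub>R w t))"
  define g where "g = (\<lambda>t. K (p + prim v t) * wedge (q + prim w t) (v t))"
  have fg: "continuous_on {0..1} f" "continuous_on {0..1} g"
    unfolding f_def g_def by (rule darea_cont K lvc v w)+
  have "darea K (p + \<sigma> *\<^sub>R q) (\<lambda>t. v t + \<sigma> *\<^sub>R w t) q w - darea K p v q w = integral {0..1} (\<lambda>t. f t - g t)"
    using fg by (simp add: darea_def f_def g_def integral_diff integrable_unit)
  also have "norm \<dots> \<le> integral {0..1} (\<lambda>t. N * (e * norm (v t) + k * norm (w t)))"
  proof (rule norm_integral_unit_le)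
    fix t :: real assume t: "t \<in> {0..1}"
    define a where "a = K (p + \<sigma> *\<^sub>R q + prim (\<lambda>t. v t + \<sigma> *\<^sub>R w t) t)"
    define b where "b = K (p + prim v t)"
    have pw: "norm (prim w t) \<le> len w" by (rule norm_prim_le[OF w t])
    have qN: "norm (q + prim w t) \<le> N"
      using pw norm_triangle_ineq[of q "prim w t"] by (simp add: N_def)
    have "\<bar>a - b\<bar> \<le> e" unfolding a_def b_def
    proof (rule d)
      have "p + \<sigma> *\<^sub>R q + prim (\<lambda>t. v t + \<sigma> *\<^sub>R w t) t - (p + prim v t) = \<sigma> *\<^sub>R (q + prim w t)"
        using t by (subst prim_add) (auto intro!: continuous_intros v w simp: algebra_simps)
      also have "norm \<dots> \<le> N" using qN \<sigma> by (simp add: mult_left_le_one_le order_trans[OF mult_left_le_one_le])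
      finally show "norm (p + \<sigma> *\<^sub>R q + prim (\<lambda>t. v t + \<sigma> *\<^sub>R w t) t - (p + prim v t)) \<le> norm q + len w"
        by (simp add: N_def)
    qed
    then have 1: "\<bar>(a - b) * wedge (q + prim w t) (v t)\<bar> \<le> e * (N * norm (v t))"
      unfolding abs_mult
      by (intro mult_mono order_trans[OF abs_wedge_le] mult_right_mono qN) (auto simp: e0)
    have "\<bar>a\<bar> \<le> k" unfolding a_def by (rule k)
    then have "\<bar>a * \<sigma>\<bar> \<le> k" using k0 \<sigma> mult_mono[of "\<bar>a\<bar>" k \<sigma> 1] by (simp add: abs_mult)
    then have 2: "\<bar>(a * \<sigma>) * wedge (q + prim w t) (w t)\<bar> \<le> k * (N * norm (w t))"
      unfolding abs_mult[of "a * \<sigma>"]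
      by (intro mult_mono order_trans[OF abs_wedge_le] mult_right_mono qN) (auto simp: k0)
    have "f t - g t = (a - b) * wedge (q + prim w t) (v t) + (a * \<sigma>) * wedge (q + prim w t) (w t)"
      unfolding f_def g_def a_def[symmetric] b_def[symmetric] by (simp add: wedge_add algebra_simps)
    then show "norm (f t - g t) \<le> N * (e * norm (v t) + k * norm (w t))"
      using 1 2 unfolding real_norm_def
      by (smt (verit) mult.commute mult.left_commute distrib_left)
  qed (intro continuous_intros fg v w)+
  also have "\<dots> = N * (e * integral {0..1} (\<lambda>t. norm (v t)) + k * integral {0..1} (\<lambda>t. norm (w t)))"
    by (simp add: integral_add integrable_unit continuous_intros v w)
  also have "\<dots> \<le> N * (e * len v + k * len w)"
    by (intro mult_left_mono add_mono integral_norm_le_len v w e0 k0 N0)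
  finally show ?thesis by (simp add: N_def)
qed

text \<open>First-order decrease of the action, up to an error that consists of the quadratic term of the length and the variation
of the first variation of the area along the segment.\<close>

lemma descent_step:
  assumes K: "continuous_on UNIV K" and k: "\<And>z. \<bar>K z\<bar> \<le> k"
    and v: "continuous_on {0..1} v" "integral {0..1} v = 0" "0 < len v"
    and \<theta>: "0 \<le> \<theta>" and \<tau>: "0 \<le> \<tau>"
    and N: "norm (force K p v 1) + len (grad K \<theta> p v) \<le> G"
    and d: "\<And>z z'. norm (z' - z) \<le> \<tau> * G \<Longrightarrow> \<bar>K z' - K z\<bar> \<le> e"
  shows "action K \<theta> (p - \<tau> *\<^sub>R force K p v 1) (\<lambda>t. v t - \<tau> *\<^sub>R grad K \<theta> p v t)
    \<le> action K \<theta> p v - \<tau> * slope K \<theta> p v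
       + \<tau> * (\<theta> * \<tau> * G\<^sup>2 / (2 * len v) + G * (e * len v + k * (\<tau> * G)))"
proof -
  define g where "g = grad K \<theta> p v"
  define W1 where "W1 = force K p v 1"
  define q where "q = (- \<tau>) *\<^sub>R W1"
  define w where "w = (\<lambda>t. (- \<tau>) *\<^sub>R g t)"
  define L where "L = len v"
  have gc: "continuous_on {0..1} g" unfolding g_def by (rule grad_cont[OF K v(1)])
  have g0: "integral {0..1} g = 0" unfolding g_def by (rule integral_grad[OF K v(1,2)])
  have wc: "continuous_on {0..1} w" unfolding w_def by (intro continuous_intros gc)
  have w0: "integral {0..1} w = 0" unfolding w_def using g0 by simp
  have lg: "0 \<le> len g" by (rule len_nonneg[OF gc])
  have k0: "0 \<le> k" using k[of 0] by linarith
  have G0: "0 \<le> G" using N lg norm_ge_zero[of W1] unfolding g_def[symmetric] W1_def[symmetric] by linarith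
  have e0: "0 \<le> e" using d[of 0 0] \<tau> G0 by simp
  have lw: "len w = \<tau> * len g" using \<tau> by (simp add: w_def len_scaleR del: scaleR_minus_left)
  have lwG: "len w \<le> \<tau> * G"
    unfolding lw using order_trans[OF _ N, of "len g"] \<tau> by (intro mult_left_mono) (auto simp: g_def)
  have qw: "norm q + len w \<le> \<tau> * G"
    using mult_left_mono[OF N \<tau>] \<tau> by (simp add: q_def lw g_def W1_def distrib_left)
  have qw0: "0 \<le> norm q + len w" using lg \<tau> by (simp add: lw)
  have l: "len (\<lambda>t. v t + w t) \<le> L + integral {0..1} (\<lambda>t. v t \<bullet> w t) / L + (len w)\<^sup>2 / (2 * L)"
    unfolding L_def by (rule len_add_le[OF v(1) wc v(3)])
  have B: "(norm q + len w) * (e * L + k * len w) \<le> (\<tau> * G) * (e * L + k * (\<tau> * G))"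
    using qw lwG e0 k0 v(3) \<tau> G0 qw0 len_nonneg[OF wc] by (intro mult_mono add_mono) (auto simp: L_def)
  have D: "\<bar>darea K (p + \<sigma> *\<^sub>R q) (\<lambda>t. v t + \<sigma> *\<^sub>R w t) q w - darea K p v q w\<bar> \<le> (\<tau> * G) * (e * L + k * (\<tau> * G))"
    if "\<sigma> \<in> {0..1}" for \<sigma>
    unfolding L_def
    by (rule order_trans[OF darea_line_close[OF K k v(1) wc _ that] B[unfolded L_def]], rule d)
       (use qw in auto)
  have dc: "continuous_on {0..1} (\<lambda>\<sigma>. darea K (p + \<sigma> *\<^sub>R q) (\<lambda>t. v t + \<sigma> *\<^sub>R w t) q w)"
  proof -
    have "continuous_on ({0..1} \<times> {0..1}) (\<lambda>(\<sigma>, t). v t + \<sigma> *\<^sub>R w t)"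
      using continuous_on_add[OF continuous_snd_on[OF v(1), of "{0..1}"] continuous_scaled[OF wc, of "{0..1}"]]
      by (simp add: split_beta)
    then show ?thesis by (intro continuous_darea K continuous_snd_on wc continuous_intros)
  qed
  have "area K (p + q) (\<lambda>t. v t + w t) - area K p v - darea K p v q w =
     integral {0..1} (\<lambda>\<sigma>. darea K (p + \<sigma> *\<^sub>R q) (\<lambda>t. v t + \<sigma> *\<^sub>R w t) q w - darea K p v q w)"
    using area_diff[OF K v(1,2) wc w0, of p q] dc by (simp add: integral_diff integrable_unit)
  also have "norm \<dots> \<le> (\<tau> * G) * (e * L + k * (\<tau> * G))"
    by (rule norm_integral_unit_le_const) (use D in \<open>auto intro!: continuous_intros dc\<close>)
  finally have A: "area K (p + q) (\<lambda>t. v t + w t) \<ge> area K p v + darea K p v q w - (\<tau> * G) * (e * L + k * (\<tau> * G))"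
    by (simp add: abs_le_iff)
  have i: "integral {0..1} (\<lambda>t. v t \<bullet> w t) = - \<tau> * integral {0..1} (\<lambda>t. v t \<bullet> g t)"
    by (simp add: w_def del: scaleR_minus_left)
  have da: "darea K p v q w = - \<tau> * darea K p v W1 g"
    unfolding darea_def integral_mult_right[symmetric]
  proof (rule integral_cong)
    fix t :: real
    have "q + prim w t = (- \<tau>) *\<^sub>R (W1 + prim g t)"
      unfolding q_def w_def prim_scaleR by (simp only: scaleR_add_right)
    then show "K (p + prim v t) * wedge (q + prim w t) (v t) = - \<tau> * (K (p + prim v t) * wedge (W1 + prim g t) (v t))"
      by (simp del: scaleR_minus_left)
  qed
  have "(len w)\<^sup>2 \<le> (\<tau> * G)\<^sup>2" using lwG len_nonneg[OF wc] by (intro power_mono)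
  then have "\<theta> * ((len w)\<^sup>2 / (2 * L)) \<le> \<theta> * ((\<tau> * G)\<^sup>2 / (2 * L))"
    using \<theta> v(3) by (intro mult_left_mono divide_right_mono) (auto simp: L_def)
  moreover have "\<theta> * len (\<lambda>t. v t + w t) \<le>
      \<theta> * L - \<tau> * (\<theta> / L * integral {0..1} (\<lambda>t. v t \<bullet> g t)) + \<theta> * ((len w)\<^sup>2 / (2 * L))"
    using mult_left_mono[OF l \<theta>] i by (simp add: distrib_left right_diff_distrib mult.left_commute)
  moreover have "\<theta> / L * integral {0..1} (\<lambda>t. v t \<bullet> g t) - darea K p v W1 g = slope K \<theta> p v"
    unfolding L_def g_def W1_def by (rule first_variation_grad[OF K v(1,2)])
  then have "\<tau> * slope K \<theta> p v = \<tau> * (\<theta> / L * integral {0..1} (\<lambda>t. v t \<bullet> g t)) - \<tau> * darea K p v W1 g"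
    by (simp only: right_diff_distrib[symmetric])
  ultimately have "\<theta> * len (\<lambda>t. v t + w t) - area K (p + q) (\<lambda>t. v t + w t) \<le>
    \<theta> * L - area K p v - \<tau> * slope K \<theta> p v + (\<theta> * ((\<tau> * G)\<^sup>2 / (2 * L)) + (\<tau> * G) * (e * L + k * (\<tau> * G)))"
    using A da by linarith
  also have "(\<theta> * ((\<tau> * G)\<^sup>2 / (2 * L)) + (\<tau> * G) * (e * L + k * (\<tau> * G))) =
     \<tau> * (\<theta> * \<tau> * G\<^sup>2 / (2 * L) + G * (e * L + k * (\<tau> * G)))"
    by (simp add: power2_eq_square algebra_simps)
  finally show ?thesis
    by (simp add: action_def L_def w_def q_def W1_def g_def)
qed

text \<open>All bounds depend only on the range of \<open>len\<close>, and not on the position of the loop, because \<open>K\<close> is bounded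
and uniformly continuous. Every step up to a fixed size \<open>\<tau>\<^sub>0\<close> therefore decreases the action at a fixed rate, which allows
the step to depend continuously on the loop.\<close>

lemma uniform_descent:
  assumes K: "uniformly_continuous_on UNIV K" and k: "\<And>z. \<bar>K z\<bar> \<le> k"
    and "0 < m" "0 < M" "0 < \<theta>" "0 < \<delta>"
  obtains \<tau>\<^sub>0 where "0 < \<tau>\<^sub>0"
    "\<And>p v \<tau>. \<lbrakk>continuous_on {0..1} v; integral {0..1} v = 0; m \<le> len v; len v \<le> M;
        \<delta> \<le> slope K \<theta> p v; 0 \<le> \<tau>; \<tau> \<le> \<tau>\<^sub>0\<rbrakk> \<Longrightarrow>
      action K \<theta> (p - \<tau> *\<^sub>R force K p v 1) (\<lambda>t. v t - \<tau> *\<^sub>R grad K \<theta> p v t)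
      \<le> action K \<theta> p v - \<tau> * \<delta> / 2"
proof -
  have Kc: "continuous_on UNIV K" by (rule uniformly_continuous_imp_continuous[OF K])
  have k0: "0 \<le> k" using k[of 0] by linarith
  \<comment> \<open>\<open>G\<close> bounds the displacement per unit step; \<open>e\<close> and \<open>\<tau>\<^sub>0\<close> are chosen so that each of the two error terms stays below \<open>\<delta> / 4\<close>.\<close>
  define G where "G = \<theta> + 3 * k * M"
  have G: "0 < G" unfolding G_def using assms k0 by (intro add_pos_nonneg) auto
  define e where "e = \<delta> / (4 * G * M)"
  have e: "0 < e" unfolding e_def using assms G by simp
  obtain d where d: "0 < d" "\<And>z z'. dist z' z < d \<Longrightarrow> dist (K z') (K z) < e"
    using K e unfolding uniformly_continuous_on_def by auto
  define c where "c = \<theta> * G\<^sup>2 / (2 * m) + G * k * G"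
  have c: "0 < c" unfolding c_def using assms k0 G by (intro add_pos_nonneg) auto
  define \<tau>\<^sub>0 where "\<tau>\<^sub>0 = min (d / (2 * G)) (\<delta> / (4 * c))"
  show ?thesis
  proof (rule that)
    show "0 < \<tau>\<^sub>0" unfolding \<tau>\<^sub>0_def using d G c assms by simp
    fix p v \<tau>
    assume v: "continuous_on {0..1} v" "integral {0..1} v = 0" "m \<le> len v" "len v \<le> M"
      and s: "\<delta> \<le> slope K \<theta> p v" and \<tau>: "0 \<le> \<tau>" "\<tau> \<le> \<tau>\<^sub>0"
    have L: "0 < len v" using v(3) assms(3) by simp
    have kM: "k * len v \<le> k * M" using v(4) k0 by (rule mult_left_mono)
    have N: "norm (force K p v 1) + len (grad K \<theta> p v) \<le> G"
      using norm_force_le[OF Kc v(1) k, of 1 p] len_grad_le[OF Kc v(1) L k, of \<theta> p] kM \<open>0 < \<theta>\<close>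
      by (simp add: G_def)
    have "\<tau> \<le> d / (2 * G)" "\<tau> \<le> \<delta> / (4 * c)" using \<tau>(2) by (auto simp: \<tau>\<^sub>0_def)
    then have \<tau>G: "\<tau> * G \<le> d / 2" and \<tau>c: "\<tau> * c \<le> \<delta> / 4" using G c by (simp_all add: field_simps)
    define err where "err = \<theta> * \<tau> * G\<^sup>2 / (2 * len v) + G * (e * len v + k * (\<tau> * G))"
    have step: "action K \<theta> (p - \<tau> *\<^sub>R force K p v 1) (\<lambda>t. v t - \<tau> *\<^sub>R grad K \<theta> p v t)
      \<le> action K \<theta> p v - \<tau> * slope K \<theta> p v
       + \<tau> * err"
      unfolding err_def
    proof (rule descent_step[OF Kc k v(1,2) L _ \<tau>(1) N])
      fix z z' :: complex assume "norm (z' - z) \<le> \<tau> * G"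
      then have "dist z' z < d" using \<tau>G d(1) by (simp add: dist_norm)
      from d(2)[OF this] show "\<bar>K z' - K z\<bar> \<le> e" by (simp add: dist_real_def)
    qed (use \<open>0 < \<theta>\<close> in simp)
    have "\<theta> * \<tau> * G\<^sup>2 / (2 * len v) \<le> \<theta> * \<tau> * G\<^sup>2 / (2 * m)"
      using v(3) assms \<tau> L by (intro divide_left_mono) auto
    moreover have "G * (e * len v) \<le> G * (e * M)"
      using v(4) e G by (intro mult_left_mono) auto
    moreover have "G * (e * M) = \<delta> / 4" using G assms by (simp add: e_def)
    moreover have "\<theta> * \<tau> * G\<^sup>2 / (2 * m) + G * (k * (\<tau> * G)) = \<tau> * c"
      by (simp add: c_def algebra_simps)
    ultimately have small: "err \<le> \<delta> / 2"
      unfolding err_def distrib_left[of G] using \<tau>c by linarith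
    have "\<tau> * \<delta> \<le> \<tau> * slope K \<theta> p v" using s \<tau>(1) by (rule mult_left_mono)
    moreover have "\<tau> * err \<le> \<tau> * (\<delta> / 2)"
      using small \<tau>(1) by (rule mult_left_mono)
    ultimately show "action K \<theta> (p - \<tau> *\<^sub>R force K p v 1) (\<lambda>t. v t - \<tau> *\<^sub>R grad K \<theta> p v t)
      \<le> action K \<theta> p v - \<tau> * \<delta> / 2" using step by simp
  qed
qed

section \<open>The mountain pass level\<close>

text \<open>The final condition is imposed at the largest parameter \<open>\<Theta>\<close>. By monotonicity in \<open>\<theta>\<close> it holds for all
smaller parameters too, so the same family of paths serves all of them and the levels can be compared.\<close>

definition mountain_path :: "(complex \<Rightarrow> real) \<Rightarrow> real \<Rightarrow> (real \<Rightarrow> complex) \<Rightarrow> (real \<Rightarrow> real \<Rightarrow> complex) \<Rightarrow> bool" where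
  "mountain_path K \<Theta> P V \<longleftrightarrow>
     continuous_on {0..1} P \<and> continuous_on ({0..1} \<times> {0..1}) (\<lambda>(s, t). V s t) \<and>
     (\<forall>s\<in>{0..1}. integral {0..1} (V s) = 0) \<and>
     len (V 0) = 0 \<and> 0 < len (V 1) \<and> action K \<Theta> (P 1) (V 1) \<le> 0"

definition upper_heights :: "(complex \<Rightarrow> real) \<Rightarrow> real \<Rightarrow> real \<Rightarrow> real set" where
  "upper_heights K \<Theta> \<theta> =
     {c. \<exists>P V. mountain_path K \<Theta> P V \<and> (\<forall>s\<in>{0..1}. action K \<theta> (P s) (V s) \<le> c)}"

definition level :: "(complex \<Rightarrow> real) \<Rightarrow> real \<Rightarrow> real \<Rightarrow> real" where
  "level K \<Theta> \<theta> = Inf (upper_heights K \<Theta> \<theta>)"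

definition almost_critical ::
  "(complex \<Rightarrow> real) \<Rightarrow> real \<Rightarrow> real \<Rightarrow> real \<Rightarrow> real \<Rightarrow> real \<Rightarrow> complex \<Rightarrow> (real \<Rightarrow> complex) \<Rightarrow> bool" where
  "almost_critical K \<theta> c m M \<delta> p v \<longleftrightarrow>
     continuous_on {0..1} v \<and> integral {0..1} v = 0 \<and> m \<le> len v \<and> len v \<le> M \<and>
     slope K \<theta> p v < \<delta> \<and> \<bar>action K \<theta> p v - c\<bar> < \<delta>"

lemma slice_cont:
  fixes V :: "real \<Rightarrow> real \<Rightarrow> 'a::topological_space"
  assumes V: "continuous_on ({0..1} \<times> {0..1}) (\<lambda>(s, t). V s t)" and s: "s \<in> {0..1}"
  shows "continuous_on {0..1} (V s)"
proof -
  have "continuous_on {0..1} (\<lambda>t::real. (s, t))" by (intro continuous_intros)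
  from continuous_on_compose2[OF V this] show ?thesis using s by (simp add: image_subset_iff)
qed

lemma abs_area_le_global:
  assumes "continuous_on UNIV K" "continuous_on {0..1} v" "\<And>z. \<bar>K z\<bar> \<le> k"
  shows "\<bar>area K p v\<bar> \<le> k * (len v)\<^sup>2 / 2"
  by (rule abs_area_le) (use assms in auto)

lemma action_mono:
  assumes "continuous_on {0..1} v" "\<theta> \<le> \<theta>'"
  shows "action K \<theta> p v \<le> action K \<theta>' p v"
  unfolding action_def using mult_right_mono[OF assms(2) len_nonneg[OF assms(1)]] by simp

lemma continuous_action:
  fixes S :: "'a::topological_space set"
  assumes K: "continuous_on UNIV K" and p: "continuous_on S P"
    and V: "continuous_on (S \<times> {0..1}) (\<lambda>(s, t). V s t)"
  shows "continuous_on S (\<lambda>s. action K \<theta> (P s) (V s))"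
  unfolding action_def by (intro continuous_intros continuous_len[OF V] continuous_area[OF K p V])

text \<open>On its way from length zero to a loop of nonpositive action, a path meets loops with \<open>len = \<theta> / k\<close>, where
the isoperimetric inequality leaves half of the length term.\<close>

lemma mountain_path_height:
  assumes K: "continuous_on UNIV K" and k: "\<And>z. \<bar>K z\<bar> \<le> k" "0 < k"
    and \<theta>: "0 < \<theta>" "\<theta> \<le> \<Theta>" and path: "mountain_path K \<Theta> P V"
  obtains s where "s \<in> {0..1}" "\<theta>\<^sup>2 / (2 * k) \<le> action K \<theta> (P s) (V s)"
proof -
  have V: "continuous_on ({0..1} \<times> {0..1}) (\<lambda>(s, t). V s t)" and V0: "len (V 0) = 0"
    and V1: "0 < len (V 1)" "\<Theta> * len (V 1) \<le> area K (P 1) (V 1)"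
    using path by (auto simp: mountain_path_def action_def)
  have "area K (P 1) (V 1) \<le> k * (len (V 1))\<^sup>2 / 2"
    using abs_area_le_global[OF K slice_cont[OF V] k(1), of 1 "P 1"] by simp
  also have "\<dots> = (k * len (V 1) / 2) * len (V 1)" by (simp add: power2_eq_square)
  finally have "\<Theta> * len (V 1) \<le> (k * len (V 1) / 2) * len (V 1)" using V1(2) by linarith
  then have "\<Theta> \<le> k * len (V 1) / 2" by (rule mult_right_le_imp_le) (rule V1(1))
  then have "\<theta> / k \<le> len (V 1)" using \<theta> k(2) V1(1) by (simp add: field_simps)
  moreover have "0 \<le> \<theta> / k" using \<theta> k by simp
  ultimately obtain s where s: "0 \<le> s" "s \<le> 1" "len (V s) = \<theta> / k"
    using IVT'[of "\<lambda>s. len (V s)" 0 "\<theta> / k" 1] V0 continuous_len[OF V] by auto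
  have "area K (P s) (V s) \<le> k * (len (V s))\<^sup>2 / 2"
    using abs_area_le_global[OF K slice_cont[OF V] k(1), of s "P s"] s by simp
  then have "\<theta>\<^sup>2 / (2 * k) \<le> action K \<theta> (P s) (V s)"
    unfolding action_def s(3) using k by (simp add: field_simps power2_eq_square)
  then show ?thesis using that s by auto
qed

context
  fixes K :: "complex \<Rightarrow> real" and k \<Theta> :: real
  assumes K: "continuous_on UNIV K" and k: "\<And>z. \<bar>K z\<bar> \<le> k" "0 < k"
begin

lemma level_le:
  assumes "0 < \<theta>" "\<theta> \<le> \<Theta>" "mountain_path K \<Theta> P V" "\<And>s. s \<in> {0..1} \<Longrightarrow> action K \<theta> (P s) (V s) \<le> c"
  shows "level K \<Theta> \<theta> \<le> c"
  unfolding level_def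
proof (rule cInf_lower)
  show "bdd_below (upper_heights K \<Theta> \<theta>)"
  proof (rule bdd_belowI)
    fix c assume "c \<in> upper_heights K \<Theta> \<theta>"
    then obtain P V where PV: "mountain_path K \<Theta> P V" "\<forall>s\<in>{0..1}. action K \<theta> (P s) (V s) \<le> c"
      unfolding upper_heights_def by auto
    obtain s where "s \<in> {0..1}" "\<theta>\<^sup>2 / (2 * k) \<le> action K \<theta> (P s) (V s)"
      by (rule mountain_path_height[OF K k assms(1,2) PV(1)])
    then show "\<theta>\<^sup>2 / (2 * k) \<le> c" using PV(2) by force
  qed
  show "c \<in> upper_heights K \<Theta> \<theta>"
    unfolding upper_heights_def mem_Collect_eq
    by (rule exI[of _ P], rule exI[of _ V]) (use assms in simp)
qed

lemma level_nearly_attained: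
  assumes "mountain_path K \<Theta> P\<^sub>0 V\<^sub>0" "level K \<Theta> \<theta> < c"
  obtains P V where "mountain_path K \<Theta> P V" "\<And>s. s \<in> {0..1} \<Longrightarrow> action K \<theta> (P s) (V s) < c"
proof -
  have "continuous_on {0..1} (\<lambda>s. action K \<theta> (P\<^sub>0 s) (V\<^sub>0 s))"
    using assms(1) by (intro continuous_action K) (auto simp: mountain_path_def)
  from continuous_attains_sup[OF compact_Icc _ this]
  obtain b where "\<forall>s\<in>{0..1}. action K \<theta> (P\<^sub>0 s) (V\<^sub>0 s) \<le> b" by auto
  then have "b \<in> upper_heights K \<Theta> \<theta>"
    unfolding upper_heights_def mem_Collect_eq
    by (intro exI[of _ "P\<^sub>0"] exI[of _ "V\<^sub>0"]) (use assms(1) in simp)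
  then have "upper_heights K \<Theta> \<theta> \<noteq> {}"
    by auto
  from cInf_lessD[OF this assms(2)[unfolded level_def]]
  obtain P V d where PV: "mountain_path K \<Theta> P V" "\<forall>s\<in>{0..1}. action K \<theta> (P s) (V s) \<le> d" "d < c"
    unfolding upper_heights_def by auto
  show ?thesis by (rule that[OF PV(1)]) (use PV in force)
qed

lemma level_ge:
  assumes "mountain_path K \<Theta> P\<^sub>0 V\<^sub>0" "0 < \<theta>" "\<theta> \<le> \<Theta>"
  shows "\<theta>\<^sup>2 / (2 * k) \<le> level K \<Theta> \<theta>"
proof (rule ccontr)
  assume "\<not> ?thesis"
  then have low: "level K \<Theta> \<theta> < \<theta>\<^sup>2 / (2 * k)" by simp
  obtain P V where PV: "mountain_path K \<Theta> P V"
    "\<And>s. s \<in> {0..1} \<Longrightarrow> action K \<theta> (P s) (V s) < \<theta>\<^sup>2 / (2 * k)"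
    using level_nearly_attained[OF assms(1) low] by metis
  obtain s where "s \<in> {0..1}" "\<theta>\<^sup>2 / (2 * k) \<le> action K \<theta> (P s) (V s)"
    by (rule mountain_path_height[OF K k assms(2,3) PV(1)])
  then show False using PV(2)[of s] by simp
qed

lemma level_mono:
  assumes "mountain_path K \<Theta> P\<^sub>0 V\<^sub>0" "0 < \<theta>" "\<theta> \<le> \<theta>'" "\<theta>' \<le> \<Theta>"
  shows "level K \<Theta> \<theta> \<le> level K \<Theta> \<theta>'"
proof (rule field_le_epsilon)
  fix e :: real assume "0 < e"
  then obtain P V where PV: "mountain_path K \<Theta> P V"
    "\<And>s. s \<in> {0..1} \<Longrightarrow> action K \<theta>' (P s) (V s) < level K \<Theta> \<theta>' + e"
    using level_nearly_attained[OF assms(1), of \<theta>' "level K \<Theta> \<theta>' + e"] by auto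
  show "level K \<Theta> \<theta> \<le> level K \<Theta> \<theta>' + e"
  proof (rule level_le[OF assms(2) _ PV(1)])
    fix s :: real assume s: "s \<in> {0..1}"
    have "continuous_on {0..1} (V s)" using PV(1) s by (auto simp: mountain_path_def intro: slice_cont)
    from action_mono[OF this assms(3), of K "P s"] PV(2)[OF s]
    show "action K \<theta> (P s) (V s) \<le> level K \<Theta> \<theta>' + e" by simp
  qed (use assms in simp)
qed

text \<open>One gradient step whose size is a continuous function of the action. The step is switched off below height \<open>b > 0\<close>,
which keeps both ends of the path and avoids loops of length zero, where the gradient is singular.\<close>

lemma descended_path:
  assumes path: "mountain_path K \<Theta> P V" and \<theta>: "0 < \<theta>" "\<theta> \<le> \<Theta>" and m: "0 < m" "0 < b"
    and \<tau>: "continuous_on UNIV \<tau>" "\<And>a. a \<le> b \<Longrightarrow> \<tau> a = 0"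
    and long: "\<And>s. s \<in> {0..1} \<Longrightarrow> b \<le> action K \<theta> (P s) (V s) \<Longrightarrow> m \<le> len (V s)"
  obtains P' V' where "mountain_path K \<Theta> P' V'"
    "\<And>s. s \<in> {0..1} \<Longrightarrow> action K \<theta> (P s) (V s) \<le> b \<Longrightarrow> P' s = P s \<and> V' s = V s"
    "\<And>s. s \<in> {0..1} \<Longrightarrow> b \<le> action K \<theta> (P s) (V s) \<Longrightarrow>
       P' s = P s - \<tau> (action K \<theta> (P s) (V s)) *\<^sub>R force K (P s) (V s) 1 \<and>
       V' s = (\<lambda>t. V s t - \<tau> (action K \<theta> (P s) (V s)) *\<^sub>R grad K \<theta> (P s) (V s) t)"
proof -
  have P: "continuous_on {0..1} P" and V: "continuous_on ({0..1} \<times> {0..1}) (\<lambda>(s, t). V s t)"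
    and V0: "\<And>s. s \<in> {0..1} \<Longrightarrow> integral {0..1} (V s) = 0" "len (V 0) = 0"
    and V1: "0 < len (V 1)" "action K \<Theta> (P 1) (V 1) \<le> 0"
    using path by (auto simp: mountain_path_def)
  define a where "a = (\<lambda>s. action K \<theta> (P s) (V s))"
  have ac: "continuous_on {0..1} a" unfolding a_def by (rule continuous_action[OF K P V])
  define T where "T = (\<lambda>s. \<tau> (a s))"
  have Tc: "continuous_on {0..1} T" unfolding T_def by (rule cont_comp[OF \<tau>(1) ac])
  have Vs: "continuous_on {0..1} (V s)" if "s \<in> {0..1}" for s using slice_cont[OF V that] .
  define W where "W = (\<lambda>s. force K (P s) (V s))"
  have fs: "continuous_on ({0..1::real} \<times> {0..1::real}) (\<lambda>z. f (fst z))" if "continuous_on {0..1} f" for f :: "real \<Rightarrow> 'b::topological_space"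
    by (rule continuous_on_compose2[OF that continuous_on_fst[OF continuous_on_id]]) auto
  have Wc: "continuous_on ({0..1} \<times> {0..1}) (\<lambda>(s, t). W s t)"
    unfolding W_def force_def
    by (rule continuous_prim2, unfold split_beta)
       (intro continuous_intros cont_comp[OF K] fs P V[unfolded split_beta] continuous_prim2[OF V, unfolded split_beta])
  have W1: "continuous_on {0..1} (\<lambda>s. W s 1)"
  proof -
    have "continuous_on {0..1} (\<lambda>s::real. (s, 1::real))" by (intro continuous_intros)
    from continuous_on_compose2[OF Wc this] show ?thesis by (simp add: image_subset_iff)
  qed
  define P' where "P' = (\<lambda>s. P s - T s *\<^sub>R W s 1)"
  \<comment> \<open>The maximum with \<open>m\<close> keeps the quotient continuous where the step is switched off and the length may vanish.\<close>
  define V' where "V' = (\<lambda>s t. V s t - T s *\<^sub>R ((\<theta> / max m (len (V s))) *\<^sub>R V s t - (W s t - integral {0..1} (W s))))"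
  have low: "P' s = P s \<and> V' s = V s" if "a s \<le> b" for s
    using \<tau>(2)[OF that] by (auto simp: P'_def V'_def T_def)
  have high: "P' s = P s - T s *\<^sub>R force K (P s) (V s) 1 \<and>
      V' s = (\<lambda>t. V s t - T s *\<^sub>R grad K \<theta> (P s) (V s) t)" if "s \<in> {0..1}" "b \<le> a s" for s
  proof -
    have "m \<le> len (V s)" using long[of s] that by (simp add: a_def)
    then show ?thesis by (simp add: P'_def V'_def W_def grad_def max_absorb2)
  qed
  have a0: "a 0 \<le> b"
    using abs_area_le_global[OF K Vs k(1), of 0 "P 0"] V0(2) m by (simp add: a_def action_def)
  have a1: "a 1 \<le> b"
    using action_mono[OF Vs \<theta>(2), of 1 K "P 1"] V1(2) m by (simp add: a_def)
  have "mountain_path K \<Theta> P' V'"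
    unfolding mountain_path_def
  proof (intro conjI ballI)
    show "continuous_on {0..1} P'" unfolding P'_def by (intro continuous_intros P Tc W1)
    show "continuous_on ({0..1} \<times> {0..1}) (\<lambda>(s, t). V' s t)"
    proof -
      have 1: "continuous_on {0..1} (\<lambda>s. \<theta> / max m (len (V s)))"
        using m by (intro continuous_intros continuous_len[OF V]) auto
      have 2: "continuous_on {0..1} (\<lambda>s. integral {0..1} (W s))"
        by (rule continuous_integral_unit[OF Wc])
      show ?thesis unfolding V'_def split_beta
        by (intro continuous_on_diff continuous_on_scaleR fs[OF Tc] fs[OF 1] fs[OF 2]
            V[unfolded split_beta] Wc[unfolded split_beta])
    qed
    fix s :: real assume s: "s \<in> {0..1}"
    show "integral {0..1} (V' s) = 0"
    proof (cases "a s \<le> b")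
      case True
      then show ?thesis using low V0(1)[OF s] by simp
    next
      case False
      then have "V' s = (\<lambda>t. V s t - T s *\<^sub>R grad K \<theta> (P s) (V s) t)" using high[OF s] by simp
      then show ?thesis
        using integral_grad[OF K Vs[OF s] V0(1)[OF s], of \<theta> "P s"] grad_cont[OF K Vs[OF s], of \<theta> "P s"] V0(1)[OF s]
        by (simp add: integral_diff integrable_unit continuous_intros Vs[OF s])
    qed
  qed (use low[OF a0] low[OF a1] V0 V1 in auto)
  then show ?thesis
    by (rule that) (use low high in \<open>auto simp: a_def T_def\<close>)
qed

text \<open>The monotonicity trick, for a parameter at which the level has bounded difference quotients along some
sequence of increments. Loops near the top of a nearly optimal path for \<open>\<theta> + h\<close> have \<open>len \<le> M\<close>. If all such loops were
steep, a descent step of fixed size would lower them by a fixed amount, which exceeds the excess of order \<open>h\<close> of the path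
over the level at \<open>\<theta>\<close>; the new path would contradict the definition of the level.\<close>

theorem almost_critical_loops:
  assumes unif: "uniformly_continuous_on UNIV K"
    and path: "mountain_path K \<Theta> P\<^sub>0 V\<^sub>0" and \<theta>: "0 < \<theta>" "\<theta> < \<Theta>"
    and D: "\<And>e. 0 < e \<Longrightarrow> \<exists>h. 0 < h \<and> h < e \<and> level K \<Theta> (\<theta> + h) \<le> level K \<Theta> \<theta> + D * h"
  obtains m M where "0 < m"
    "\<And>\<delta>. 0 < \<delta> \<Longrightarrow> \<exists>p v. almost_critical K \<theta> (level K \<Theta> \<theta>) m M \<delta> p v"
proof -
  define c where "c = level K \<Theta> \<theta>"
  have "0 < \<theta>\<^sup>2 / (2 * k)" using \<theta> k by simp
  then have c: "0 < c" using level_ge[OF path \<theta>(1)] \<theta> by (simp add: c_def)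
  \<comment> \<open>Loops shorter than \<open>m\<close> have action at most \<open>(\<theta> + k) m \<le> c / 4\<close>.\<close>
  define m where "m = min 1 (c / (4 * (\<theta> + k)))"
  have m: "0 < m" unfolding m_def using c \<theta> k by simp
  have long: "m \<le> len v" if v: "continuous_on {0..1} v" and a: "c / 2 \<le> action K \<theta> p v" for p v
  proof (rule ccontr)
    assume "\<not> m \<le> len v"
    then have l: "len v \<le> m" by simp
    have l0: "0 \<le> len v" by (rule len_nonneg[OF v])
    have "m \<le> c / (4 * (\<theta> + k))" by (simp add: m_def)
    moreover have "0 < 4 * (\<theta> + k)" using \<theta>(1) k(2) by simp
    ultimately have m1: "m \<le> 1" "m * (4 * (\<theta> + k)) \<le> c"
      by (auto simp only: pos_le_divide_eq) (simp add: m_def)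
    have "(len v)\<^sup>2 \<le> len v * 1"
      unfolding power2_eq_square using l m1 l0 by (intro mult_left_mono) auto
    then have "k * (len v)\<^sup>2 / 2 \<le> k * len v" using k l0 by (simp add: mult_left_mono)
    then have "action K \<theta> p v \<le> (\<theta> + k) * len v"
      using abs_area_le_global[OF K v k(1), of p] by (simp add: action_def algebra_simps abs_le_iff)
    also have "\<dots> \<le> (\<theta> + k) * m" using l \<theta> k by (intro mult_left_mono) auto
    also have "\<dots> \<le> c / 4" using m1 by (simp add: algebra_simps)
    finally show False using a c by simp
  qed
  define D' where "D' = max D 0"
  define M where "M = D' + 2"
  have M: "0 < M" by (simp add: M_def D'_def)
  show ?thesis
  proof (rule that[OF m], rule ccontr)
    fix \<delta> :: real
    assume \<delta>: "0 < \<delta>"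
      and "\<not> (\<exists>p v. almost_critical K \<theta> (level K \<Theta> \<theta>) m M \<delta> p v)"
    then have steep: "\<delta> \<le> slope K \<theta> p v"
      if "continuous_on {0..1} v" "integral {0..1} v = 0" "m \<le> len v" "len v \<le> M" "\<bar>action K \<theta> p v - c\<bar> < \<delta>" for p v
      using that unfolding c_def almost_critical_def by (meson not_le)
    obtain \<tau>\<^sub>0 where \<tau>\<^sub>0: "0 < \<tau>\<^sub>0" and descent:
      "\<And>p v \<tau>. \<lbrakk>continuous_on {0..1} v; integral {0..1} v = 0; m \<le> len v; len v \<le> M;
        \<delta> \<le> slope K \<theta> p v; 0 \<le> \<tau>; \<tau> \<le> \<tau>\<^sub>0\<rbrakk> \<Longrightarrow>
        action K \<theta> (p - \<tau> *\<^sub>R force K p v 1) (\<lambda>t. v t - \<tau> *\<^sub>R grad K \<theta> p v t)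
        \<le> action K \<theta> p v - \<tau> * \<delta> / 2"
      by (rule uniform_descent[OF unif k(1) m M \<theta>(1) \<delta>]) (rule that)
    \<comment> \<open>The last entry makes \<open>h M\<close>, which bounds the excess of the path over the level, smaller than \<open>\<delta>\<close> and the decrease \<open>\<tau>\<^sub>0 \<delta> / 2\<close>.\<close>
    define e where "e = min (min (c / 2) (\<Theta> - \<theta>)) (min \<delta> (\<tau>\<^sub>0 * \<delta> / 2) / M)"
    have "0 < e" unfolding e_def using c \<theta> \<delta> \<tau>\<^sub>0 M by simp
    then obtain h where h: "0 < h" "h < e" "level K \<Theta> (\<theta> + h) \<le> c + D * h"
      using D unfolding c_def by blast
    have h2: "h < c / 2" "\<theta> + h < \<Theta>" "h * M < \<delta>" "h * M < \<tau>\<^sub>0 * \<delta> / 2"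
      using h(2) M by (simp_all add: e_def pos_less_divide_eq)
    have Dh: "D * h \<le> D' * h" using h(1) by (intro mult_right_mono) (auto simp: D'_def)
    have D'h: "0 \<le> D' * h" using h(1) by (simp add: D'_def)
    have hM: "h * M = D' * h + 2 * h" by (simp add: M_def algebra_simps)
    obtain P V where PV: "mountain_path K \<Theta> P V"
      and low: "\<And>s. s \<in> {0..1} \<Longrightarrow> action K (\<theta> + h) (P s) (V s) < c + D' * h + h"
      using level_nearly_attained[OF path, of "\<theta> + h" "c + D' * h + h"] h Dh by auto
    have Vs: "continuous_on {0..1} (V s)" "integral {0..1} (V s) = 0" if "s \<in> {0..1}" for s
      using PV that by (auto simp: mountain_path_def intro: slice_cont)
    define a where "a = (\<lambda>s. action K \<theta> (P s) (V s))"
    have a_upper: "a s < c + D' * h + h" if "s \<in> {0..1}" for s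
      using action_mono[OF Vs(1)[OF that], of \<theta> "\<theta> + h" K "P s"] low[OF that] h by (simp add: a_def)
    have short: "len (V s) \<le> M" if "s \<in> {0..1}" "c - h \<le> a s" for s
    proof -
      have "h * len (V s) = action K (\<theta> + h) (P s) (V s) - a s"
        by (simp add: a_def action_def algebra_simps)
      also have "\<dots> \<le> h * M" using low[OF that(1)] that(2) by (simp add: hM)
      finally show ?thesis using h(1) by simp
    qed
    \<comment> \<open>Step size as a function of the action: zero below \<open>c - h\<close>, full above \<open>c - h / 2\<close>.\<close>
    define \<tau> where "\<tau> = (\<lambda>x. \<tau>\<^sub>0 * max 0 (min 1 ((x - (c - h)) / (h / 2))))"
    have \<tau>c: "continuous_on UNIV \<tau>" unfolding \<tau>_def using h by (intro continuous_intros) auto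
    have \<tau>_low: "\<tau> x = 0" if "x \<le> c - h" for x
      using that h by (simp add: \<tau>_def divide_le_0_iff)
    have \<tau>_high: "\<tau> x = \<tau>\<^sub>0" if "c - h / 2 \<le> x" for x
      using that h by (simp add: \<tau>_def le_divide_eq)
    have \<tau>_range: "0 \<le> \<tau> x" "\<tau> x \<le> \<tau>\<^sub>0" for x
      using \<tau>\<^sub>0 by (auto simp: \<tau>_def intro!: mult_left_le)
    have "\<theta> \<le> \<Theta>" "0 < c - h" using \<theta> h2 c by auto
    have long': "m \<le> len (V s)" if "s \<in> {0..1}" "c - h \<le> action K \<theta> (P s) (V s)" for s
      using long[OF Vs(1)[OF that(1)], of "P s"] that(2) h2(1) by simp
    obtain P' V' where P'V': "mountain_path K \<Theta> P' V'"
      and same: "\<And>s. s \<in> {0..1} \<Longrightarrow> action K \<theta> (P s) (V s) \<le> c - h \<Longrightarrow> P' s = P s \<and> V' s = V s"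
      and moved: "\<And>s. s \<in> {0..1} \<Longrightarrow> c - h \<le> action K \<theta> (P s) (V s) \<Longrightarrow>
         P' s = P s - \<tau> (action K \<theta> (P s) (V s)) *\<^sub>R force K (P s) (V s) 1 \<and>
         V' s = (\<lambda>t. V s t - \<tau> (action K \<theta> (P s) (V s)) *\<^sub>R grad K \<theta> (P s) (V s) t)"
      by (rule descended_path[OF PV \<theta>(1) \<open>\<theta> \<le> \<Theta>\<close> m \<open>0 < c - h\<close> \<tau>c]) (rule \<tau>_low long' that; assumption)+
    have "level K \<Theta> \<theta> \<le> c - h / 2"
    proof (rule level_le[OF \<theta>(1) \<open>\<theta> \<le> \<Theta>\<close> P'V'])
      fix s :: real assume s: "s \<in> {0..1}"
      show "action K \<theta> (P' s) (V' s) \<le> c - h / 2"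
      proof (cases "a s \<le> c - h")
        case True
        then show ?thesis using same[OF s] h(1) by (simp add: a_def)
      next
        case False
        then have as: "c - h \<le> a s" by simp
        have "D' * h + h < \<delta>" "h < \<delta>" using h2(3) hM h(1) D'h by linarith+
        then have "\<bar>a s - c\<bar> < \<delta>" using as a_upper[OF s] by linarith
        moreover have ml: "m \<le> len (V s)"
          using long[OF Vs(1)[OF s], of "P s"] as h2(1) by (simp add: a_def)
        ultimately have "\<delta> \<le> slope K \<theta> (P s) (V s)"
          using steep[OF Vs[OF s] ml short[OF s as], of "P s"] by (simp add: a_def)
        from descent[OF Vs[OF s] ml short[OF s as] this \<tau>_range[of "a s"]]
        have *: "action K \<theta> (P' s) (V' s) \<le> a s - \<tau> (a s) * \<delta> / 2"
          using moved[OF s] as by (simp add: a_def)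
        show ?thesis
        proof (cases "a s \<le> c - h / 2")
          case True
          have "0 \<le> \<tau> (a s) * \<delta>" using \<tau>_range(1)[of "a s"] \<delta> by simp
          then show ?thesis using * True by linarith
        next
          case False
          then show ?thesis using * \<tau>_high[of "a s"] a_upper[OF s] h2(4) hM h(1) by simp
        qed
      qed
    qed
    then show False using h(1) by (simp add: c_def)
  qed
qed

end

text \<open>A circle of radius \<open>\<rho>\<close> in a disc on which \<open>K \<ge> b\<close> has action at most \<open>2 \<pi> \<theta> \<rho> - \<pi> b \<rho>\<^sup>2\<close>, whose maximum over \<open>\<rho>\<close>
is \<open>\<pi> \<theta>\<^sup>2 / b\<close>. Compactness of the disc turns \<open>K > K\<^sub>0\<close> into \<open>K \<ge> b > K\<^sub>0\<close>.\<close>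

theorem mountain_path_of_circles:
  assumes K: "continuous_on UNIV K" and K0: "0 < K\<^sub>0" and \<Theta>: "0 < \<Theta>"
    and disc: "\<And>R. \<exists>z\<^sub>0. \<forall>z\<in>cball z\<^sub>0 R. K\<^sub>0 < K z"
  obtains P V b where "mountain_path K \<Theta> P V" "K\<^sub>0 < b"
    "\<And>s \<theta>. s \<in> {0..1} \<Longrightarrow> action K \<theta> (P s) (V s) \<le> pi * \<theta>\<^sup>2 / b"
proof -
  \<comment> \<open>The radius at which the action of a circle for the weight \<open>K\<^sub>0\<close> and the parameter \<open>\<Theta>\<close> returns to zero.\<close>
  define R where "R = 2 * \<Theta> / K\<^sub>0"
  have R: "0 < R" using K0 \<Theta> by (simp add: R_def)
  obtain z\<^sub>0 where z0: "\<And>z. z \<in> cball z\<^sub>0 R \<Longrightarrow> K\<^sub>0 < K z" using disc[of R] by blast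
  have "cball z\<^sub>0 R \<noteq> {}" using R by simp
  then obtain x where x: "x \<in> cball z\<^sub>0 R" "\<And>z. z \<in> cball z\<^sub>0 R \<Longrightarrow> K x \<le> K z"
    using continuous_attains_inf[OF compact_cball _ continuous_on_subset[OF K]] by (metis subset_UNIV)
  define b where "b = K x"
  have b: "K\<^sub>0 < b" "0 < b" using z0[OF x(1)] K0 by (auto simp: b_def)
  define P where "P = (\<lambda>s::real. z\<^sub>0 + of_real (s * R))"
  define V where "V = (\<lambda>s t. (s * R) *\<^sub>R (2 * pi * \<i> * cis (2 * pi * t)))"
  have cisd: "((\<lambda>t. cis (2 * pi * t)) has_vector_derivative 2 * pi * \<i> * cis (2 * pi * t)) (at t within A)" for t A
    by (auto intro!: derivative_eq_intros simp: has_vector_derivative_def scaleR_conv_of_real)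
  have Vc: "continuous_on {0..1} (V s)" for s
    unfolding V_def by (intro continuous_intros)
  have primV: "prim (V s) t = (s * R) *\<^sub>R (cis (2 * pi * t) - 1)" if "t \<in> {0..1}" for s t
  proof -
    have "((\<lambda>t. 2 * pi * \<i> * cis (2 * pi * t)) has_integral cis (2 * pi * t) - cis (2 * pi * 0)) {0..t}"
      by (rule fundamental_theorem_of_calculus) (use that cisd in auto)
    from integral_unique[OF has_integral_cmul[OF this, of "s * R"]] show ?thesis
      by (simp only: prim_def V_def) simp
  qed
  have V0: "integral {0..1} (V s) = 0" for s
    using primV[of 1 s] by (simp add: prim_def cis_2pi)
  have lenV: "len (V s) = 2 * pi * (s * R)" if "0 \<le> s" for s
    using that R by (simp add: len_def V_def norm_mult power_mult_distrib real_sqrt_mult)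
  have act: "action K \<theta> (P s) (V s) \<le> 2 * pi * \<theta> * (s * R) - b * pi * (s * R)\<^sup>2" if s: "s \<in> {0..1}" for s \<theta>
  proof -
    define q where "q = complex_of_real (s * R)"
    have a0: "area K z\<^sub>0 (\<lambda>_. 0) = 0" by (simp add: area_def darea_def wedge_def)
    have "P s = z\<^sub>0 + q" by (simp add: P_def q_def)
    then have eq: "area K (P s) (V s) = integral {0..1} (\<lambda>\<sigma>. darea K (z\<^sub>0 + \<sigma> *\<^sub>R q) (\<lambda>t. 0 + \<sigma> *\<^sub>R V s t) q (V s))"
      using area_diff[OF K, of "\<lambda>_. 0" "V s" z\<^sub>0 q] Vc V0 a0 by simp
    have dc: "continuous_on {0..1} (\<lambda>\<sigma>. darea K (z\<^sub>0 + \<sigma> *\<^sub>R q) (\<lambda>t. 0 + \<sigma> *\<^sub>R V s t) q (V s))"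
    proof (intro continuous_darea K continuous_intros)
      show "continuous_on ({0..1} \<times> {0..1}) (\<lambda>(\<sigma>, t). 0 + \<sigma> *\<^sub>R V s t)"
        using continuous_scaled[OF Vc] by simp
      show "continuous_on ({0..1} \<times> {0..1}) (\<lambda>(\<sigma>::real, t). V s t)" by (rule continuous_snd_on[OF Vc])
    qed
    have "integral {0..1} (\<lambda>\<sigma>. \<sigma> * (2 * pi * b * (s * R)\<^sup>2)) \<le> area K (P s) (V s)"
      unfolding eq
    proof (rule integral_unit_mono[OF _ dc])
      fix \<sigma> :: real assume \<sigma>: "\<sigma> \<in> {0..1}"
      have c: "continuous_on {0..1} (\<lambda>t. 0 + \<sigma> *\<^sub>R V s t)" by (intro continuous_intros Vc)
      have "integral {0..1} (\<lambda>t::real. \<sigma> * (2 * pi * b * (s * R)\<^sup>2)) \<le> darea K (z\<^sub>0 + \<sigma> *\<^sub>R q) (\<lambda>t. 0 + \<sigma> *\<^sub>R V s t) q (V s)"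
        unfolding darea_def
      proof (rule integral_unit_mono[OF _ darea_cont[OF K c Vc]])
        fix t :: real assume t: "t \<in> {0..1}"
        define z where "z = z\<^sub>0 + \<sigma> *\<^sub>R q + prim (\<lambda>t. 0 + \<sigma> *\<^sub>R V s t) t"
        have qp: "q + prim (V s) t = (s * R) *\<^sub>R cis (2 * pi * t)"
          unfolding primV[OF t] by (simp add: q_def scaleR_conv_of_real algebra_simps)
        have z: "z = z\<^sub>0 + (\<sigma> * (s * R)) *\<^sub>R cis (2 * pi * t)"
        proof -
          have "z = z\<^sub>0 + \<sigma> *\<^sub>R (q + prim (V s) t)" by (simp add: z_def scaleR_add_right)
          then show ?thesis by (simp add: qp)
        qed
        have "\<sigma> * (s * R) \<le> 1 * (1 * R)" using \<sigma> s R by (intro mult_mono) auto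
        then have "z \<in> cball z\<^sub>0 R" using \<sigma> s R by (simp add: z dist_norm norm_mult)
        then have "b \<le> K z" using x(2) by (simp add: b_def)
        moreover have wq: "wedge (q + prim (V s) t) (0 + \<sigma> *\<^sub>R V s t) = \<sigma> * (2 * pi * (s * R)\<^sup>2)"
        proof -
          have "wedge (cis (2 * pi * t)) (2 * pi * \<i> * cis (2 * pi * t)) = 2 * pi"
          proof -
            have "wedge (cis x) (2 * pi * \<i> * cis x) = 2 * pi * (cos x * cos x) + 2 * pi * (sin x * sin x)" for x
              by (simp add: wedge_def algebra_simps)
            then show ?thesis by (simp only: distrib_left[symmetric] sin_cos_squared_add3 mult_1_right)
          qed
          then show ?thesis unfolding qp by (simp add: V_def power2_eq_square)
        qed
        moreover have "0 \<le> \<sigma> * (2 * pi * (s * R)\<^sup>2)" using \<sigma> by simp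
        ultimately have "b * (\<sigma> * (2 * pi * (s * R)\<^sup>2)) \<le> K z * (\<sigma> * (2 * pi * (s * R)\<^sup>2))"
          by (intro mult_right_mono)
        then show "\<sigma> * (2 * pi * b * (s * R)\<^sup>2) \<le>
            K (z\<^sub>0 + \<sigma> *\<^sub>R q + prim (\<lambda>t. 0 + \<sigma> *\<^sub>R V s t) t) * wedge (q + prim (V s) t) (0 + \<sigma> *\<^sub>R V s t)"
          unfolding z_def[symmetric] wq by (simp only: mult_ac)
      qed (intro continuous_intros)
      then show "\<sigma> * (2 * pi * b * (s * R)\<^sup>2) \<le> darea K (z\<^sub>0 + \<sigma> *\<^sub>R q) (\<lambda>t. 0 + \<sigma> *\<^sub>R V s t) q (V s)"
        by simp
    qed (intro continuous_intros)
    then show ?thesis using s lenV[of s] by (simp add: action_def integral_ident_unit mult_ac)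
  qed
  show ?thesis
  proof (rule that)
    show "mountain_path K \<Theta> P V"
      unfolding mountain_path_def
    proof (intro conjI ballI)
      show "continuous_on {0..1} P" unfolding P_def by (intro continuous_intros)
      show "continuous_on ({0..1} \<times> {0..1}) (\<lambda>(s, t). V s t)"
        unfolding V_def split_beta by (intro continuous_intros)
      have "action K \<Theta> (P 1) (V 1) \<le> pi * R * (2 * \<Theta> - b * R)"
        using act[of 1 \<Theta>] by (simp add: power2_eq_square algebra_simps)
      also have "\<dots> \<le> 0"
      proof -
        have "2 * \<Theta> = K\<^sub>0 * R" using K0 by (simp add: R_def)
        also have "\<dots> \<le> b * R" using b R by simp
        finally show ?thesis using R by (simp add: mult_nonneg_nonpos)
      qed
      finally show "action K \<Theta> (P 1) (V 1) \<le> 0" .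
    qed (use V0 lenV[of 0] lenV[of 1] R in auto)
    fix s \<theta> :: real assume s: "s \<in> {0..1}"
    have "0 \<le> b * pi * (s * R - \<theta> / b)\<^sup>2" using b by simp
    also have "b * pi * (s * R - \<theta> / b)\<^sup>2 = pi * \<theta>\<^sup>2 / b - (2 * pi * \<theta> * (s * R) - b * pi * (s * R)\<^sup>2)"
      using b by (simp add: power2_eq_square field_simps)
    finally show "action K \<theta> (P s) (V s) \<le> pi * \<theta>\<^sup>2 / b" using act[OF s, of \<theta>] by simp
  qed (rule b)
qed

section \<open>Difference quotients of monotone functions\<close>

text \<open>By translation invariance the integral of \<open>g (x + h) - g x\<close> telescopes to integrals over two end intervals of
length \<open>h\<close>. The constant \<open>g a\<close> is subtracted first to stay in the nonnegative reals.\<close>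

lemma nn_integral_increment_le:
  fixes g :: "real \<Rightarrow> real"
  assumes g: "mono g" and ab: "a \<le> b" and h: "0 < h" "h \<le> 1"
  shows "(\<integral>\<^sup>+x. ennreal (g (x + h) - g x) * indicator {a..b} x \<partial>lborel) \<le> ennreal (h * (g (b + 1) - g a))"
proof -
  have [measurable]: "g \<in> borel_measurable borel" by (rule borel_measurable_mono[OF g])
  define G where "G = (\<lambda>x. ennreal (g x - g a))"
  have [measurable]: "G \<in> borel_measurable borel" unfolding G_def by measurable
  define c where "c = g (b + 1) - g a"
  have c: "0 \<le> c" using monoD[OF g, of a "b + 1"] ab by (simp add: c_def)
  let ?I = "\<integral>\<^sup>+x. G x * indicator {a..b} x \<partial>lborel"
  have "(\<integral>\<^sup>+x. ennreal (g (x + h) - g x) * indicator {a..b} x \<partial>lborel) + ?I =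
      (\<integral>\<^sup>+x. ennreal (g (x + h) - g x) * indicator {a..b} x + G x * indicator {a..b} x \<partial>lborel)"
    by (rule nn_integral_add[symmetric]) measurable
  also have "\<dots> = (\<integral>\<^sup>+x. G (h + 1 * x) * indicator {a..b} ((h + 1 * x) - h) \<partial>lborel)"
  proof (rule nn_integral_cong)
    fix x
    have "ennreal (g (x + h) - g x) + G x = G (h + 1 * x)" if "a \<le> x"
      using monoD[OF g that] monoD[OF g, of x "x + h"] h
      by (simp add: G_def add.commute flip: ennreal_plus)
    then show "ennreal (g (x + h) - g x) * indicator {a..b} x + G x * indicator {a..b} x
        = G (h + 1 * x) * indicator {a..b} ((h + 1 * x) - h)"
      by (auto simp: indicator_def)
  qed
  also have "\<dots> = (\<integral>\<^sup>+x. G x * indicator {a..b} (x - h) \<partial>lborel)"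
    by (subst nn_integral_real_affine[of "\<lambda>x. G x * indicator {a..b} (x - h)" 1 h]) auto
  also have "\<dots> \<le> (\<integral>\<^sup>+x. G x * indicator {a..b} x + ennreal c * indicator {b..b+h} x \<partial>lborel)"
  proof (rule nn_integral_mono)
    fix x
    have "G x \<le> ennreal c" if "x \<le> b + h"
      unfolding G_def c_def using monoD[OF g, of x "b + 1"] that h by (intro ennreal_leI) simp
    then show "G x * indicator {a..b} (x - h) \<le> G x * indicator {a..b} x + ennreal c * indicator {b..b+h} x"
      using h by (auto simp: indicator_def)
  qed
  also have "\<dots> = ?I + ennreal (h * c)"
    using h c by (subst nn_integral_add) (auto simp: nn_integral_cmult_indicator ennreal_mult mult.commute)
  finally have *: "(\<integral>\<^sup>+x. ennreal (g (x + h) - g x) * indicator {a..b} x \<partial>lborel) + ?I \<le> ennreal (h * c) + ?I"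
    by (simp add: add.commute)
  have "?I \<le> (\<integral>\<^sup>+x. ennreal c * indicator {a..b} x \<partial>lborel)"
  proof (rule nn_integral_mono)
    fix x show "G x * indicator {a..b} x \<le> ennreal c * indicator {a..b} x"
      unfolding G_def c_def using monoD[OF g, of x "b + 1"]
      by (auto simp: indicator_def intro!: ennreal_leI)
  qed
  also have "\<dots> = ennreal (c * (b - a))"
    using ab c by (simp add: nn_integral_cmult_indicator ennreal_mult)
  finally have "?I \<noteq> \<infinity>" by (auto simp: top_unique)
  with * show ?thesis by (simp add: c_def)
qed

text \<open>A weak form of Lebesgue's theorem on the differentiability of monotone functions. The integrals of the difference
quotients over a bounded interval are bounded, so Fatou's lemma makes their lower limit finite almost everywhere.\<close>

theorem mono_AE_bounded_difference_quotients:
  fixes g :: "real \<Rightarrow> real"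
  assumes g: "mono g"
  shows "AE x in lborel. \<exists>D. \<exists>\<^sub>F n in sequentially. g (x + 1 / Suc n) - g x \<le> D * (1 / Suc n)"
proof -
  have [measurable]: "g \<in> borel_measurable borel" by (rule borel_measurable_mono[OF g])
  define f where "f = (\<lambda>n x. ennreal (Suc n) * ennreal (g (x + 1 / Suc n) - g x))"
  have [measurable]: "f n \<in> borel_measurable borel" for n unfolding f_def by measurable
  have "AE x in lborel. x \<in> {- real N..real N} \<longrightarrow> liminf (\<lambda>n. f n x) \<noteq> \<infinity>" for N :: nat
  proof -
    define c where "c = g (real N + 1) - g (- real N)"
    have bound: "(\<integral>\<^sup>+x. f n x * indicator {- real N..real N} x \<partial>lborel) \<le> ennreal c" for n
    proof -
      have "(\<integral>\<^sup>+x. f n x * indicator {- real N..real N} x \<partial>lborel) =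
         ennreal (Suc n) * (\<integral>\<^sup>+x. ennreal (g (x + 1 / Suc n) - g x) * indicator {- real N..real N} x \<partial>lborel)"
        unfolding f_def by (subst nn_integral_cmult[symmetric]) (auto simp: mult.assoc)
      also have "\<dots> \<le> ennreal (Suc n) * ennreal (1 / Suc n * c)"
        unfolding c_def by (intro mult_left_mono nn_integral_increment_le g) auto
      also have "\<dots> = ennreal c"
        by (subst ennreal_mult'[symmetric]) (simp_all del: of_nat_Suc)
      finally show ?thesis .
    qed
    have "(\<integral>\<^sup>+x. liminf (\<lambda>n. f n x * indicator {- real N..real N} x) \<partial>lborel)
       \<le> liminf (\<lambda>n. \<integral>\<^sup>+x. f n x * indicator {- real N..real N} x \<partial>lborel)"
      by (rule nn_integral_liminf) measurable
    also have "\<dots> \<le> ennreal c"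
      by (rule order_trans[OF Liminf_le_Limsup Limsup_bounded]) (use bound in auto)
    finally have "(\<integral>\<^sup>+x. liminf (\<lambda>n. f n x * indicator {- real N..real N} x) \<partial>lborel) \<noteq> \<infinity>"
      by (auto simp: top_unique)
    then have "AE x in lborel. liminf (\<lambda>n. f n x * indicator {- real N..real N} x) \<noteq> \<infinity>"
      by (intro nn_integral_noteq_infinite) measurable
    then show ?thesis by eventually_elim auto
  qed
  then have "AE x in lborel. \<forall>N::nat. x \<in> {- real N..real N} \<longrightarrow> liminf (\<lambda>n. f n x) \<noteq> \<infinity>"
    by (subst AE_all_countable) simp
  then show ?thesis
  proof eventually_elim
    case (elim x)
    obtain N :: nat where "\<bar>x\<bar> \<le> real N" using real_arch_simple by blast
    then have "liminf (\<lambda>n. f n x) \<noteq> \<infinity>" using elim by (auto simp: abs_le_iff)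
    then obtain l where l: "0 \<le> l" "liminf (\<lambda>n. f n x) = ennreal l"
      by (cases "liminf (\<lambda>n. f n x)") auto
    define D where "D = l + 1"
    have D: "0 \<le> D" "liminf (\<lambda>n. f n x) < ennreal D"
      using l by (auto simp: D_def intro: ennreal_lessI)
    have "\<exists>\<^sub>F n in sequentially. f n x < ennreal D"
    proof (rule ccontr)
      assume "\<not> ?thesis"
      then have "\<forall>\<^sub>F n in sequentially. ennreal D \<le> f n x"
        by (simp add: not_frequently not_less)
      then have "ennreal D \<le> liminf (\<lambda>n. f n x)" by (rule Liminf_bounded)
      then show False using D(2) by simp
    qed
    then have "\<exists>\<^sub>F n in sequentially. g (x + 1 / Suc n) - g x \<le> D * (1 / Suc n)"
    proof (rule frequently_elim1)
      fix n assume "f n x < ennreal D"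
      then have "ennreal (Suc n * (g (x + 1 / Suc n) - g x)) < ennreal D"
        by (simp add: f_def ennreal_mult' del: of_nat_Suc)
      then have "Suc n * (g (x + 1 / Suc n) - g x) \<le> D" using D(1)
        by (metis ennreal_leI linorder_not_le linear)
      then show "g (x + 1 / Suc n) - g x \<le> D * (1 / Suc n)"
        by (simp add: field_simps del: of_nat_Suc)
    qed
    then show ?case by blast
  qed
qed

section \<open>Compactness of almost critical loops\<close>

text \<open>Equicontinuity of curves of bounded Dirichlet integral, with Young's inequality \<open>\<bar>v\<bar> \<le> \<eta> \<bar>v\<bar>\<^sup>2 / 2 + 1 / (2 \<eta>)\<close> in place of
the usual square root modulus.\<close>

lemma norm_prim_diff_le:
  assumes v: "continuous_on {0..1} v" and M: "len v \<le> M" and \<eta>: "0 < \<eta>"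
    and st: "s \<in> {0..1}" "t \<in> {0..1}"
  shows "norm (prim v t - prim v s) \<le> \<eta> * M\<^sup>2 / 2 + \<bar>t - s\<bar> / (2 * \<eta>)"
proof -
  have *: "norm (prim v t - prim v s) \<le> \<eta> * M\<^sup>2 / 2 + (t - s) / (2 * \<eta>)"
    if st: "0 \<le> s" "s \<le> t" "t \<le> 1" for s t
  proof -
    have sub: "continuous_on {s..t} v" using v by (rule continuous_on_subset) (use st in auto)
    have sq: "(\<lambda>x. \<eta> / 2 * (norm (v x))\<^sup>2) integrable_on {s..t}"
      by (intro integrable_continuous_real continuous_intros sub)
    have "prim v s + integral {s..t} v = prim v t"
      unfolding prim_def using Henstock_Kurzweil_Integration.integral_combine[of 0 s t v] st integrable_sub[OF v] by auto
    then have "norm (prim v t - prim v s) = norm (integral {s..t} v)" by (metis add_diff_cancel_left')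
    also have "\<dots> \<le> integral {s..t} (\<lambda>x. \<eta> / 2 * (norm (v x))\<^sup>2 + 1 / (2 * \<eta>))"
    proof (rule integral_norm_bound_integral)
      fix x
      have "0 \<le> (\<eta> * norm (v x) - 1)\<^sup>2 / (2 * \<eta>)" using \<eta> by simp
      also have "\<dots> = \<eta> / 2 * (norm (v x))\<^sup>2 + 1 / (2 * \<eta>) - norm (v x)"
        using \<eta> by (simp add: power2_eq_square field_simps)
      finally show "norm (v x) \<le> \<eta> / 2 * (norm (v x))\<^sup>2 + 1 / (2 * \<eta>)" by simp
    qed (intro integrable_continuous_real continuous_intros sub)+
    also have "\<dots> = integral {s..t} (\<lambda>x. \<eta> / 2 * (norm (v x))\<^sup>2) + (t - s) / (2 * \<eta>)"
      using st by (subst integral_add[OF sq integrable_const_ivl]) simp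
    also have "integral {s..t} (\<lambda>x. \<eta> / 2 * (norm (v x))\<^sup>2) \<le> integral {0..1} (\<lambda>x. \<eta> / 2 * (norm (v x))\<^sup>2)"
      using st \<eta> by (intro integral_subset_le sq integrable_unit continuous_intros v) auto
    also have "\<dots> = \<eta> * (len v)\<^sup>2 / 2" by (simp add: len_square[OF v])
    also have "\<dots> \<le> \<eta> * M\<^sup>2 / 2"
      using \<eta> M len_nonneg[OF v] by (intro divide_right_mono mult_left_mono power_mono) auto
    finally show ?thesis by simp
  qed
  show ?thesis
    using *[of s t] *[of t s] st by (cases "s \<le> t") (auto simp: norm_minus_commute abs_if)
qed

lemma tendsto_zero_from_bound:
  fixes x :: "nat \<Rightarrow> real"
  assumes "\<And>n. 0 \<le> x n" "0 \<le> C" "\<And>e. 0 < e \<Longrightarrow> e \<le> 1 \<Longrightarrow> \<forall>\<^sub>F n in sequentially. x n \<le> C * e"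
  shows "x \<longlonglongrightarrow> 0"
proof (rule LIMSEQ_I)
  fix r :: real assume r: "0 < r"
  define e where "e = min 1 (r / (C + 1))"
  have "r / (C + 1) * C < r" using r assms(2) by (simp add: field_simps)
  moreover have "C * e \<le> C * (r / (C + 1))" unfolding e_def using assms(2) by (intro mult_left_mono) auto
  ultimately have "C * e < r" by (simp add: mult.commute)
  moreover have "0 < e" "e \<le> 1" using r assms(2) by (auto simp: e_def)
  ultimately have "\<forall>\<^sub>F n in sequentially. x n < r"
    using assms(3)[of e] by (auto elim: eventually_mono)
  then show "\<exists>no. \<forall>n\<ge>no. norm (x n - 0) < r"
    using assms(1) by (auto simp: eventually_sequentially)
qed

text \<open>Differentiating the relation \<open>\<theta> u' / L = force + const\<close> gives the differential equation for the velocity \<open>a = u'\<close>; the vanishing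
of the force at time 1 gives \<open>a 1 = a 0\<close>, so the periodic extension has a continuous second derivative.\<close>

definition critical_loop :: "(complex \<Rightarrow> real) \<Rightarrow> real \<Rightarrow> complex \<Rightarrow> (real \<Rightarrow> complex) \<Rightarrow> real \<Rightarrow> bool" where
  "critical_loop K \<theta> p a L \<longleftrightarrow> 0 < L \<and> continuous_on {0..1} a \<and> prim a 1 = 0 \<and> a 1 = a 0 \<and>
     (\<forall>t\<in>{0..1}. norm (a t) = L \<and>
       (a has_vector_derivative (L / \<theta> * K (p + prim a t)) *\<^sub>R (\<i> * a t)) (at t within {0..1}))"

text \<open>The curves and their forces are equicontinuous, so along a subsequence both converge uniformly. Since the gradients
tend to zero, the velocities are asymptotically the lengths times the mean-free forces divided by \<open>\<theta>\<close>, hence they converge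
in the mean square as well. This strong convergence identifies the limit of the forces as the force of the limit curve, which is
the differential equation, and it passes to the limit in the action. The weights vary with \<open>n\<close> so that the
loops can be translated to start at 0.\<close>

theorem almost_critical_loops_converge:
  fixes K :: "nat \<Rightarrow> complex \<Rightarrow> real" and v :: "nat \<Rightarrow> real \<Rightarrow> complex"
  assumes K: "\<And>n. continuous_on UNIV (K n)" "\<And>n z. \<bar>K n z\<bar> \<le> k" and k: "0 < k"
    and F: "continuous_on UNIV F"
    and KF: "\<And>R e. 0 < e \<Longrightarrow> \<forall>\<^sub>F n in sequentially. \<forall>z\<in>cball 0 R. \<bar>K n z - F z\<bar> \<le> e"
    and v: "\<And>n. continuous_on {0..1} (v n)" "\<And>n. integral {0..1} (v n) = 0"
    and len: "0 < m" "\<And>n. m \<le> len (v n)" "\<And>n. len (v n) \<le> M"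
    and \<theta>: "0 < \<theta>" and slope: "(\<lambda>n. slope (K n) \<theta> 0 (v n)) \<longlonglongrightarrow> 0"
  obtains r :: "nat \<Rightarrow> nat" and a L where "strict_mono r" "critical_loop F \<theta> 0 a L"
    "(\<lambda>n. action (K (r n)) \<theta> 0 (v (r n))) \<longlonglongrightarrow> action F \<theta> 0 a"
proof -
  define y where "y = (\<lambda>n. prim (v n))"
  define W where "W = (\<lambda>n. force (K n) 0 (v n))"
  have M: "0 < M" using len(1) len(2,3)[of 0] by linarith
  have Fk: "\<bar>F z\<bar> \<le> k" for z
  proof (rule field_le_epsilon)
    fix e :: real assume "0 < e"
    from eventually_happens'[OF sequentially_bot KF[OF this, of "norm z"]]
    obtain n where "\<forall>x\<in>cball 0 (norm z). \<bar>K n x - F x\<bar> \<le> e" by blast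
    then have "\<bar>K n z - F z\<bar> \<le> e" by simp
    then show "\<bar>F z\<bar> \<le> k + e" using K(2)[of n z] by linarith
  qed
  have yc: "continuous_on {0..1} (y n)" for n unfolding y_def by (intro prim_cont v)
  have Wc: "continuous_on {0..1} (W n)" for n unfolding W_def by (intro force_cont K v)
  have yM: "norm (y n t) \<le> M" if "t \<in> {0..1}" for n t
    using norm_prim_le[OF v(1) that, of n] len(3)[of n] by (simp add: y_def)
  have kM: "k * len (v n) \<le> k * M" for n using len(3)[of n] k by simp
  have WM: "norm (W n t) \<le> k * M" if "t \<in> {0..1}" for n t
    using norm_force_le[OF K(1) v(1) K(2) that, of n 0 n] kM[of n] by (simp add: W_def)
  define B where "B = M + k * M"
  have B: "0 < B" "M \<le> B" "k * M \<le> B" using M mult_pos_pos[OF k M] by (simp_all add: B_def)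
  define w where "w = (\<lambda>n t. K n (y n t) *\<^sub>R (\<i> * v n t))"
  have W_w: "W n = prim (w n)" for n by (simp add: W_def force_def w_def y_def)
  have wc: "continuous_on {0..1} (w n)" for n
    unfolding w_def by (intro continuous_intros cont_comp[OF K(1)] yc v)
  have w_len: "len (w n) \<le> k * M" for n
    unfolding w_def by (rule order_trans[OF len_scaled_le kM]) (intro v cont_comp[OF K(1)] yc K)+
  have modulus: "norm ((y n t, W n t) - (y n s, W n s)) \<le> \<eta> * B\<^sup>2 + \<bar>t - s\<bar> / \<eta>"
    if "s \<in> {0..1}" "t \<in> {0..1}" "0 < \<eta>" for n s t \<eta>
  proof -
    have "norm (y n t - y n s) \<le> \<eta> * B\<^sup>2 / 2 + \<bar>t - s\<bar> / (2 * \<eta>)"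
      unfolding y_def by (rule norm_prim_diff_le) (use v that len(3)[of n] B in auto)
    moreover have "norm (W n t - W n s) \<le> \<eta> * B\<^sup>2 / 2 + \<bar>t - s\<bar> / (2 * \<eta>)"
      unfolding W_w by (rule norm_prim_diff_le) (use wc w_len[of n] that B in auto)
    moreover have "\<eta> * B\<^sup>2 / 2 + \<bar>t - s\<bar> / (2 * \<eta>) = (\<eta> * B\<^sup>2 + \<bar>t - s\<bar> / \<eta>) / 2"
      by (simp add: add_divide_distrib)
    ultimately show ?thesis
      using norm_Pair_le[of "y n t - y n s" "W n t - W n s"] by simp
  qed
  obtain g r\<^sub>1 where g: "continuous_on {0..1} g" "strict_mono (r\<^sub>1 :: nat \<Rightarrow> nat)"
    and conv: "\<And>e. 0 < e \<Longrightarrow> \<exists>N. \<forall>n t. N \<le> n \<and> t \<in> {0..1} \<longrightarrow> norm ((y (r\<^sub>1 n) t, W (r\<^sub>1 n) t) - g t) < e"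
  proof (rule Arzela_Ascoli[of "{0..1::real}" "\<lambda>n t. (y n t, W n t)" B])
    fix n and t :: real assume t: "t \<in> {0..1}"
    show "norm (y n t, W n t) \<le> B"
      using norm_Pair_le[of "y n t" "W n t"] yM[OF t, of n] WM[OF t, of n] by (simp add: B_def)
  next
    fix t e :: real assume t: "t \<in> {0..1}" and e: "0 < e"
    define c where "c = B\<^sup>2 + 1"
    have c: "0 < c" unfolding c_def by (intro add_nonneg_pos) auto
    define \<eta> where "\<eta> = e / (2 * c)"
    have \<eta>: "0 < \<eta>" unfolding \<eta>_def using e c by simp
    have "\<eta> * c = e / 2" using c by (simp add: \<eta>_def)
    then have "\<eta> * B\<^sup>2 < e / 2" using \<eta> by (simp add: c_def distrib_left)
    moreover have "\<bar>t - s\<bar> / \<eta> < e / 2" if "\<bar>s - t\<bar> < \<eta> * (e / 2)" for s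
      using that \<eta> by (simp add: field_simps abs_minus_commute)
    ultimately have "norm ((y n t, W n t) - (y n s, W n s)) < e" if "s \<in> {0..1}" "\<bar>s - t\<bar> < \<eta> * (e / 2)" for n s
      using modulus[OF that(1) t \<eta>, of n] that(2) by (smt (verit, best) field_sum_of_halves)
    then show "\<exists>d>0. \<forall>n s. s \<in> {0..1} \<and> norm (t - s) < d \<longrightarrow> norm ((y n t, W n t) - (y n s, W n s)) < e"
      using \<eta> e by (intro exI[of _ "\<eta> * (e / 2)"]) (auto simp: abs_minus_commute)
  qed (auto intro: that)
  have "\<forall>n. len (v (r\<^sub>1 n)) \<in> {m..M}" using len by auto
  with compact_Icc[of m M, unfolded compact_eq_seq_compact_metric seq_compact_def]
  obtain L r\<^sub>2 where L: "L \<in> {m..M}" and r2: "strict_mono (r\<^sub>2 :: nat \<Rightarrow> nat)"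
    and Llim: "((\<lambda>n. len (v (r\<^sub>1 n))) \<circ> r\<^sub>2) \<longlonglongrightarrow> L"
    by (metis (no_types, lifting))
  define r where "r = r\<^sub>1 \<circ> r\<^sub>2"
  have r: "strict_mono r" unfolding r_def by (rule strict_mono_o[OF g(2) r2])
  define yy where "yy = (\<lambda>t. fst (g t))"
  define WW where "WW = (\<lambda>t. snd (g t))"
  have yyc: "continuous_on {0..1} yy" and WWc: "continuous_on {0..1} WW"
    unfolding yy_def WW_def by (intro continuous_intros g)+
  have unif: "\<forall>\<^sub>F n in sequentially. \<forall>t\<in>{0..1}. norm (y (r n) t - yy t) \<le> e \<and> norm (W (r n) t - WW t) \<le> e"
    if "0 < e" for e
  proof -
    obtain N where N: "\<forall>n t. N \<le> n \<and> t \<in> {0..1} \<longrightarrow> norm ((y (r\<^sub>1 n) t, W (r\<^sub>1 n) t) - g t) < e"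
      using conv[OF \<open>0 < e\<close>] by blast
    show ?thesis
      unfolding eventually_sequentially
    proof (intro exI[of _ N] allI impI ballI)
      fix n and t :: real assume n: "N \<le> n" and t: "t \<in> {0..1}"
      have "N \<le> r\<^sub>2 n" using n seq_suble[OF r2, of n] by simp
      then have "norm ((y (r n) t, W (r n) t) - g t) < e" using N t by (simp add: r_def)
      then show "norm (y (r n) t - yy t) \<le> e \<and> norm (W (r n) t - WW t) \<le> e"
        using norm_fst_le[of "y (r n) t - yy t" "W (r n) t - WW t"] norm_snd_le[of "W (r n) t - WW t" "y (r n) t - yy t"]
        by (cases "g t") (auto simp: yy_def WW_def)
    qed
  qed
  have pointwise: "(\<lambda>n. y (r n) t) \<longlonglongrightarrow> yy t" "(\<lambda>n. W (r n) t) \<longlonglongrightarrow> WW t" if t: "t \<in> {0..1}" for t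
    using unif[of "e / 2" for e] t unfolding LIMSEQ_def dist_norm eventually_sequentially
    by (force intro: le_less_trans[of _ "e / 2" e for e])+
  have Llim: "(\<lambda>n. len (v (r n))) \<longlonglongrightarrow> L" using Llim by (simp add: r_def o_def)
  have rinf: "filterlim r sequentially sequentially" by (rule filterlim_subseq[OF r])
  have slope_r: "(\<lambda>n. slope (K (r n)) \<theta> 0 (v (r n))) \<longlonglongrightarrow> 0" by (rule filterlim_compose[OF slope rinf])
  have slope0: "0 \<le> slope (K n) \<theta> 0 (v n)" for n by (simp add: slope_def)
  have grad_small: "\<forall>\<^sub>F n in sequentially. len (grad (K (r n)) \<theta> 0 (v (r n))) \<le> e \<and> norm (W (r n) 1) \<le> e"
    if e: "0 < e" for e
  proof -
    have "\<forall>\<^sub>F n in sequentially. slope (K (r n)) \<theta> 0 (v (r n)) < e\<^sup>2"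
      by (rule order_tendstoD[OF slope_r]) (use e in simp)
    then show ?thesis
    proof eventually_elim
      case (elim n)
      then have "(len (grad (K (r n)) \<theta> 0 (v (r n))))\<^sup>2 \<le> e\<^sup>2" "(norm (W (r n) 1))\<^sup>2 \<le> e\<^sup>2"
        unfolding slope_def W_def by (smt (verit) zero_le_power2)+
      then show ?case using e by (auto intro: power2_le_imp_le)
    qed
  qed
  define A where "A = (\<lambda>t. WW t - integral {0..1} WW)"
  define a where "a = (\<lambda>t. (L / \<theta>) *\<^sub>R A t)"
  have Ac: "continuous_on {0..1} A" unfolding A_def by (intro continuous_intros WWc)
  have ac: "continuous_on {0..1} a" unfolding a_def by (intro continuous_intros Ac)
  obtain C where C: "0 < C" "\<And>t. t \<in> {0..1} \<Longrightarrow> norm (A t) \<le> C" "\<And>t. t \<in> {0..1} \<Longrightarrow> norm (a t) \<le> C"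
  proof -
    have "bounded (A ` {0..1})" "bounded (a ` {0..1})"
      by (intro compact_imp_bounded compact_continuous_image Ac ac compact_Icc)+
    then obtain C1 C2 where C12: "\<And>t. t \<in> {0..1} \<Longrightarrow> norm (A t) \<le> C1" "\<And>t. t \<in> {0..1} \<Longrightarrow> norm (a t) \<le> C2"
      unfolding bounded_iff by blast
    show ?thesis
      by (rule that[of "max 1 (max C1 C2)"]) (simp_all add: le_max_iff_disj C12)
  qed
  \<comment> \<open>The mean square distance of the velocities from the candidate limit \<open>a\<close>.\<close>
  define \<rho> where "\<rho> = (\<lambda>n. len (\<lambda>t. v (r n) t - a t))"
  have dc: "continuous_on {0..1} (\<lambda>t. v (r n) t - a t)" for n by (intro continuous_intros v ac)
  have \<rho>0: "0 \<le> \<rho> n" for n unfolding \<rho>_def by (rule len_nonneg[OF dc])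
  have \<rho>: "\<rho> \<longlonglongrightarrow> 0"
  proof (rule tendsto_zero_from_bound[OF \<rho>0])
    show "0 \<le> M / \<theta> * 3 + C / \<theta>" using M \<theta> C by simp
    fix e :: real assume e: "0 < e"
    have "\<forall>\<^sub>F n in sequentially. \<bar>len (v (r n)) - L\<bar> < e"
      using tendstoD[OF Llim e] by (simp add: dist_real_def)
    with unif[OF e] grad_small[OF e]
    show "\<forall>\<^sub>F n in sequentially. \<rho> n \<le> (M / \<theta> * 3 + C / \<theta>) * e"
    proof eventually_elim
      case (elim n)
      define Ln where "Ln = len (v (r n))"
      have Ln: "0 < Ln" "Ln \<le> M" using len(1) len(2,3)[of "r n"] by (auto simp: Ln_def)
      define An where "An = (\<lambda>t. W (r n) t - integral {0..1} (W (r n)))"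
      have Anc: "continuous_on {0..1} An" unfolding An_def by (intro continuous_intros Wc)
      define G where "G = grad (K (r n)) \<theta> 0 (v (r n))"
      have Gc: "continuous_on {0..1} G" unfolding G_def by (intro grad_cont K v)
      \<comment> \<open>The gradient relation is solved for the velocity.\<close>
      have "v (r n) t - a t = (Ln / \<theta>) *\<^sub>R G t + ((Ln / \<theta>) *\<^sub>R An t - a t)" for t
      proof -
        have "G t = (\<theta> / Ln) *\<^sub>R v (r n) t - An t" by (simp add: G_def grad_def An_def W_def Ln_def)
        then have "(Ln / \<theta>) *\<^sub>R G t = v (r n) t - (Ln / \<theta>) *\<^sub>R An t"
          using Ln \<theta> by (simp add: scaleR_diff_right)
        then show ?thesis by simp
      qed
      then have "\<rho> n \<le> len (\<lambda>t. (Ln / \<theta>) *\<^sub>R G t) + len (\<lambda>t. (Ln / \<theta>) *\<^sub>R An t - a t)"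
        unfolding \<rho>_def by (simp only:) (intro len_triangle continuous_intros Gc Anc ac)
      also have "len (\<lambda>t. (Ln / \<theta>) *\<^sub>R G t) \<le> M / \<theta> * e"
        unfolding len_scaleR using Ln \<theta> elim(2) len_nonneg[OF Gc]
        by (intro mult_mono) (auto simp: G_def divide_right_mono)
      also have "len (\<lambda>t. (Ln / \<theta>) *\<^sub>R An t - a t) \<le> M / \<theta> * (2 * e) + e * C / \<theta>"
      proof (rule len_le_const)
        show "continuous_on {0..1} (\<lambda>t. (Ln / \<theta>) *\<^sub>R An t - a t)" by (intro continuous_intros Anc ac)
        fix t :: real assume t: "t \<in> {0..1}"
        have "integral {0..1} (W (r n)) - integral {0..1} WW = integral {0..1} (\<lambda>t. W (r n) t - WW t)"
          by (simp add: integral_diff integrable_unit Wc WWc)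
        also have "norm \<dots> \<le> e"
          by (rule norm_integral_unit_le_const) (use elim(1) in \<open>auto intro!: continuous_intros Wc WWc\<close>)
        finally have 1: "norm (integral {0..1} (W (r n)) - integral {0..1} WW) \<le> e" .
        have "norm (An t - A t) \<le> 2 * e"
        proof -
          have "An t - A t = (W (r n) t - WW t) - (integral {0..1} (W (r n)) - integral {0..1} WW)"
            by (simp add: An_def A_def)
          then show ?thesis
            using norm_triangle_ineq4[of "W (r n) t - WW t" "integral {0..1} (W (r n)) - integral {0..1} WW"] 1 elim(1) t
            by force
        qed
        then have 2: "norm ((Ln / \<theta>) *\<^sub>R (An t - A t)) \<le> M / \<theta> * (2 * e)"
          unfolding norm_scaleR using Ln \<theta> by (intro mult_mono) (auto simp: divide_right_mono)
        have 3: "norm (((Ln - L) / \<theta>) *\<^sub>R A t) \<le> e / \<theta> * C"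
          unfolding norm_scaleR using elim(3) \<theta> C(2)[OF t] e
          by (intro mult_mono) (auto simp: Ln_def divide_right_mono)
        have "(Ln / \<theta>) *\<^sub>R An t - a t = (Ln / \<theta>) *\<^sub>R (An t - A t) + ((Ln - L) / \<theta>) *\<^sub>R A t"
          by (simp add: a_def scaleR_diff_right scaleR_diff_left diff_divide_distrib)
        then show "norm ((Ln / \<theta>) *\<^sub>R An t - a t) \<le> M / \<theta> * (2 * e) + e * C / \<theta>"
          using norm_triangle_ineq[of "(Ln / \<theta>) *\<^sub>R (An t - A t)" "((Ln - L) / \<theta>) *\<^sub>R A t"] 2 3 by simp
      qed
      finally show ?case by (simp add: algebra_simps)
    qed
  qed
  have ylim: "yy t = prim a t" if t: "t \<in> {0..1}" for t
  proof (rule LIMSEQ_unique)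
    show "(\<lambda>n. y (r n) t) \<longlonglongrightarrow> yy t" by (rule pointwise(1)[OF t])
    show "(\<lambda>n. y (r n) t) \<longlonglongrightarrow> prim a t"
    proof (rule LIM_zero_cancel, rule Lim_null_comparison[OF always_eventually \<rho>], rule allI)
      fix n
      have "prim (v (r n)) t = prim (\<lambda>t. (v (r n) t - a t) + a t) t" by simp
      also have "\<dots> = prim (\<lambda>t. v (r n) t - a t) t + prim a t" by (rule prim_add[OF dc ac t])
      finally show "norm (y (r n) t - prim a t) \<le> \<rho> n"
        using norm_prim_le[OF dc t, of n] by (simp add: y_def \<rho>_def)
    qed
  qed
  have yyM: "norm (yy t) \<le> M" if t: "t \<in> {0..1}" for t
    by (rule LIMSEQ_le_const2[OF tendsto_norm[OF pointwise(1)[OF t]]]) (use yM[OF t] in blast)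
  have Kconv: "\<forall>\<^sub>F n in sequentially. \<forall>s\<in>{0..1}. \<forall>t\<in>{0..1}. \<bar>K (r n) (s *\<^sub>R y (r n) t) - F (s *\<^sub>R yy t)\<bar> \<le> e"
    if e: "0 < e" for e
  proof -
    have "uniformly_continuous_on (cball 0 M) F"
      by (rule compact_uniformly_continuous[OF continuous_on_subset[OF F] compact_cball]) simp
    then obtain d where d: "0 < d" "\<And>z z'. z \<in> cball 0 M \<Longrightarrow> z' \<in> cball 0 M \<Longrightarrow> dist z' z < d \<Longrightarrow> dist (F z') (F z) < e / 2"
      unfolding uniformly_continuous_on_def using e by (metis half_gt_zero)
    have "\<forall>\<^sub>F n in sequentially. \<forall>z\<in>cball 0 M. \<bar>K (r n) z - F z\<bar> \<le> e / 2"
      by (rule eventually_compose_filterlim[OF KF rinf]) (use e in simp)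
    moreover have "\<forall>\<^sub>F n in sequentially. \<forall>t\<in>{0..1}. norm (y (r n) t - yy t) \<le> d / 2 \<and> norm (W (r n) t - WW t) \<le> d / 2"
      by (rule unif) (use d in simp)
    ultimately show ?thesis
    proof eventually_elim
      case (elim n)
      show ?case
      proof (intro ballI)
        fix s t :: real assume s: "s \<in> {0..1}" and t: "t \<in> {0..1}"
        have sx: "norm (s *\<^sub>R x) \<le> norm x" for x :: complex
          using s by (simp add: mult_left_le_one_le)
        have in1: "s *\<^sub>R y (r n) t \<in> cball 0 M" "s *\<^sub>R yy t \<in> cball 0 M"
          using order_trans[OF sx yM[OF t]] order_trans[OF sx yyM[OF t]] by simp_all
        have "dist (s *\<^sub>R y (r n) t) (s *\<^sub>R yy t) \<le> norm (y (r n) t - yy t)"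
          using sx[of "y (r n) t - yy t"] by (simp add: dist_norm scaleR_diff_right)
        also have "\<dots> < d" using elim(2) t d(1) by force
        finally have "\<bar>F (s *\<^sub>R y (r n) t) - F (s *\<^sub>R yy t)\<bar> < e / 2"
          using d(2)[OF in1(2,1)] by (simp add: dist_real_def)
        moreover have "\<bar>K (r n) (s *\<^sub>R y (r n) t) - F (s *\<^sub>R y (r n) t)\<bar> \<le> e / 2"
          using elim(1) in1(1) by blast
        ultimately show "\<bar>K (r n) (s *\<^sub>R y (r n) t) - F (s *\<^sub>R yy t)\<bar> \<le> e" by linarith
      qed
    qed
  qed
  define w' where "w' = (\<lambda>t. F (yy t) *\<^sub>R (\<i> * a t))"
  have w'c: "continuous_on {0..1} w'" unfolding w'_def by (intro continuous_intros cont_comp[OF F] yyc ac)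
  have la: "len a \<le> C" by (rule len_le_const[OF ac C(3)])
  have WW: "WW t = prim w' t" if t: "t \<in> {0..1}" for t
  proof (rule LIMSEQ_unique)
    show "(\<lambda>n. W (r n) t) \<longlonglongrightarrow> WW t" by (rule pointwise(2)[OF t])
    have "(\<lambda>n. norm (W (r n) t - prim w' t)) \<longlonglongrightarrow> 0"
    proof (rule tendsto_zero_from_bound)
      show "0 \<le> k + C" using k C by simp
      fix e :: real assume e: "0 < e"
      have "\<forall>\<^sub>F n in sequentially. \<rho> n < e" by (rule order_tendstoD(2)[OF \<rho> e])
      with Kconv[OF e] show "\<forall>\<^sub>F n in sequentially. norm (W (r n) t - prim w' t) \<le> (k + C) * e"
      proof eventually_elim
        case (elim n)
        define f where "f = (\<lambda>t. K (r n) (y (r n) t) *\<^sub>R (\<i> * (v (r n) t - a t)))"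
        define h where "h = (\<lambda>t. (K (r n) (y (r n) t) - F (yy t)) *\<^sub>R (\<i> * a t))"
        have fh: "continuous_on {0..1} f" "continuous_on {0..1} h"
          unfolding f_def h_def by (intro continuous_intros cont_comp[OF K(1)] cont_comp[OF F] yyc yc v ac)+
        have "w (r n) = (\<lambda>t. (f t + h t) + w' t)"
          by (auto simp: w_def f_def h_def w'_def algebra_simps)
        then have "W (r n) t = prim (\<lambda>t. f t + h t) t + prim w' t"
          unfolding W_w by (simp only:) (intro prim_add continuous_intros fh w'c t)
        then have "norm (W (r n) t - prim w' t) \<le> len (\<lambda>t. f t + h t)"
          using norm_prim_le[of "\<lambda>t. f t + h t" t] t fh by (simp add: continuous_on_add)
        also have "\<dots> \<le> len f + len h" by (rule len_triangle[OF fh])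
        also have "len f \<le> k * \<rho> n"
          unfolding f_def \<rho>_def by (intro len_scaled_le dc cont_comp[OF K(1)] yc K)
        also have "len h \<le> e * len a"
          unfolding h_def
        proof (intro len_scaled_le ac)
          show "continuous_on {0..1} (\<lambda>t. K (r n) (y (r n) t) - F (yy t))"
            by (intro continuous_intros cont_comp[OF K(1)] cont_comp[OF F] yyc yc)
          fix t :: real assume "t \<in> {0..1}"
          then show "\<bar>K (r n) (y (r n) t) - F (yy t)\<bar> \<le> e" using elim(1)[rule_format, of 1 t] by simp
        qed
        also have "k * \<rho> n \<le> k * e" using k elim(2) by simp
        also have "e * len a \<le> e * C" using la e by simp
        finally show ?case by (simp add: algebra_simps)
      qed
    qed simp
    then show "(\<lambda>n. W (r n) t) \<longlonglongrightarrow> prim w' t"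
      by (simp add: tendsto_norm_zero_iff LIM_zero_iff)
  qed
  have "(\<lambda>n. norm (W (r n) 1)) \<longlonglongrightarrow> 0"
  proof (rule tendsto_zero_from_bound[of _ 1])
    show "\<forall>\<^sub>F n in sequentially. norm (W (r n) 1) \<le> 1 * e" if "0 < e" for e
      using grad_small[OF that] by (auto elim: eventually_mono)
  qed auto
  then have W1: "WW 1 = 0"
    using LIMSEQ_unique[OF pointwise(2)] by (simp add: tendsto_norm_zero_iff)
  have "y n 1 = 0" for n using v(2) by (simp add: y_def prim_def)
  then have prim1: "prim a 1 = 0"
    using pointwise(1)[of 1] ylim[of 1] by (simp add: LIMSEQ_const_iff)
  have a1: "a 1 = a 0" using W1 WW[of 0] by (simp add: a_def A_def)
  have ode: "(a has_vector_derivative (L / \<theta> * F (prim a t)) *\<^sub>R (\<i> * a t)) (at t within {0..1})"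
    if t: "t \<in> {0..1}" for t
  proof -
    have "((\<lambda>t. (L / \<theta>) *\<^sub>R (prim w' t - integral {0..1} WW)) has_vector_derivative (L / \<theta>) *\<^sub>R w' t) (at t within {0..1})"
      using prim_deriv[OF w'c t] by (auto intro!: derivative_eq_intros)
    then have "(a has_vector_derivative (L / \<theta>) *\<^sub>R w' t) (at t within {0..1})"
      by (rule has_vector_derivative_transform[OF t, rotated]) (simp add: a_def A_def WW)
    then show ?thesis by (simp add: w'_def ylim[OF t])
  qed
  have len_a: "len a = L"
  proof (rule LIMSEQ_unique[OF _ Llim])
    show "(\<lambda>n. len (v (r n))) \<longlonglongrightarrow> len a"
    proof (rule LIM_zero_cancel, rule Lim_null_comparison[OF always_eventually \<rho>], rule allI)
      fix n
      have "len (v (r n)) \<le> \<rho> n + len a"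
        using len_triangle[OF dc ac, of n] by (simp add: \<rho>_def)
      moreover have "len a \<le> len (\<lambda>t. (-1) *\<^sub>R (v (r n) t - a t)) + len (v (r n))"
        using len_triangle[of "\<lambda>t. (-1) *\<^sub>R (v (r n) t - a t)" "v (r n)"]
        by (simp add: continuous_intros v ac del: scaleR_minus_left)
      then have "len a \<le> \<rho> n + len (v (r n))" unfolding len_scaleR \<rho>_def by simp
      ultimately show "norm (len (v (r n)) - len a) \<le> \<rho> n" by simp
    qed
  qed
  have normc: "norm (a t) = norm (a 0)" if t: "t \<in> {0..1}" for t
  proof -
    have "((\<lambda>t. a t \<bullet> a t) has_derivative (\<lambda>h. 0)) (at t within {0..1})" if "t \<in> {0..1}" for t
    proof -
      have "((\<lambda>t. a t \<bullet> a t) has_vector_derivative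
         (a t \<bullet> ((L / \<theta> * F (prim a t)) *\<^sub>R (\<i> * a t)) + ((L / \<theta> * F (prim a t)) *\<^sub>R (\<i> * a t)) \<bullet> a t)) (at t within {0..1})"
        by (rule bounded_bilinear.has_vector_derivative[OF bounded_bilinear_inner ode[OF that] ode[OF that]])
      moreover have "a t \<bullet> (\<i> * a t) = 0" "(\<i> * a t) \<bullet> a t = 0" by (auto simp: inner_complex_def)
      ultimately show ?thesis by (simp add: has_vector_derivative_def)
    qed
    from has_derivative_zero_constant[OF convex_real_interval(5) this]
    obtain c where "\<And>t. t \<in> {0..1} \<Longrightarrow> a t \<bullet> a t = c" by blast
    then have "a t \<bullet> a t = a 0 \<bullet> a 0" using t by simp
    then show ?thesis by (simp add: norm_eq_sqrt_inner)
  qed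
  have na: "norm (a t) = L" if t: "t \<in> {0..1}" for t
  proof -
    have "len a = sqrt (integral {0..1} (\<lambda>t::real. (norm (a 0))\<^sup>2))"
      unfolding len_def by (intro arg_cong[of _ _ sqrt] integral_cong) (rule arg_cong[OF normc])
    then show ?thesis using normc[OF t] len_a by simp
  qed
  have area_lim: "(\<lambda>n. area (K (r n)) 0 (v (r n))) \<longlonglongrightarrow> area F 0 a"
  proof -
    have "(\<lambda>n. norm (area (K (r n)) 0 (v (r n)) - area F 0 a)) \<longlonglongrightarrow> 0"
    proof (rule tendsto_zero_from_bound)
      show "0 \<le> M * M + k * (M + M)" using k M by simp
      fix e :: real assume e: "0 < e"
      have "\<forall>\<^sub>F n in sequentially. \<rho> n < e" by (rule order_tendstoD(2)[OF \<rho> e])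
      with Kconv[OF e] unif[OF e]
      show "\<forall>\<^sub>F n in sequentially. norm (area (K (r n)) 0 (v (r n)) - area F 0 a) \<le> (M * M + k * (M + M)) * e"
      proof eventually_elim
        case (elim n)
        define u where "u = v (r n)"
        have uc: "continuous_on {0..1} u" unfolding u_def by (rule v)
        have uM: "len u \<le> M" unfolding u_def by (rule len)
        have duc: "continuous_on {0..1} (\<lambda>t. u t - a t)" unfolding u_def by (rule dc)
        define D where "D = (\<lambda>s. darea (K (r n)) 0 (\<lambda>t. s *\<^sub>R u t) 0 u - darea F 0 (\<lambda>t. s *\<^sub>R a t) 0 a)"
        have bd: "norm (D s) \<le> (M * M + k * (M + M)) * e"
          if s: "s \<in> {0..1}" for s
        proof -
          define f where "f = (\<lambda>t. K (r n) (0 + prim (\<lambda>t. s *\<^sub>R u t) t) * wedge (0 + prim u t) (s *\<^sub>R u t))"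
          define h where "h = (\<lambda>t. F (0 + prim (\<lambda>t. s *\<^sub>R a t) t) * wedge (0 + prim a t) (s *\<^sub>R a t))"
          have fh: "continuous_on {0..1} f" "continuous_on {0..1} h"
            unfolding f_def h_def by (rule darea_cont K F continuous_intros uc ac)+
          have "D s = integral {0..1} (\<lambda>t. f t - h t)"
            using fh by (simp add: D_def darea_def f_def h_def integral_diff integrable_unit)
          also have "norm \<dots> \<le> integral {0..1} (\<lambda>t. (e * M + k * e) * norm (u t) + k * M * norm (u t - a t))"
          proof (rule norm_integral_unit_le)
            fix t :: real assume t: "t \<in> {0..1}"
            define \<kappa> where "\<kappa> = K (r n) (s *\<^sub>R y (r n) t)"
            define \<phi> where "\<phi> = F (s *\<^sub>R yy t)"
            have bounds: "\<bar>\<kappa> - \<phi>\<bar> \<le> e" "\<bar>\<phi>\<bar> \<le> k" "norm (y (r n) t - yy t) \<le> e" "norm (y (r n) t) \<le> M" "norm (yy t) \<le> M"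
              using elim(1,2) s t Fk yM yyM by (auto simp: \<kappa>_def \<phi>_def)
            have "f t = s * (\<kappa> * wedge (y (r n) t) (u t))" "h t = s * (\<phi> * wedge (yy t) (a t))"
              using ylim[OF t] by (simp_all add: f_def h_def \<kappa>_def \<phi>_def y_def u_def)
            then have "f t - h t = s * ((\<kappa> - \<phi>) * wedge (y (r n) t) (u t)
                + \<phi> * (wedge (y (r n) t - yy t) (u t) + wedge (yy t) (u t - a t)))"
              by (simp add: wedge_def algebra_simps)
            also have "norm \<dots> \<le> 1 * (\<bar>(\<kappa> - \<phi>) * wedge (y (r n) t) (u t)\<bar>
                + \<bar>\<phi> * (wedge (y (r n) t - yy t) (u t) + wedge (yy t) (u t - a t))\<bar>)"
              unfolding real_norm_def abs_mult[of s] using s by (intro mult_mono abs_triangle_ineq) auto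
            also have "\<bar>(\<kappa> - \<phi>) * wedge (y (r n) t) (u t)\<bar> \<le> e * (M * norm (u t))"
              unfolding abs_mult using bounds e M
              by (intro mult_mono order_trans[OF abs_wedge_le] mult_right_mono) auto
            also have "\<bar>\<phi> * (wedge (y (r n) t - yy t) (u t) + wedge (yy t) (u t - a t))\<bar>
                \<le> k * (e * norm (u t) + M * norm (u t - a t))"
              unfolding abs_mult using bounds k
              by (intro mult_mono order_trans[OF abs_triangle_ineq] add_mono order_trans[OF abs_wedge_le] mult_right_mono) auto
            finally show "norm (f t - h t) \<le> (e * M + k * e) * norm (u t) + k * M * norm (u t - a t)"
              by (simp add: algebra_simps)
          qed (intro continuous_intros fh uc ac)+
          also have "\<dots> = (e * M + k * e) * integral {0..1} (\<lambda>t. norm (u t)) + k * M * integral {0..1} (\<lambda>t. norm (u t - a t))"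
            by (simp add: integral_add integrable_unit continuous_intros uc ac)
          also have "\<dots> \<le> (e * M + k * e) * M + k * M * e"
            using order_trans[OF integral_norm_le_len[OF uc] uM] order_trans[OF integral_norm_le_len[OF duc], of e] elim(3) e k M
            by (intro add_mono mult_left_mono) (auto simp: \<rho>_def u_def)
          finally show ?thesis by (simp add: algebra_simps)
        qed
        have eq: "area (K (r n)) 0 u - area F 0 a =
            integral {0..1} D"
          unfolding area_def D_def by (rule integral_diff[symmetric]; intro integrable_unit area_cont K F uc ac)
        have ct: "continuous_on {0..1} D"
          unfolding D_def by (intro continuous_on_diff area_cont K F uc ac)
        show ?case
          using norm_integral_unit_le_const[OF ct bd] unfolding eq[symmetric] by (simp add: u_def)
      qed
    qed simp
    then show ?thesis by (simp only: tendsto_norm_zero_iff LIM_zero_iff)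
  qed
  show ?thesis
  proof (rule that[OF r])
    show "critical_loop F \<theta> 0 a L"
      unfolding critical_loop_def using L len(1) ac prim1 a1 na ode by auto
    show "(\<lambda>n. action (K (r n)) \<theta> 0 (v (r n))) \<longlonglongrightarrow> action F \<theta> 0 a"
      unfolding action_def len_a by (intro tendsto_intros Llim area_lim)
  qed
qed

section \<open>Critical loops for almost every parameter\<close>

text \<open>The velocity rotates with constant angular speed \<open>\<beta> = L K\<^sub>0 / \<theta>\<close>, and since it returns after unit time \<open>\<beta> \<ge> 2 \<pi>\<close>. Pairing the
equation with the curve gives \<open>\<theta> L / 2\<close> for the action.\<close>

lemma circle_action_ge:
  assumes K0: "0 < K\<^sub>0" and \<theta>: "0 < \<theta>" and loop: "critical_loop (\<lambda>_. K\<^sub>0) \<theta> 0 a L"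
  shows "pi * \<theta>\<^sup>2 / K\<^sub>0 \<le> action (\<lambda>_. K\<^sub>0) \<theta> 0 a"
proof -
  have L: "0 < L"
    and a: "continuous_on {0..1} a" "prim a 1 = 0" "a 1 = a 0" "\<And>t. t \<in> {0..1} \<Longrightarrow> norm (a t) = L"
    and ode: "\<And>t. t \<in> {0..1} \<Longrightarrow>
      (a has_vector_derivative (L / \<theta> * K\<^sub>0) *\<^sub>R (\<i> * a t)) (at t within {0..1})"
    using loop unfolding critical_loop_def by auto
  define \<beta> where "\<beta> = L / \<theta> * K\<^sub>0"
  have \<beta>: "0 < \<beta>" using K0 \<theta> L by (simp add: \<beta>_def)
  have "\<exists>c. \<forall>t\<in>{0..1}. exp (- \<i> * \<beta> * t) * a t = c"
  proof (rule has_derivative_zero_constant[OF convex_real_interval(5)])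
    fix t :: real assume t: "t \<in> {0..1}"
    have "((\<lambda>t. exp (- \<i> * \<beta> * t) * a t) has_vector_derivative
       (exp (- \<i> * \<beta> * t) * (\<beta> *\<^sub>R (\<i> * a t)) + (- \<i> * \<beta> * exp (- \<i> * \<beta> * t)) * a t)) (at t within {0..1})"
    proof (rule has_vector_derivative_mult)
      show "((\<lambda>t. exp (- \<i> * \<beta> * t)) has_vector_derivative (- \<i> * \<beta> * exp (- \<i> * \<beta> * t))) (at t within {0..1})"
        by (rule has_vector_derivative_real_field) (auto intro!: derivative_eq_intros)
    qed (use ode[OF t] in \<open>simp add: \<beta>_def\<close>)
    then show "((\<lambda>t. exp (- \<i> * \<beta> * t) * a t) has_derivative (\<lambda>h. 0)) (at t within {0..1})"
      by (simp add: has_vector_derivative_def scaleR_conv_of_real algebra_simps)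
  qed
  then obtain c where c: "\<And>t. t \<in> {0..1} \<Longrightarrow> exp (- \<i> * \<beta> * t) * a t = c" by blast
  have "exp (- \<i> * \<beta>) * a 0 = a 0" using c[of 0] c[of 1] a(3) by simp
  moreover have "a 0 \<noteq> 0" using a(4)[of 0] L by auto
  ultimately have "exp (- \<i> * \<beta>) = 1" by simp
  then obtain n :: int where n: "- \<beta> = of_int (2 * n) * pi" unfolding exp_eq_1 by auto
  then have "of_int (2 * n) * pi < 0" using \<beta> by linarith
  then have "n < 0" by (simp add: mult_less_0_iff)
  then have "1 \<le> - n" by simp
  then have "1 \<le> - real_of_int n" by linarith
  then have "2 * pi * 1 \<le> 2 * pi * (- real_of_int n)" by (intro mult_left_mono) auto
  then have \<beta>2: "2 * pi \<le> \<beta>" using n by (simp add: mult_ac)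
  have c1: "continuous_on {0..1} (\<lambda>t. wedge (prim a t) (a t))" by (intro continuous_intros prim_cont a)
  have "((\<lambda>t. L\<^sup>2 - \<beta> * wedge (prim a t) (a t)) has_integral prim a 1 \<bullet> a 1 - prim a 0 \<bullet> a 0) {0..1}"
  proof (rule fundamental_theorem_of_calculus)
    fix t :: real assume t: "t \<in> {0..1}"
    have "((\<lambda>t. prim a t \<bullet> a t) has_vector_derivative prim a t \<bullet> (\<beta> *\<^sub>R (\<i> * a t)) + a t \<bullet> a t) (at t within {0..1})"
      unfolding \<beta>_def
      by (rule bounded_bilinear.has_vector_derivative[OF bounded_bilinear_inner prim_deriv[OF a(1) t] ode[OF t]])
    moreover have "a t \<bullet> a t = L\<^sup>2" using a(4)[OF t] by (simp add: dot_square_norm)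
    ultimately show "((\<lambda>t. prim a t \<bullet> a t) has_vector_derivative L\<^sup>2 - \<beta> * wedge (prim a t) (a t)) (at t within {0..1})"
      by (simp add: wedge_inner algebra_simps)
  qed simp
  then have "integral {0..1} (\<lambda>t. L\<^sup>2 - \<beta> * wedge (prim a t) (a t)) = 0"
    using a(2) by (simp add: integral_unique)
  then have w: "integral {0..1} (\<lambda>t. wedge (prim a t) (a t)) = L\<^sup>2 / \<beta>"
    using \<beta> by (simp add: integral_diff integrable_unit c1 continuous_intros field_simps)
  have "darea (\<lambda>_. K\<^sub>0) 0 (\<lambda>t. s *\<^sub>R a t) 0 a = s * (K\<^sub>0 * (L\<^sup>2 / \<beta>))" for s
    unfolding darea_def by (simp add: w)
  then have area: "area (\<lambda>_. K\<^sub>0) 0 a = K\<^sub>0 * (L\<^sup>2 / \<beta>) / 2"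
    by (simp add: area_def integral_ident_unit)
  have "len a = sqrt (integral {0..1} (\<lambda>t::real. L\<^sup>2))"
    unfolding len_def by (intro arg_cong[of _ _ sqrt] integral_cong) (simp add: a(4))
  then have "len a = L" using L by simp
  then have act: "action (\<lambda>_. K\<^sub>0) \<theta> 0 a = \<theta> * L / 2"
    unfolding action_def area \<beta>_def using L K0 \<theta> by (simp add: field_simps power2_eq_square)
  have "2 * pi * \<theta> / K\<^sub>0 \<le> \<beta> * \<theta> / K\<^sub>0"
    using \<beta>2 \<theta> K0 by (intro divide_right_mono mult_right_mono) auto
  also have "\<dots> = L" using K0 \<theta> by (simp add: \<beta>_def)
  finally have "\<theta> / 2 * (2 * pi * \<theta> / K\<^sub>0) \<le> \<theta> / 2 * L" using \<theta> by (intro mult_left_mono) auto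
  then show ?thesis unfolding act by (simp add: power2_eq_square mult_ac)
qed

text \<open>The base point enters only through the translate of the weight, so it can be moved to the origin.\<close>

lemma translate_loop:
  "force (\<lambda>z. K (p + z)) 0 v = force K p v"
  "grad (\<lambda>z. K (p + z)) \<theta> 0 v = grad K \<theta> p v"
  "slope (\<lambda>z. K (p + z)) \<theta> 0 v = slope K \<theta> p v"
  "area (\<lambda>z. K (p + z)) 0 v = area K p v"
  "action (\<lambda>z. K (p + z)) \<theta> 0 v = action K \<theta> p v"
proof -
  show 1: "force (\<lambda>z. K (p + z)) 0 v = force K p v" by (simp add: force_def)
  show 2: "grad (\<lambda>z. K (p + z)) \<theta> 0 v = grad K \<theta> p v" by (simp add: grad_def 1 fun_eq_iff)
  show "slope (\<lambda>z. K (p + z)) \<theta> 0 v = slope K \<theta> p v" by (simp add: slope_def 1 2)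
  show 3: "area (\<lambda>z. K (p + z)) 0 v = area K p v" by (simp add: area_def darea_def)
  show "action (\<lambda>z. K (p + z)) \<theta> 0 v = action K \<theta> p v" by (simp add: action_def 3)
qed

lemma bounded_of_limit_at_infinity:
  fixes K :: "complex \<Rightarrow> real"
  assumes K: "continuous_on UNIV K" and lim: "(K \<longlongrightarrow> l) at_infinity"
  obtains k where "0 < k" "\<And>z. \<bar>K z\<bar> \<le> k"
proof -
  obtain R where R: "\<And>z. R \<le> norm z \<Longrightarrow> \<bar>K z - l\<bar> < 1"
    using tendstoD[OF lim zero_less_one] unfolding eventually_at_infinity dist_real_def by auto
  have "bounded (K ` cball 0 R)"
    by (intro compact_imp_bounded compact_continuous_image continuous_on_subset[OF K]) auto
  then obtain b where b: "\<And>z. z \<in> cball 0 R \<Longrightarrow> \<bar>K z\<bar> \<le> b"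
    unfolding bounded_iff real_norm_def by blast
  show ?thesis
  proof (rule that[of "max b (\<bar>l\<bar> + 1)"])
    fix z show "\<bar>K z\<bar> \<le> max b (\<bar>l\<bar> + 1)"
      using R[of z] b[of z] by (cases "norm z \<le> R") auto
  qed simp
qed

lemma uniformly_continuous_of_limit_at_infinity:
  fixes K :: "complex \<Rightarrow> real"
  assumes K: "continuous_on UNIV K" and lim: "(K \<longlongrightarrow> l) at_infinity"
  shows "uniformly_continuous_on UNIV K"
  unfolding uniformly_continuous_on_def
proof (intro allI impI)
  fix e :: real assume e: "0 < e"
  obtain R where R: "\<And>z. R \<le> norm z \<Longrightarrow> \<bar>K z - l\<bar> < e / 2"
    using tendstoD[OF lim, of "e / 2"] e unfolding eventually_at_infinity dist_real_def by auto
  have "uniformly_continuous_on (cball 0 (R + 1)) K"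
    by (rule compact_uniformly_continuous[OF continuous_on_subset[OF K] compact_cball]) simp
  then obtain d where d: "0 < d"
    "\<And>z z'. z \<in> cball 0 (R + 1) \<Longrightarrow> z' \<in> cball 0 (R + 1) \<Longrightarrow> dist z' z < d \<Longrightarrow> dist (K z') (K z) < e"
    unfolding uniformly_continuous_on_def using e by metis
  show "\<exists>d>0. \<forall>z\<in>UNIV. \<forall>z'\<in>UNIV. dist z' z < d \<longrightarrow> dist (K z') (K z) < e"
  proof (intro exI[of _ "min d 1"] conjI ballI impI)
    fix z z' :: complex assume dz: "dist z' z < min d 1"
    show "dist (K z') (K z) < e"
    proof (cases "R \<le> norm z \<and> R \<le> norm z'")
      case True
      then have "\<bar>K z - l\<bar> < e / 2" "\<bar>K z' - l\<bar> < e / 2" using R by auto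
      then show ?thesis unfolding dist_real_def by linarith
    next
      case False
      then have "norm z \<le> R + 1" "norm z' \<le> R + 1"
        using dz norm_triangle_sub[of z z'] norm_triangle_sub[of z' z]
        by (auto simp: dist_norm norm_minus_commute)
      then show ?thesis using d(2)[of z z'] dz by simp
    qed
  qed (use d in simp)
qed

text \<open>If almost critical loops at the level \<open>c\<close> can be found in a bounded region, their base points converge along a subsequence and the
limit is critical for \<open>K\<close>. Otherwise they can be chosen arbitrarily far out, and the limit is critical for the
constant \<open>K\<^sub>0\<close> with action exactly \<open>c\<close>, which is too small.\<close>

theorem critical_loop_exists_below_circle_level:
  assumes K: "continuous_on UNIV K" and lim: "(K \<longlongrightarrow> K\<^sub>0) at_infinity" and K0: "0 < K\<^sub>0"
    and \<theta>: "0 < \<theta>" and c: "c < pi * \<theta>\<^sup>2 / K\<^sub>0" and m: "0 < m"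
    and ps: "\<And>\<delta>. 0 < \<delta> \<Longrightarrow> \<exists>p v. almost_critical K \<theta> c m M \<delta> p v"
  shows "\<exists>p a L. critical_loop K \<theta> p a L"
proof -
  obtain k where k: "0 < k" "\<And>z. \<bar>K z\<bar> \<le> k" by (rule bounded_of_limit_at_infinity[OF K lim]) (rule that; assumption)
  have unif: "uniformly_continuous_on UNIV K" by (rule uniformly_continuous_of_limit_at_infinity[OF K lim])
  define good where "good = almost_critical K \<theta> c m M"
  note good_def = good_def[unfolded fun_eq_iff almost_critical_def, rule_format]
  have converge: "\<exists>a L. critical_loop F \<theta> 0 a L \<and> action F \<theta> 0 a = c"
    if F: "continuous_on UNIV F"
      and KF: "\<And>R e. 0 < e \<Longrightarrow> \<forall>\<^sub>F n in sequentially. \<forall>z\<in>cball 0 R. \<bar>K (p n + z) - F z\<bar> \<le> e"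
      and g: "\<And>n. good (\<delta> n) (p n) (v n)" and \<delta>: "\<delta> \<longlonglongrightarrow> 0" for F p v \<delta>
  proof -
    have Kn: "continuous_on UNIV (\<lambda>z. K (p n + z))" for n by (intro cont_comp[OF K] continuous_intros)
    have sl: "(\<lambda>n. slope (\<lambda>z. K (p n + z)) \<theta> 0 (v n)) \<longlonglongrightarrow> 0"
      unfolding translate_loop
      by (rule Lim_null_comparison[OF always_eventually \<delta>]) (use g in \<open>auto simp: good_def slope_def intro: less_imp_le\<close>)
    have g': "continuous_on {0..1} (v n)" "integral {0..1} (v n) = 0" "m \<le> len (v n)" "len (v n) \<le> M" for n
      using g[of n] by (auto simp: good_def)
    obtain r :: "nat \<Rightarrow> nat" and a L where lim: "strict_mono r" "critical_loop F \<theta> 0 a L"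
      "(\<lambda>n. action (\<lambda>z. K (p (r n) + z)) \<theta> 0 (v (r n))) \<longlonglongrightarrow> action F \<theta> 0 a"
      by (rule almost_critical_loops_converge[OF Kn k(2) k(1) F KF g'(1,2) m g'(3,4) \<theta> sl]) (assumption | rule that)+
    have "(\<lambda>n. action K \<theta> (p n) (v n)) \<longlonglongrightarrow> c"
    proof (rule LIM_zero_cancel, rule Lim_null_comparison[OF always_eventually \<delta>], rule allI)
      show "norm (action K \<theta> (p n) (v n) - c) \<le> \<delta> n" for n using g[of n] by (simp add: good_def)
    qed
    from LIMSEQ_subseq_LIMSEQ[OF this lim(1)]
    have "(\<lambda>n. action (\<lambda>z. K (p (r n) + z)) \<theta> 0 (v (r n))) \<longlonglongrightarrow> c"
      unfolding translate_loop by (simp add: o_def)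
    then have "action F \<theta> 0 a = c" using LIMSEQ_unique lim(3) by blast
    then show ?thesis using lim by blast
  qed
  have inv0: "(\<lambda>n. 1 / real (Suc n)) \<longlonglongrightarrow> 0" by (rule LIMSEQ_Suc[OF lim_1_over_n])
  show ?thesis
  proof (cases "\<exists>R. \<forall>\<delta>>0. \<exists>p v. norm p \<le> R \<and> good \<delta> p v")
    case True
    then obtain R where R: "\<And>\<delta>. 0 < \<delta> \<Longrightarrow> \<exists>p v. norm p \<le> R \<and> good \<delta> p v" by blast
    have "\<forall>n. \<exists>p v. norm p \<le> R \<and> good (1 / real (Suc n)) p v" using R by simp
    then obtain p v where pv: "\<And>n. norm (p n) \<le> R" "\<And>n. good (1 / real (Suc n)) (p n) (v n)" by metis
    have "\<forall>n. p n \<in> cball 0 R" using pv(1) by simp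
    with compact_cball[of "0::complex" R, unfolded compact_eq_seq_compact_metric seq_compact_def]
    obtain q s where s: "strict_mono (s :: nat \<Rightarrow> nat)" "(p \<circ> s) \<longlonglongrightarrow> q"
      by (metis (no_types, lifting))
    have F: "continuous_on UNIV (\<lambda>z. K (q + z))" by (intro cont_comp[OF K] continuous_intros)
    have KF: "\<forall>\<^sub>F n in sequentially. \<forall>z\<in>cball 0 R'. \<bar>K ((p \<circ> s) n + z) - K (q + z)\<bar> \<le> e" if "0 < e" for R' e
    proof -
      obtain d where d: "0 < d" "\<And>z z'. dist z' z < d \<Longrightarrow> dist (K z') (K z) < e"
        using unif \<open>0 < e\<close> unfolding uniformly_continuous_on_def by auto
      have "\<forall>\<^sub>F n in sequentially. dist ((p \<circ> s) n) q < d" by (rule tendstoD[OF s(2) d(1)])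
      then show ?thesis
      proof eventually_elim
        case (elim n)
        show ?case
        proof
          fix z :: complex
          have "dist ((p \<circ> s) n + z) (q + z) < d" using elim by (simp add: dist_norm)
          from d(2)[OF this] show "\<bar>K ((p \<circ> s) n + z) - K (q + z)\<bar> \<le> e" by (simp add: dist_real_def)
        qed
      qed
    qed
    from converge[OF F KF, of "(\<lambda>n. 1 / real (Suc n)) \<circ> s" "v \<circ> s"] LIMSEQ_subseq_LIMSEQ[OF inv0 s(1)] pv(2)
    obtain a L where "critical_loop (\<lambda>z. K (q + z)) \<theta> 0 a L"
      by (auto simp: o_def)
    then have "critical_loop K \<theta> q a L" by (simp add: critical_loop_def)
    then show ?thesis by blast
  next
    case False
    have "\<exists>\<delta> p v. \<delta> \<le> 1 / real (Suc n) \<and> real n < norm p \<and> good \<delta> p v" for n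
    proof -
      from False obtain \<delta>\<^sub>0 where \<delta>0: "0 < \<delta>\<^sub>0" "\<And>p v. norm p \<le> real n \<Longrightarrow> \<not> good \<delta>\<^sub>0 p v" by blast
      define \<delta> where "\<delta> = min \<delta>\<^sub>0 (1 / real (Suc n))"
      have "0 < \<delta>" using \<delta>0 by (simp add: \<delta>_def)
      then obtain p v where pv: "good \<delta> p v" using ps unfolding good_def almost_critical_def by blast
      then have "good \<delta>\<^sub>0 p v" by (auto simp: good_def \<delta>_def)
      then have "real n < norm p" using \<delta>0(2) by (meson not_le)
      then show ?thesis using pv by (intro exI[of _ \<delta>] exI[of _ p] exI[of _ v]) (simp add: \<delta>_def)
    qed
    then obtain \<delta> p v where pv: "\<And>n. \<delta> n \<le> 1 / real (Suc n)" "\<And>n. real n < norm (p n)" "\<And>n. good (\<delta> n) (p n) (v n)"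
      by metis
    have \<delta>: "\<delta> \<longlonglongrightarrow> 0"
    proof (rule Lim_null_comparison[OF always_eventually inv0], rule allI)
      fix n
      have "0 \<le> \<delta> n" using pv(3)[of n] abs_ge_zero[of "action K \<theta> (p n) (v n) - c"] unfolding good_def by linarith
      then show "norm (\<delta> n) \<le> 1 / real (Suc n)" using pv(1)[of n] by simp
    qed
    have KF: "\<forall>\<^sub>F n in sequentially. \<forall>z\<in>cball 0 R. \<bar>K (p n + z) - K\<^sub>0\<bar> \<le> e" if "0 < e" for R e
    proof -
      obtain B where B: "\<And>z. B \<le> norm z \<Longrightarrow> \<bar>K z - K\<^sub>0\<bar> < e"
        using tendstoD[OF lim \<open>0 < e\<close>] unfolding eventually_at_infinity dist_real_def by auto
      have "\<forall>\<^sub>F n in sequentially. B + R \<le> real n"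
        using eventually_ge_at_top[of "nat \<lceil>B + R\<rceil>"] by eventually_elim linarith
      then show ?thesis
      proof eventually_elim
        case (elim n)
        show ?case
        proof
          fix z :: complex assume "z \<in> cball 0 R"
          then have "B \<le> norm (p n + z)"
            using pv(2)[of n] elim norm_triangle_sub[of "p n" "- z"] by simp
          then show "\<bar>K (p n + z) - K\<^sub>0\<bar> \<le> e" using B by (simp add: less_imp_le)
        qed
      qed
    qed
    from converge[OF _ KF pv(3) \<delta>]
    obtain a L where a: "critical_loop (\<lambda>_. K\<^sub>0) \<theta> 0 a L" "action (\<lambda>_. K\<^sub>0) \<theta> 0 a = c"
      by auto
    have "pi * \<theta>\<^sup>2 / K\<^sub>0 \<le> action (\<lambda>_. K\<^sub>0) \<theta> 0 a" by (rule circle_action_ge[OF K0 \<theta> a(1)])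
    then show ?thesis using a(2) c by simp
  qed
qed

text \<open>The circles bound the level from above, and monotonicity in \<open>\<theta>\<close> supplies the parameters to which the previous results apply.
Paths are compared only among parameters below \<open>\<Theta>\<close>; letting \<open>\<Theta>\<close> run through the integers covers all of them.\<close>

theorem AE_critical_loop:
  assumes K: "continuous_on UNIV K" and lim: "(K \<longlongrightarrow> K\<^sub>0) at_infinity" and K0: "0 < K\<^sub>0"
    and disc: "\<And>R. \<exists>z\<^sub>0. \<forall>z\<in>cball z\<^sub>0 R. K\<^sub>0 < K z"
  shows "AE \<theta> in lborel. 0 < \<theta> \<longrightarrow> (\<exists>p a L. critical_loop K \<theta> p a L)"
proof -
  obtain k where k: "0 < k" "\<And>z. \<bar>K z\<bar> \<le> k" by (rule bounded_of_limit_at_infinity[OF K lim]) (rule that; assumption)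
  have unif: "uniformly_continuous_on UNIV K" by (rule uniformly_continuous_of_limit_at_infinity[OF K lim])
  have "AE \<theta> in lborel. 0 < \<theta> \<and> \<theta> < \<Theta> \<longrightarrow> (\<exists>p a L. critical_loop K \<theta> p a L)" if \<Theta>: "0 < \<Theta>" for \<Theta>
  proof -
    obtain P V b where path: "mountain_path K \<Theta> P V" and b: "K\<^sub>0 < b"
      and low: "\<And>s \<theta>. s \<in> {0..1} \<Longrightarrow> action K \<theta> (P s) (V s) \<le> pi * \<theta>\<^sup>2 / b"
      by (rule mountain_path_of_circles[OF K K0 \<Theta> disc]) (rule that; assumption)
    \<comment> \<open>The level as a monotone function on the whole line, extended by constants.\<close>
    define g where "g = (\<lambda>\<theta>. if \<theta> \<le> 0 then 0 else level K \<Theta> (min \<theta> \<Theta>))"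
    have "mono g"
    proof (rule monoI)
      fix x y :: real assume xy: "x \<le> y"
      have "0 \<le> level K \<Theta> (min y \<Theta>)" if "0 < y"
        using level_ge[OF K k(2,1) path, of "min y \<Theta>"] that \<Theta> k
        by (intro order_trans[OF _ level_ge[OF K k(2,1) path, of "min y \<Theta>"]]) auto
      moreover have "level K \<Theta> (min x \<Theta>) \<le> level K \<Theta> (min y \<Theta>)" if "0 < x"
        using level_mono[OF K k(2,1) path, of "min x \<Theta>" "min y \<Theta>"] that xy \<Theta> by auto
      ultimately show "g x \<le> g y" using xy by (auto simp: g_def)
    qed
    from mono_AE_bounded_difference_quotients[OF this]
    show ?thesis
    proof eventually_elim
      case (elim \<theta>)
      then obtain D where D: "\<exists>\<^sub>F n in sequentially. g (\<theta> + 1 / Suc n) - g \<theta> \<le> D * (1 / Suc n)" by blast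
      show ?case
      proof
        assume \<theta>: "0 < \<theta> \<and> \<theta> < \<Theta>"
        have quot: "\<exists>h. 0 < h \<and> h < e \<and> level K \<Theta> (\<theta> + h) \<le> level K \<Theta> \<theta> + D * h" if e: "0 < e" for e
        proof -
          have "(\<lambda>n. 1 / real (Suc n)) \<longlonglongrightarrow> 0" by (rule LIMSEQ_Suc[OF lim_1_over_n])
          then have "\<forall>\<^sub>F n in sequentially. 1 / real (Suc n) < min e (\<Theta> - \<theta>)"
            by (rule order_tendstoD(2)) (use e \<theta> in simp)
          from frequently_eventually_conj[OF D this]
          obtain n where n: "g (\<theta> + 1 / Suc n) - g \<theta> \<le> D * (1 / Suc n)" "1 / real (Suc n) < min e (\<Theta> - \<theta>)"
            using frequently_ex by (metis (mono_tags, lifting))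
          have pos: "0 < 1 / real (Suc n)" by simp
          have "g (\<theta> + 1 / Suc n) = level K \<Theta> (\<theta> + 1 / Suc n)" "g \<theta> = level K \<Theta> \<theta>"
            using \<theta> pos n(2) unfolding g_def min_def by (smt (verit))+
          then show ?thesis using n pos by (intro exI[of _ "1 / real (Suc n)"]) simp
        qed
        have "pi * \<theta>\<^sup>2 / b < pi * \<theta>\<^sup>2 / K\<^sub>0"
          using b K0 \<theta> by (intro divide_strict_left_mono) auto
        moreover have "level K \<Theta> \<theta> \<le> pi * \<theta>\<^sup>2 / b"
          by (rule level_le[OF K k(2,1) _ _ path]) (use \<theta> low in auto)
        ultimately have c: "level K \<Theta> \<theta> < pi * \<theta>\<^sup>2 / K\<^sub>0" by simp
        obtain m M where m: "0 < m"
          and ps: "\<And>\<delta>. 0 < \<delta> \<Longrightarrow> \<exists>p v. almost_critical K \<theta> (level K \<Theta> \<theta>) m M \<delta> p v"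
          by (rule almost_critical_loops[OF K k(2,1) unif path conjunct1[OF \<theta>] conjunct2[OF \<theta>]])
             (rule quot that; assumption)+
        show "\<exists>p a L. critical_loop K \<theta> p a L"
          by (rule critical_loop_exists_below_circle_level[OF K lim K0 _ c m ps]) (use \<theta> in auto)
      qed
    qed
  qed
  then have "AE \<theta> in lborel. \<forall>N::nat. 0 < \<theta> \<and> \<theta> < real (Suc N) \<longrightarrow> (\<exists>p a L. critical_loop K \<theta> p a L)"
    by (subst AE_all_countable) simp
  then show ?thesis
  proof eventually_elim
    case (elim \<theta>)
    obtain N :: nat where "\<theta> < real N" using reals_Archimedean2 by blast
    then have "\<theta> < real (Suc N)" by simp
    then show ?case using elim by blast
  qed
qed

section \<open>From critical loops to curves of prescribed curvature\<close>

lemma has_vector_derivative_Un: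
  assumes "(f has_vector_derivative f') (at x within S)" "(f has_vector_derivative f') (at x within T)"
  shows "(f has_vector_derivative f') (at x within (S \<union> T))"
  using assms unfolding has_vector_derivative_def has_derivative_within by (auto intro: Lim_Un)

text \<open>At integers the two one-sided derivatives are glued; matching values make the extension agree with a shifted copy of \<open>f\<close> on each
closed unit interval.\<close>

lemma periodic_extension_derivative:
  fixes f :: "real \<Rightarrow> 'a::real_normed_vector"
  assumes f: "\<And>t. t \<in> {0..1} \<Longrightarrow> (f has_vector_derivative f' t) (at t within {0..1})"
    and per: "f 1 = f 0" "f' 1 = f' 0"
  shows "((\<lambda>t. f (frac t)) has_vector_derivative f' (frac t)) (at t)"
proof -
  have shift: "((\<lambda>s. f (frac s)) has_vector_derivative f' (t - of_int n)) (at t within {of_int n..of_int n + 1})"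
    if t: "t \<in> {of_int n..of_int n + 1}" for n :: int and t :: real
  proof -
    have "((\<lambda>s. f (s - of_int n)) has_vector_derivative 1 *\<^sub>R f' (t - of_int n)) (at t within {of_int n..of_int n + 1})"
    proof (rule vector_diff_chain_within[of "\<lambda>s. s - of_int n" 1 t _ f, unfolded o_def])
      show "((\<lambda>s. s - of_int n) has_vector_derivative 1) (at t within {of_int n..of_int n + 1})"
        by (auto intro!: derivative_eq_intros)
      have "(\<lambda>s. s - of_int n) ` {of_int n..of_int n + 1} = {0..1::real}"
        by (auto simp: image_def intro: bexI[of _ "x + of_int n" for x])
      then show "(f has_vector_derivative f' (t - of_int n)) (at (t - of_int n) within (\<lambda>s. s - of_int n) ` {of_int n..of_int n + 1})"
        using f[of "t - of_int n"] t by simp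
    qed
    then have "((\<lambda>s. f (s - of_int n)) has_vector_derivative f' (t - of_int n)) (at t within {of_int n..of_int n + 1})"
      by simp
    then show ?thesis
    proof (rule has_vector_derivative_transform[OF t, rotated])
      fix s :: real assume s: "s \<in> {of_int n..of_int n + 1}"
      show "f (frac s) = f (s - of_int n)"
      proof (cases "s = of_int n + 1")
        case True
        then show ?thesis using per(1) by simp
      next
        case False
        then have "\<lfloor>s\<rfloor> = n" using s by (intro floor_unique) auto
        then show ?thesis by (simp add: frac_def)
      qed
    qed
  qed
  define n where "n = \<lfloor>t\<rfloor>"
  have nt: "of_int n \<le> t" "t < of_int n + 1" "frac t = t - of_int n" unfolding n_def frac_def by linarith+
  show ?thesis
  proof (cases "t = of_int n")
    case False
    then have "at t within {of_int n..of_int n + 1} = at t"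
      using nt by (intro at_within_interior) simp
    moreover have "t \<in> {of_int n..of_int n + 1}" using nt by simp
    ultimately show ?thesis using shift[of t n] unfolding nt(3) by metis
  next
    case True
    have "((\<lambda>s. f (frac s)) has_vector_derivative f' 0) (at t within {of_int n..of_int n + 1})"
      using shift[of t n] True by simp
    moreover have "((\<lambda>s. f (frac s)) has_vector_derivative f' 0) (at t within {of_int n - 1..of_int n})"
      using shift[of t "n - 1"] True per(2) by simp
    ultimately have "((\<lambda>s. f (frac s)) has_vector_derivative f' 0)
        (at t within {of_int n..of_int n + 1} \<union> {of_int n - 1..of_int n})"
      by (rule has_vector_derivative_Un)
    moreover have "at t within ({of_int n..of_int n + 1} \<union> {of_int n - 1..of_int n}) = at t"
    proof -
      have "{of_int n..of_int n + 1} \<union> {of_int n - 1..of_int n} = {of_int n - 1..(of_int n + 1 :: real)}" by auto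
      then show ?thesis using True by (simp only:) (intro at_within_interior, simp)
    qed
    moreover have "frac t = 0" using True by simp
    ultimately show ?thesis by (simp only:)
  qed
qed

definition to_plane :: "complex \<Rightarrow> real ^ 2" where
  "to_plane z = vector [Re z, Im z]"

definition from_plane :: "real ^ 2 \<Rightarrow> complex" where
  "from_plane x = Complex (x $ 1) (x $ 2)"

lemma from_plane_inverse [simp]: "from_plane (to_plane z) = z"
  by (simp add: from_plane_def to_plane_def)

lemma to_plane_inverse [simp]: "to_plane (from_plane x) = x"
  by (simp add: from_plane_def to_plane_def vec_eq_iff forall_2)

lemma inner_to_plane: "to_plane a \<bullet> to_plane b = a \<bullet> b"
  by (simp add: to_plane_def inner_vec_def sum_2 inner_complex_def)

lemma norm_to_plane [simp]: "norm (to_plane a) = norm a"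
  by (simp add: norm_eq_sqrt_inner inner_to_plane)

lemma rot90_to_plane: "rot90 (to_plane a) = to_plane (\<i> * a)"
  by (simp add: rot90_def to_plane_def)

lemma bounded_linear_to_plane: "bounded_linear to_plane"
  by (rule bounded_linear_intro[of _ 1])
     (simp_all add: to_plane_def vec_eq_iff forall_2 flip: norm_to_plane)

lemma to_plane_scaleR: "to_plane (c *\<^sub>R a) = c *\<^sub>R to_plane a"
  by (rule linear_scale[OF bounded_linear.linear[OF bounded_linear_to_plane]])

lemma to_plane_diff: "to_plane (a - b) = to_plane a - to_plane b"
  by (rule linear_diff[OF bounded_linear.linear[OF bounded_linear_to_plane]])

text \<open>The sign \<open>\<epsilon>\<close> is the direction of traversal: reversing a curve changes the sign of its curvature. Constant speed \<open>L\<close> turns the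
equation for the velocity into the prescribed curvature.\<close>

lemma F_loop_of_critical_loop:
  assumes loop: "critical_loop (\<lambda>z. K (to_plane z)) \<theta> p a L"
    and K: "continuous_on UNIV K" and \<theta>: "0 < \<theta>" and \<epsilon>: "\<epsilon> = 1 \<or> \<epsilon> = -1"
  shows "\<exists>C. F_loop (\<lambda>x. \<epsilon> / \<theta> * K x) C"
proof -
  have L: "0 < L" and a: "continuous_on {0..1} a" "prim a 1 = 0" "a 1 = a 0"
    and na: "\<And>t. t \<in> {0..1} \<Longrightarrow> norm (a t) = L"
    and ode: "\<And>t. t \<in> {0..1} \<Longrightarrow>
       (a has_vector_derivative (L / \<theta> * K (to_plane (p + prim a t))) *\<^sub>R (\<i> * a t)) (at t within {0..1})"
    using loop by (auto simp: critical_loop_def)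
  have fr: "frac t \<in> {0..1}" for t :: real using frac_lt_1[of t] frac_ge_0[of t] by simp
  define x where "x = (\<lambda>t. p + prim a (frac t))"
  define w where "w = (\<lambda>t. a (frac t))"
  define b where "b = (\<lambda>t. (L / \<theta> * K (to_plane (x t))) *\<^sub>R (\<i> * w t))"
  have x': "(x has_vector_derivative w t) (at t)" for t
    unfolding x_def w_def
    using periodic_extension_derivative[of "prim a" a t] prim_deriv[OF a(1)] a by (auto intro!: derivative_eq_intros)
  have w': "(w has_vector_derivative b t) (at t)" for t
    unfolding b_def x_def w_def
    by (rule periodic_extension_derivative[OF ode]) (use a in auto)
  define u where "u = (\<lambda>t. to_plane (x (\<epsilon> * t)))"
  define u1 where "u1 = (\<lambda>t. \<epsilon> *\<^sub>R to_plane (w (\<epsilon> * t)))"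
  define u2 where "u2 = (\<lambda>t. to_plane (b (\<epsilon> * t)))"
  have scaled: "((\<lambda>t. to_plane (f (\<epsilon> * t))) has_vector_derivative \<epsilon> *\<^sub>R to_plane f') (at t)"
    if "(f has_vector_derivative f') (at (\<epsilon> * t))" for f f' t
  proof -
    have "((\<lambda>t. \<epsilon> * t) has_vector_derivative \<epsilon>) (at t)" by (auto intro!: derivative_eq_intros)
    from bounded_linear.has_vector_derivative[OF bounded_linear_to_plane vector_diff_chain_at[OF this that]]
    show ?thesis by (simp add: o_def to_plane_scaleR)
  qed
  have u': "(u has_vector_derivative u1 t) (at t)" for t
    unfolding u_def u1_def by (rule scaled[OF x'])
  have u1': "(u1 has_vector_derivative u2 t) (at t)" for t
  proof -
    have "(u1 has_vector_derivative \<epsilon> *\<^sub>R (\<epsilon> *\<^sub>R to_plane (b (\<epsilon> * t)))) (at t)"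
      unfolding u1_def using scaled[OF w'] by (auto intro!: derivative_eq_intros)
    then show ?thesis using \<epsilon> by (auto simp: u2_def)
  qed
  have vel: "velocity u = u1" unfolding velocity_def using vector_derivative_at[OF u'] by auto
  have acc: "acceleration u = u2" unfolding acceleration_def vel using vector_derivative_at[OF u1'] by auto
  have cont: "continuous_on UNIV f" if "\<And>t. (f has_vector_derivative f' t) (at t)" for f f' :: "real \<Rightarrow> 'b::real_normed_vector"
    using has_vector_derivative_continuous[OF that] by (simp add: continuous_at_imp_continuous_on)
  have pc: "continuous_on UNIV to_plane"
    by (rule linear_continuous_on[OF bounded_linear_to_plane])
  have u2c: "continuous_on UNIV u2"
    unfolding u2_def b_def
    by (intro continuous_intros cont_comp[OF pc] cont_comp[OF K] cont_comp[OF cont[OF x']] cont_comp[OF cont[OF w']])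
  have nw: "norm (w t) = L" for t unfolding w_def by (rule na[OF fr])
  have nu1: "norm (u1 t) = L" for t using \<epsilon> nw by (auto simp: u1_def)
  have curv: "curvature u t = \<epsilon> / \<theta> * K (u t)" for t
  proof -
    define c where "c = L / \<theta> * K (u t)"
    have "acceleration u t \<bullet> rot90 (velocity u t) =
       to_plane (c *\<^sub>R (\<i> * w (\<epsilon> * t))) \<bullet> to_plane (\<i> * (\<epsilon> *\<^sub>R w (\<epsilon> * t)))"
      unfolding acc vel u1_def u2_def b_def c_def to_plane_scaleR[symmetric] rot90_to_plane
      by (simp add: u_def)
    also have "\<dots> = c * \<epsilon> * (norm (\<i> * w (\<epsilon> * t)))\<^sup>2"
      unfolding inner_to_plane power2_norm_eq_inner by simp
    also have "\<dots> = c * \<epsilon> * L\<^sup>2" by (simp add: norm_mult nw)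
    finally have "curvature u t = c * \<epsilon> * L\<^sup>2 / L ^ 3" unfolding curvature_def vel nu1 by simp
    also have "\<dots> = \<epsilon> / \<theta> * K (u t)"
      using L \<theta> by (simp add: c_def field_simps power2_eq_square power3_eq_cube)
    finally show ?thesis .
  qed
  have per: "u (t + 1) = u t" for t
  proof -
    have "frac (\<epsilon> * (t + 1)) = frac (\<epsilon> * t)"
      using \<epsilon> frac_1_eq[of t] frac_1_eq[of "- t - 1"] by auto
    then show ?thesis by (simp add: u_def x_def)
  qed
  have nonconst: "\<exists>s t. u s \<noteq> u t"
  proof (rule ccontr)
    assume "\<not> ?thesis"
    then have "u = (\<lambda>_. u 0)" by auto
    then have "(u has_vector_derivative 0) (at 0)" by (metis has_vector_derivative_const)
    then have "u1 0 = 0" using vector_derivative_unique_at[OF u'] by auto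
    then show False using nu1[of 0] L by simp
  qed
  have par: "parametrizes u (range u)"
    unfolding parametrizes_def using cont[OF u'] per nonconst by (auto intro: exI[of _ 1])
  have "regular u"
    unfolding regular_def C1_differentiable_on_def vel
    using u' cont[OF u1'] nu1 L by (metis norm_zero less_irrefl)
  moreover have "class_C2 u"
    unfolding class_C2_def C1_differentiable_on_def vel using u' cont[OF u1'] u1' u2c by blast
  ultimately show ?thesis
    unfolding F_loop_def planar_closed_curve_def using par curv by blast
qed

text \<open>Far out on a ray in the sector, a disc of fixed radius is seen from the origin under a small angle.\<close>

lemma sector_contains_discs:
  assumes r: "0 < r" and I: "open_arc I" "I \<noteq> {}"
  obtains z\<^sub>0 where "\<And>z. z \<in> cball z\<^sub>0 R \<Longrightarrow> r < norm z \<and> z /\<^sub>R norm z \<in> I"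
proof -
  obtain e where e: "e \<in> I" using I(2) by blast
  have sub: "I \<subseteq> sphere 0 1" and "\<exists>\<rho>>0. ball e \<rho> \<inter> sphere 0 1 \<subseteq> I"
    using I(1) e unfolding open_arc_def openin_contains_ball by auto
  then obtain \<rho> where \<rho>: "0 < \<rho>" "ball e \<rho> \<inter> sphere 0 1 \<subseteq> I" by blast
  have ne: "norm e = 1" using sub e by auto
  define R' where "R' = max R 0"
  \<comment> \<open>Chosen so that \<open>t - R' > r\<close> and \<open>2 R' / (t - R') < \<rho>\<close>.\<close>
  define t where "t = R' + r + 2 * R' / \<rho> + 1"
  have R': "0 \<le> R'" by (simp add: R'_def)
  have "0 \<le> 2 * R' / \<rho>" "0 < \<rho> * r" "\<rho> * (t - R') = \<rho> * r + 2 * R' + \<rho>"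
    using \<rho>(1) r R' by (simp_all add: t_def distrib_left)
  then have t: "r < t - R'" "2 * R' < \<rho> * (t - R')"
    using \<rho>(1) unfolding t_def by linarith+
  have t0: "0 \<le> t" using t(1) r R' by linarith
  show ?thesis
  proof (rule that)
    fix z assume "z \<in> cball (t *\<^sub>R e) R"
    then have d: "norm (z - t *\<^sub>R e) \<le> R'" by (simp add: dist_norm norm_minus_commute R'_def)
    have nte: "norm (t *\<^sub>R e) = t" using ne t0 by simp
    have nz: "t - R' \<le> norm z" using d nte norm_triangle_sub[of "t *\<^sub>R e" z] by (simp add: norm_minus_commute)
    have z0: "0 < norm z" using nz t(1) r by linarith
    have "norm (z /\<^sub>R norm z - e) * norm z = norm (norm z *\<^sub>R (z /\<^sub>R norm z - e))" by simp
    also have "\<dots> = norm ((z - t *\<^sub>R e) + (t - norm z) *\<^sub>R e)"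
      using z0 by (simp add: scaleR_diff_right scaleR_diff_left)
    also have "\<dots> \<le> norm (z - t *\<^sub>R e) + \<bar>t - norm z\<bar>"
      using norm_triangle_ineq[of "z - t *\<^sub>R e" "(t - norm z) *\<^sub>R e"] ne by simp
    also have "\<bar>t - norm z\<bar> \<le> R'"
      using norm_triangle_ineq3[of "t *\<^sub>R e" z] d nte by (simp add: norm_minus_commute)
    also have "norm (z - t *\<^sub>R e) + R' \<le> 2 * R'" using d by simp
    also have "\<dots> < \<rho> * (t - R')" by (rule t(2))
    also have "\<dots> \<le> \<rho> * norm z" using \<rho>(1) nz by simp
    finally have "norm (z /\<^sub>R norm z - e) < \<rho>" using z0 by simp
    then have "z /\<^sub>R norm z \<in> ball e \<rho> \<inter> sphere 0 1"
      using z0 by (simp add: dist_norm norm_minus_commute)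
    then show "r < norm z \<and> z /\<^sub>R norm z \<in> I" using \<rho>(2) nz t(1) by auto
  qed
qed

text \<open>Inversion maps null sets of positive numbers to null sets, being differentiable there.\<close>

lemma AE_nonzero_of_AE_positive:
  fixes Q :: "real \<Rightarrow> bool"
  assumes "AE \<theta> in lborel. 0 < \<theta> \<longrightarrow> Q \<theta>"
  shows "AE \<mu> in lebesgue. \<mu> \<noteq> 0 \<longrightarrow> Q (1 / \<bar>\<mu>\<bar>)"
proof -
  have "AE \<theta> in lebesgue. 0 < \<theta> \<longrightarrow> Q \<theta>" using assms by (rule AE_completion)
  then obtain N where N: "{\<theta>. \<not> (0 < \<theta> \<longrightarrow> Q \<theta>)} \<subseteq> N" "N \<in> null_sets lebesgue"
    unfolding eventually_ae_filter by auto
  define B where "B = {\<theta>. 0 < \<theta> \<and> \<not> Q \<theta>}"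
  have "B \<subseteq> N" using N(1) by (auto simp: B_def)
  then have B: "negligible B" using N(2) negligible_iff_null_sets negligible_subset by blast
  have "negligible ((\<lambda>x. 1 / x) ` B)" "negligible ((\<lambda>x. - 1 / x) ` B)"
    by (rule negligible_differentiable_image_negligible[OF order_refl B];
        force simp: B_def differentiable_on_def intro!: derivative_intros)+
  then have "(\<lambda>x. 1 / x) ` B \<union> (\<lambda>x. - 1 / x) ` B \<in> null_sets lebesgue"
    using negligible_Un negligible_iff_null_sets by blast
  from AE_not_in[OF this] show ?thesis
  proof eventually_elim
    case (elim \<mu>)
    show ?case
    proof (rule impI, rule ccontr)
      assume \<mu>: "\<mu> \<noteq> 0" "\<not> Q (1 / \<bar>\<mu>\<bar>)"
      then have "1 / \<bar>\<mu>\<bar> \<in> B" by (simp add: B_def)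
      moreover have "\<mu> = 1 / (1 / \<bar>\<mu>\<bar>) \<or> \<mu> = - 1 / (1 / \<bar>\<mu>\<bar>)" by (auto simp: abs_if)
      ultimately show False using elim by blast
    qed
  qed
qed

theorem theorem1p2:
  fixes K K\<^sub>1 :: "real ^ 2 \<Rightarrow> real" and K\<^sub>0 r :: real and I :: "(real ^ 2) set"
  assumes "continuous_on UNIV K"
    and "\<And>z. K z = K\<^sub>0 + K\<^sub>1 z"
    and "K\<^sub>0 \<noteq> 0"
    and "(K\<^sub>1 \<longlongrightarrow> 0) at_infinity"
    and "r > 0"
    and "open_arc I"
    and "I \<noteq> {}"
    and "\<And>z. norm z > r \<Longrightarrow> z /\<^sub>R norm z \<in> I \<Longrightarrow> K\<^sub>0 * K\<^sub>1 z > 0"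
  shows "AE \<mu> in lebesgue. \<mu> \<noteq> 0 \<longrightarrow> (\<exists>C. F_loop (\<lambda>z. \<mu> * K z) C)"
proof -
  \<comment> \<open>Normalises the limit at infinity to be positive; the sign is absorbed into the orientation at the end.\<close>
  define s where "s = sgn K\<^sub>0"
  have s: "s = 1 \<or> s = -1" "s * K\<^sub>0 = \<bar>K\<^sub>0\<bar>" using assms(3) by (auto simp: s_def sgn_if)
  define H where "H = (\<lambda>x. s * K x)"
  define G where "G = (\<lambda>z. H (to_plane z))"
  have H: "continuous_on UNIV H" unfolding H_def by (intro continuous_intros assms)
  have G: "continuous_on UNIV G"
    unfolding G_def by (intro cont_comp[OF H] linear_continuous_on bounded_linear_to_plane)
  have "(G \<longlongrightarrow> \<bar>K\<^sub>0\<bar>) at_infinity"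
  proof (rule tendstoI)
    fix e :: real assume "0 < e"
    then obtain b where b: "\<And>x. b \<le> norm x \<Longrightarrow> \<bar>K\<^sub>1 x\<bar> < e"
      using tendstoD[OF assms(4)] unfolding eventually_at_infinity by (auto simp: dist_real_def)
    have "dist (G z) \<bar>K\<^sub>0\<bar> < e" if "b \<le> norm z" for z
    proof -
      have "G z = \<bar>K\<^sub>0\<bar> + s * K\<^sub>1 (to_plane z)"
        using s(2) by (simp add: G_def H_def assms(2) distrib_left)
      moreover have "\<bar>s * K\<^sub>1 (to_plane z)\<bar> < e"
        using s(1) b[of "to_plane z"] that by auto
      ultimately show ?thesis by (simp add: dist_real_def)
    qed
    then show "\<forall>\<^sub>F z in at_infinity. dist (G z) \<bar>K\<^sub>0\<bar> < e" unfolding eventually_at_infinity by blast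
  qed
  moreover have "\<exists>z\<^sub>0. \<forall>z\<in>cball z\<^sub>0 R. \<bar>K\<^sub>0\<bar> < G z" for R
  proof -
    obtain x\<^sub>0 where x0: "\<And>x. x \<in> cball x\<^sub>0 R \<Longrightarrow> r < norm x \<and> x /\<^sub>R norm x \<in> I"
      by (rule sector_contains_discs[OF assms(5-7)]) (rule that; assumption)
    show ?thesis
    proof (intro exI[of _ "from_plane x\<^sub>0"] ballI)
      fix z assume "z \<in> cball (from_plane x\<^sub>0) R"
      then have "to_plane z \<in> cball x\<^sub>0 R"
        using norm_to_plane[of "from_plane x\<^sub>0 - z"] by (simp add: dist_norm to_plane_diff)
      then have "0 < K\<^sub>0 * K\<^sub>1 (to_plane z)" using x0 assms(8) by blast
      then have "0 < s * K\<^sub>1 (to_plane z)"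
        unfolding s_def by (auto simp: sgn_if zero_less_mult_iff)
      then show "\<bar>K\<^sub>0\<bar> < G z" using s(2) by (simp add: G_def H_def assms(2) distrib_left)
    qed
  qed
  ultimately have "AE \<theta> in lborel. 0 < \<theta> \<longrightarrow> (\<exists>p a L. critical_loop G \<theta> p a L)"
    using assms(3) by (intro AE_critical_loop G) auto
  from AE_nonzero_of_AE_positive[OF this] show ?thesis
  proof eventually_elim
    case (elim \<mu>)
    show ?case
    proof
      assume \<mu>: "\<mu> \<noteq> 0"
      then obtain p a L where "critical_loop (\<lambda>z. H (to_plane z)) (1 / \<bar>\<mu>\<bar>) p a L"
        using elim unfolding G_def by blast
      moreover have "0 < 1 / \<bar>\<mu>\<bar>" "sgn \<mu> * s = 1 \<or> sgn \<mu> * s = - 1"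
        using \<mu> s(1) by (auto simp: sgn_if)
      ultimately obtain C where C: "F_loop (\<lambda>x. sgn \<mu> * s / (1 / \<bar>\<mu>\<bar>) * H x) C"
        using F_loop_of_critical_loop[OF _ H] by blast
      have "(\<lambda>x. sgn \<mu> * s / (1 / \<bar>\<mu>\<bar>) * H x) = (\<lambda>x. \<mu> * K x)"
        using s(1) by (auto simp: H_def sgn_if abs_if fun_eq_iff)
      then show "\<exists>C. F_loop (\<lambda>z. \<mu> * K z) C" using C by auto
    qed
  qed
qed

end
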